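(* Let $S$ be a complete monotiled surface in $\mathbb{R}^3$ tiled by a 3-edge tile of Type 4. Then the group $G$ of rotations generated by the three rotations $R_\alpha$, $R_\beta$ and $R_\gamma$, of angle $\pi$, around the symmetry axes of the three edges $\alpha,\beta,\gamma$ of the tile, acts transitively on the tiles of $S$. The composition $R=R_\beta R_\gamma R_\alpha$ is of finite order.
   Context: Tilings. Let $S$ be a closed, connected, $C^k$-embedded surface in $\mathbb{R}^3$ ($k\ge1$). $S$ is monotiled by the prototile $T$ if $S=\bigcup_{i=1}^m T_i$, $m\in\mathbb{N}\cup\{\infty\}$, where: $T$ is homeomorphic to a closed disc; distinct tiles $T_i$ intersect only in subsets of their boundaries and any tile intersects only finitely many others; each $T_i$ is congruent to $T$ via a rigid motion of $\mathbb{R}^3$. The tiling is oriented if $S$ is oriented and all rigid motions $T\to T_i$ are orientation preserving. All tilings here are oriented monotilings. Complete surfaces have no boundary. Edges. An interior tile of a tiled surface is one containing no boundary points of the surface. A corona for $T$ is a monotileable surface made of congruent copies $T_i$ of $T$, each meeting $T$, with $T$ as an interior tile. $T$ is of finite edge type if it can be an interior tile of a $C^k$ surface tiled by copies of itself and there is only a finite number of ways to form a corona for $T$. An edge of $T$ is a closed curve segment of $\partial T$, other than a point, that is a connected component of the intersection of two tiles in some corona; its endpoints are vertices (corners) of $T$. Orient $\partial T$ anticlockwise and parameterize edges accordingly. Write $e_1\equiv e_2$ if there is a rigid motion mapping the (oriented) edge $e_1$ to $e_2$ and preserving the surface normal along the edge. Greek letters denote self-congruent edges, i.e. edges congruent to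 their own reverse; such an edge is preserved by a unique rotation of angle $\pi$ about an axis (its symmetry axis) through the midpoint of the segment joining its endpoints, which interchanges the endpoints. Identical letters denote congruent edges; different letters denote geometrically distinct (non-congruent) edges. 3-edge tile of Type 4. A finite edge type prototile with three edges of type $\alpha\,\beta\,\gamma$: three self-congruent edges which are pairwise geometrically distinct. *)

theory Defs
  imports
    "HOL-Analysis.Analysis"
    "HOL-Complex_Analysis.Winding_Numbers"
    "HOL-Algebra.Generated_Groups"
    "HOL-Algebra.Group_Action"
begin

text \<open>Continuity of all iterated directional derivatives; intended for open domains.\<close>

fun times_cont_diff_on ::
  "nat \<Rightarrow> ('a::real_normed_vector \<Rightarrow> 'b::real_normed_vector) \<Rightarrow> 'a set \<Rightarrow> bool" where
  "times_cont_diff_on 0 f U \<longleftrightarrow> continuous_on U f"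
| "times_cont_diff_on (Suc n) f U \<longleftrightarrow>
     (\<forall>x\<in>U. f differentiable (at x)) \<and>
     (\<forall>v. times_cont_diff_on n (\<lambda>x. frechet_derivative f (at x) v) U)"

definition Ck_on ::
  "enat \<Rightarrow> ('a::real_normed_vector \<Rightarrow> 'b::real_normed_vector) \<Rightarrow> 'a set \<Rightarrow> bool" where
  "Ck_on k f U \<longleftrightarrow> (\<forall>n. enat n \<le> k \<longrightarrow> times_cont_diff_on n f U)"

definition surface_param :: "enat \<Rightarrow> (real^2 \<Rightarrow> real^3) \<Rightarrow> (real^2) set \<Rightarrow> bool" where
  "surface_param k \<phi> V \<longleftrightarrow>
     open V \<and> Ck_on k \<phi> V \<and>
     (\<forall>x\<in>V. inj (frechet_derivative \<phi> (at x))) \<and>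
     (\<exists>\<psi>. homeomorphism V (\<phi> ` V) \<phi> \<psi>)"

definition surface_interior :: "enat \<Rightarrow> (real^3) set \<Rightarrow> (real^3) set" where
  "surface_interior k S =
     {p \<in> S. \<exists>\<phi> V. surface_param k \<phi> V \<and> p \<in> \<phi> ` V \<and> openin (top_of_set S) (\<phi> ` V)}"

definition surface_boundary :: "enat \<Rightarrow> (real^3) set \<Rightarrow> (real^3) set" where
  "surface_boundary k S = S - surface_interior k S"

text \<open>Closed connected embedded surfaces, possibly with boundary.  The boundary of a union of
  tiles has corners, and two tiles of a corona may touch in a boundary point, so no regularity of
  the boundary is required: near a boundary point the surface is only a part of some embedded
  \<open>C\<^sup>k\<close> surface.  The last conjunct excludes pieces of lower dimension.\<close>

definition Ck_surface :: "enat \<Rightarrow> (real^3) set \<Rightarrow> bool" where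
  "Ck_surface k S \<longleftrightarrow>
     S \<noteq> {} \<and> closed S \<and> connected S \<and>
     (\<forall>p\<in>S. \<exists>U \<phi> V. open U \<and> p \<in> U \<and> surface_param k \<phi> V \<and> S \<inter> U \<subseteq> \<phi> ` V) \<and>
     S \<subseteq> closure (surface_interior k S)"

definition complete_surface :: "enat \<Rightarrow> (real^3) set \<Rightarrow> bool" where
  "complete_surface k S \<longleftrightarrow> Ck_surface k S \<and> surface_boundary k S = {}"

text \<open>An orientation is a continuous unit normal field.  Orthogonality to the tangent plane is
  imposed at interior points only; at boundary points the normal is determined by continuity.\<close>

definition unit_normal :: "enat \<Rightarrow> (real^3) set \<Rightarrow> (real^3 \<Rightarrow> real^3) \<Rightarrow> bool" where
  "unit_normal k S N \<longleftrightarrow>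
     continuous_on S N \<and> (\<forall>p\<in>S. norm (N p) = 1) \<and>
     (\<forall>\<phi> V. surface_param k \<phi> V \<and> \<phi> ` V \<subseteq> S \<longrightarrow>
        (\<forall>x\<in>V. \<forall>w. N (\<phi> x) \<bullet> frechet_derivative \<phi> (at x) w = 0))"

definition rigid_motion :: "(real^3 \<Rightarrow> real^3) \<Rightarrow> bool" where
  "rigid_motion g \<longleftrightarrow> (\<exists>A b. rotation_matrix A \<and> g = (\<lambda>x. A *v x + b))"

definition linear_part :: "(real^3 \<Rightarrow> real^3) \<Rightarrow> real^3 \<Rightarrow> real^3" where
  "linear_part g v = g v - g 0"

text \<open>By invariance of domain the boundary circle does not depend on the homeomorphism.\<close>

definition disc_boundary :: "(real^3) set \<Rightarrow> (real^3) set" where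
  "disc_boundary T =
     \<Union>{h ` sphere 0 1 | h. \<exists>h'. homeomorphism (cball (0::complex) 1) T h h'}"

text \<open>Oriented monotiling of the surface \<open>S\<close>, oriented by \<open>N\<close>, by the set \<open>\<T>\<close> of tiles, with
  prototile \<open>T\<close> oriented by the normal field \<open>n\<close>.  A rigid motion is proper, so it preserves
  the orientations of \<open>T\<close> and of its image in \<open>S\<close> iff it carries \<open>n\<close> to \<open>N\<close>.\<close>

definition oriented_monotiling ::
  "enat \<Rightarrow> (real^3) set \<Rightarrow> (real^3 \<Rightarrow> real^3) \<Rightarrow> (real^3) set set \<Rightarrow>
   (real^3) set \<Rightarrow> (real^3 \<Rightarrow> real^3) \<Rightarrow> bool" where
  "oriented_monotiling k S N \<T> T n \<longleftrightarrow>
     Ck_surface k S \<and> unit_normal k S N \<and>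
     T homeomorphic cball (0::complex) 1 \<and>
     countable \<T> \<and> S = \<Union>\<T> \<and>
     (\<forall>A\<in>\<T>. \<forall>B\<in>\<T>. A \<noteq> B \<longrightarrow> A \<inter> B \<subseteq> disc_boundary A \<inter> disc_boundary B) \<and>
     (\<forall>A\<in>\<T>. finite {B \<in> \<T>. B \<noteq> A \<and> A \<inter> B \<noteq> {}}) \<and>
     (\<forall>A\<in>\<T>. \<exists>g. rigid_motion g \<and> g ` T = A \<and> (\<forall>x\<in>T. linear_part g (n x) = N (g x)))"

definition interior_tile :: "enat \<Rightarrow> (real^3) set \<Rightarrow> (real^3) set set \<Rightarrow> (real^3) set \<Rightarrow> bool" where
  "interior_tile k S \<T> T \<longleftrightarrow> T \<in> \<T> \<and> T \<inter> surface_boundary k S = {}"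

text \<open>A corona is represented by its set of tiles.\<close>

definition corona ::
  "enat \<Rightarrow> (real^3) set \<Rightarrow> (real^3 \<Rightarrow> real^3) \<Rightarrow> (real^3) set set \<Rightarrow> bool" where
  "corona k T n \<C> \<longleftrightarrow>
     (\<exists>N. oriented_monotiling k (\<Union>\<C>) N \<C> T n \<and> (\<forall>x\<in>T. N x = n x)) \<and>
     interior_tile k (\<Union>\<C>) \<C> T \<and>
     (\<forall>A\<in>\<C>. A \<inter> T \<noteq> {})"

definition finite_edge_type :: "enat \<Rightarrow> (real^3) set \<Rightarrow> (real^3 \<Rightarrow> real^3) \<Rightarrow> bool" where
  "finite_edge_type k T n \<longleftrightarrow>
     (\<exists>S N \<T>. oriented_monotiling k S N \<T> T n \<and> interior_tile k S \<T> T) \<and>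
     finite {\<C>. corona k T n \<C>}"

definition tile_edges :: "enat \<Rightarrow> (real^3) set \<Rightarrow> (real^3 \<Rightarrow> real^3) \<Rightarrow> (real^3) set set" where
  "tile_edges k T n =
     {E. E \<subseteq> disc_boundary T \<and> (\<exists>e. arc e \<and> path_image e = E) \<and>
         (\<exists>\<C> A B. corona k T n \<C> \<and> A \<in> \<C> \<and> B \<in> \<C> \<and> A \<noteq> B \<and> E \<in> components (A \<inter> B))}"

text \<open>\<open>c\<close> runs once around the boundary of the disc \<open>T\<close>, anticlockwise as seen from the tip of
  the normal \<open>n\<close>.  It is the boundary value of a parameterization \<open>h\<close> of \<open>T\<close> by the unit disc
  which preserves orientation: projected to the tangent plane at \<open>h z\<close>, whose orthonormal frame
  \<open>u, v\<close> is positive with respect to \<open>n\<close>, the images of small circles about \<open>z\<close> have winding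
  number 1.\<close>

definition anticlockwise_boundary ::
  "(real^3) set \<Rightarrow> (real^3 \<Rightarrow> real^3) \<Rightarrow> (real \<Rightarrow> real^3) \<Rightarrow> bool" where
  "anticlockwise_boundary T n c \<longleftrightarrow>
     (\<exists>h h'. homeomorphism (cball (0::complex) 1) T h h' \<and>
        (\<forall>t\<in>{0..1}. c t = h (circlepath 0 1 t)) \<and>
        (\<forall>z\<in>ball 0 1. \<forall>u v. norm u = 1 \<and> norm v = 1 \<and> u \<bullet> v = 0 \<and> cross3 u v = n (h z) \<longrightarrow>
           (\<forall>\<^sub>F r in at_right 0.
              winding_number
                (\<lambda>t. Complex ((h (circlepath z r t) - h z) \<bullet> u) ((h (circlepath z r t) - h z) \<bullet> v))
                0 = 1)))"

text \<open>An oriented edge is an arc up to reparameterization; the motion \<open>g\<close> takes the oriented edge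
  \<open>e\<^sub>1\<close> to \<open>e\<^sub>2\<close>, and the surface normal \<open>n\<close> along \<open>e\<^sub>1\<close> to that along \<open>e\<^sub>2\<close>.\<close>

definition maps_edge ::
  "(real^3 \<Rightarrow> real^3) \<Rightarrow> (real^3 \<Rightarrow> real^3) \<Rightarrow> (real \<Rightarrow> real^3) \<Rightarrow> (real \<Rightarrow> real^3) \<Rightarrow> bool" where
  "maps_edge n g e\<^sub>1 e\<^sub>2 \<longleftrightarrow>
     g ` path_image e\<^sub>1 = path_image e\<^sub>2 \<and>
     g (pathstart e\<^sub>1) = pathstart e\<^sub>2 \<and> g (pathfinish e\<^sub>1) = pathfinish e\<^sub>2 \<and>
     (\<forall>x\<in>path_image e\<^sub>1. linear_part g (n x) = n (g x))"

definition edge_congruent ::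
  "(real^3 \<Rightarrow> real^3) \<Rightarrow> (real \<Rightarrow> real^3) \<Rightarrow> (real \<Rightarrow> real^3) \<Rightarrow> bool" where
  "edge_congruent n e\<^sub>1 e\<^sub>2 \<longleftrightarrow> (\<exists>g. rigid_motion g \<and> maps_edge n g e\<^sub>1 e\<^sub>2)"

definition self_congruent :: "(real^3 \<Rightarrow> real^3) \<Rightarrow> (real \<Rightarrow> real^3) \<Rightarrow> bool" where
  "self_congruent n e \<longleftrightarrow> edge_congruent n e (reversepath e)"

text \<open>Rotation of angle \<open>\<pi>\<close> about the line through \<open>a\<close> with unit direction \<open>u\<close>.\<close>

definition half_turn :: "real^3 \<Rightarrow> real^3 \<Rightarrow> real^3 \<Rightarrow> real^3" where
  "half_turn a u x = a + 2 *\<^sub>R (((x - a) \<bullet> u) *\<^sub>R u) - (x - a)"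

text \<open>The half-turn about the symmetry axis of a self-congruent edge.  For a straight edge,
  uniqueness depends on the requirement on the normal that is part of \<^const>\<open>maps_edge\<close>.\<close>

definition edge_rotation :: "(real^3 \<Rightarrow> real^3) \<Rightarrow> (real \<Rightarrow> real^3) \<Rightarrow> real^3 \<Rightarrow> real^3" where
  "edge_rotation n e =
     (THE R. (\<exists>u. norm u = 1 \<and> R = half_turn (midpoint (pathstart e) (pathfinish e)) u) \<and>
             maps_edge n R e (reversepath e))"

definition three_edge_tile_type4 ::
  "enat \<Rightarrow> (real^3) set \<Rightarrow> (real^3 \<Rightarrow> real^3) \<Rightarrow>
   (real \<Rightarrow> real^3) \<Rightarrow> (real \<Rightarrow> real^3) \<Rightarrow> (real \<Rightarrow> real^3) \<Rightarrow> bool" where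
  "three_edge_tile_type4 k T n \<alpha> \<beta> \<gamma> \<longleftrightarrow>
     finite_edge_type k T n \<and>
     arc \<alpha> \<and> arc \<beta> \<and> arc \<gamma> \<and>
     pathfinish \<alpha> = pathstart \<beta> \<and> pathfinish \<beta> = pathstart \<gamma> \<and> pathfinish \<gamma> = pathstart \<alpha> \<and>
     anticlockwise_boundary T n (\<alpha> +++ \<beta> +++ \<gamma>) \<and>
     tile_edges k T n = {path_image \<alpha>, path_image \<beta>, path_image \<gamma>} \<and>
     self_congruent n \<alpha> \<and> self_congruent n \<beta> \<and> self_congruent n \<gamma> \<and>
     \<not> edge_congruent n \<alpha> \<beta> \<and> \<not> edge_congruent n \<beta> \<gamma> \<and> \<not> edge_congruent n \<gamma> \<alpha>"

definition generated_group :: "(real^3 \<Rightarrow> real^3) set \<Rightarrow> (real^3 \<Rightarrow> real^3) monoid" where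
  "generated_group X = (BijGroup UNIV)\<lparr>carrier := generate (BijGroup UNIV) X\<rparr>"

end

theory Submission
  imports Defs "HOL-Complex_Analysis.Great_Picard"
begin

text \<open>
  Across an edge \<open>e\<close> the tile \<open>T\<close> has exactly one neighbour \<open>B\<close>. The motion that places \<open>B\<close> back onto
  \<open>T\<close> moves the whole tiling to another tiling containing \<open>T\<close>, and carries \<open>e\<close> to a common edge of
  \<open>T\<close> and one of its neighbours there. As the three edges are pairwise not congruent, this edge is \<open>e\<close>
  itself, and as a motion is determined by what it does to the ends of an edge and to the normals
  along it, the motion is the half-turn \<open>R e\<close>. So the neighbours of \<open>T\<close> across its edges are \<open>R \<alpha> ` T\<close>,
  \<open>R \<beta> ` T\<close> and \<open>R \<gamma> ` T\<close> (\<open>neighbour_across_edge\<close>), and those of a tile \<open>g ` T\<close> are the tiles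
  \<open>(g \<circ> R e) ` T\<close>. The tiles \<open>g ` T\<close> with \<open>g\<close> in the group are therefore closed under passing to
  neighbours across edges. Their union and the union of the other tiles can only meet in vertices;
  vertices are countable, a countable set does not separate a surface, and the surface is connected,
  so there are no other tiles (\<open>rotations_transitive\<close>). Finally \<open>R \<beta> \<circ> R \<gamma> \<circ> R \<alpha>\<close> fixes the vertex between
  \<open>\<alpha>\<close> and \<open>\<beta>\<close>. Its powers place \<open>T\<close> onto tiles at that vertex, of which there are finitely many, and a
  motion placing \<open>T\<close> is determined by its image of \<open>T\<close>, so some positive power is the identity
  (\<open>tile_finite_order\<close>).

  Three points need more than this sketch.

  Local finiteness: each tile meets finitely many others, but tiles could accumulate at a point. If
  they did, the motions placing them would converge along a subsequence, and by Brouwer's fixed point theorem the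
  limit of the images of an interior point of \<open>T\<close> would be interior to several of the tiles
  (\<open>locally_finite_tiling\<close>). Consequently unions of tiles are closed, and the tiles meeting \<open>T\<close> form a corona.

  Neighbours across edges: edges are defined by arbitrary coronas, so it has to be shown that in
  each of them an edge is a component of the intersection of \<open>T\<close> with some other tile. The other tiles
  cover the boundary of \<open>T\<close> by finitely many closed sets, and the component around an
  open piece of the edge is again an edge, hence the same one (\<open>corona_edge_neighbour\<close>). This uses that a
  component is an arc, which fails exactly if \<open>T\<close> and the other tile share their whole boundary.

  Spheres made of two tiles: it remains to exclude that \<open>T\<close> and a tile \<open>g ` T\<close> share their
  whole boundary circle, while another corona has arcs as edges (\<open>no_other_corona\<close>). In that corona
  the tile \<open>A\<close> next to \<open>T\<close> at a boundary point \<open>p\<close> lies on the side of \<open>T\<close> that \<open>g ` T\<close> fills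
  completely near \<open>p\<close>. So, projected along the normal at \<open>p\<close>, the part of \<open>A\<close> near \<open>p\<close> covers at most
  the region covered by \<open>g ` T\<close>, and less of it by a definite volume if \<open>p\<close> is close to an end of the arc
  shared by \<open>T\<close> and \<open>A\<close>. As \<open>A\<close> and \<open>g ` T\<close> are both copies of \<open>T\<close>, pulling both back to \<open>T\<close> compares
  the volume at one boundary point of \<open>T\<close> to that at another. Following the boundary
  from the point, the comparison persists up to the end of the arc, where it is strict. So the list of
  rounded volumes at successive points along the boundary decreases lexicographically, and this can
  be repeated without end, which is impossible.
\<close>

section \<open>Rigid motions\<close>

abbreviation motion_inv :: "(real^3 \<Rightarrow> real^3) \<Rightarrow> real^3 \<Rightarrow> real^3" where
  "motion_inv g \<equiv> inv_into UNIV g"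

lemma rigid_motionE:
  assumes "rigid_motion g"
  obtains A b where "orthogonal_matrix A" "det A = 1" "g = (\<lambda>x. A *v x + b)"
    "linear_part g = (*v) A"
proof -
  obtain A b where A: "rotation_matrix A" "g = (\<lambda>x. A *v x + b)"
    using assms unfolding rigid_motion_def by blast
  have "linear_part g = (*v) A"
    by (rule ext) (simp add: linear_part_def A(2) matrix_vector_mult_0_right)
  with A that show thesis
    unfolding rotation_matrix_def by blast
qed

lemma linear_linear_part:
  assumes "rigid_motion g"
  shows "linear (linear_part g)"
  using assms by (elim rigid_motionE) simp

lemma linear_part_diff:
  assumes "rigid_motion g"
  shows "linear_part g (x - y) = g x - g y"
  using assms by (elim rigid_motionE) (simp add: matrix_vector_mult_diff_distrib)

lemma orthogonal_transformation_linear_part: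
  assumes "rigid_motion g"
  shows "orthogonal_transformation (linear_part g)"
  using assms by (elim rigid_motionE) (simp add: orthogonal_transformation_matrix)

lemma inner_linear_part:
  assumes "rigid_motion g"
  shows "linear_part g x \<bullet> linear_part g y = x \<bullet> y"
  using orthogonal_transformation_linear_part[OF assms]
  by (simp add: orthogonal_transformation_def)

lemma norm_linear_part:
  assumes "rigid_motion g"
  shows "norm (linear_part g x) = norm x"
  using orthogonal_transformation_linear_part[OF assms] by (rule orthogonal_transformation_norm)

lemma dist_rigid_motion:
  assumes "rigid_motion g"
  shows "dist (g x) (g y) = dist x y"
  by (metis assms dist_norm linear_part_diff norm_linear_part)

lemma inj_rigid_motion: "rigid_motion g \<Longrightarrow> inj g"
  by (metis dist_rigid_motion dist_eq_0_iff injI)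

lemma rigid_motion_image_iff: "rigid_motion g \<Longrightarrow> g x \<in> g ` A \<longleftrightarrow> x \<in> A"
  by (simp add: inj_image_mem_iff inj_rigid_motion)

lemma rigid_motion_id: "rigid_motion id"
  unfolding rigid_motion_def rotation_matrix_def
  by (rule exI[of _ "mat 1"], rule exI[of _ 0]) (auto simp: orthogonal_matrix_id)

lemma rigid_motion_comp:
  assumes "rigid_motion f" "rigid_motion g"
  shows "rigid_motion (f \<circ> g)" and "linear_part (f \<circ> g) = linear_part f \<circ> linear_part g"
proof -
  obtain A b where A: "orthogonal_matrix A" "det A = 1" "f = (\<lambda>x. A *v x + b)" "linear_part f = (*v) A"
    using assms(1) by (rule rigid_motionE)
  obtain B c where B: "orthogonal_matrix B" "det B = 1" "g = (\<lambda>x. B *v x + c)" "linear_part g = (*v) B"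
    using assms(2) by (rule rigid_motionE)
  have eq: "f \<circ> g = (\<lambda>x. (A ** B) *v x + (A *v c + b))"
    by (rule ext) (simp add: A(3) B(3) matrix_vector_right_distrib matrix_vector_mul_assoc)
  have "rotation_matrix (A ** B)"
    using A B by (simp add: rotation_matrix_def orthogonal_matrix_mul det_mul)
  then show "rigid_motion (f \<circ> g)"
    unfolding rigid_motion_def eq by blast
  show "linear_part (f \<circ> g) = linear_part f \<circ> linear_part g"
    by (rule ext) (simp add: linear_part_def A(3) B(3) matrix_vector_right_distrib
        matrix_vector_mult_diff_distrib)
qed

lemma rigid_motion_inverse:
  assumes "rigid_motion g"
  obtains g' where "rigid_motion g'" "g' \<circ> g = id" "g \<circ> g' = id"
    "\<And>v. linear_part g' (linear_part g v) = v" "\<And>v. linear_part g (linear_part g' v) = v"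
proof -
  obtain A b where A: "orthogonal_matrix A" "det A = 1" "g = (\<lambda>x. A *v x + b)" "linear_part g = (*v) A"
    using assms by (rule rigid_motionE)
  define B where "B = transpose A"
  define g' where "g' = (\<lambda>x. B *v x + (- (B *v b)))"
  have "rotation_matrix B"
    using A by (simp add: rotation_matrix_def orthogonal_matrix_transpose det_transpose B_def)
  then have r: "rigid_motion g'"
    unfolding rigid_motion_def g'_def by blast
  have t: "B ** A = mat 1" "A ** B = mat 1"
    using A(1) by (auto simp: orthogonal_matrix_def B_def)
  have 1: "g' \<circ> g = id"
    by (rule ext) (simp add: g'_def A(3) matrix_vector_right_distrib matrix_vector_mul_assoc t)
  have 2: "g \<circ> g' = id"
    by (rule ext) (simp add: g'_def A(3) matrix_vector_mul_assoc t matrix_vector_mult_diff_distrib)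
  have l: "linear_part id = id"
    by (rule ext) (simp add: linear_part_def)
  show thesis
  proof (rule that[OF r 1 2])
    show "linear_part g' (linear_part g v) = v" for v
      using rigid_motion_comp(2)[OF r assms] by (metis 1 comp_apply id_apply l)
    show "linear_part g (linear_part g' v) = v" for v
      using rigid_motion_comp(2)[OF assms r] by (metis 2 comp_apply id_apply l)
  qed
qed

lemma homeomorphism_rigid_motion:
  assumes "rigid_motion g"
  shows "homeomorphism X (g ` X) g (motion_inv g)"
proof -
  obtain g' where g': "rigid_motion g'" "g' \<circ> g = id" "g \<circ> g' = id"
    using assms by (rule rigid_motion_inverse)
  have inv: "motion_inv g = g'"
    by (metis g'(2,3) inv_unique_comp)
  have c: "continuous_on Y f" if "rigid_motion f" for f :: "real^3 \<Rightarrow> real^3" and Y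
    using that by (elim rigid_motionE) (auto intro!: continuous_intros matrix_vector_mult_linear_continuous_on)
  show ?thesis
    unfolding homeomorphism_def inv
    using c[OF assms] c[OF g'(1)] g' by (auto simp: fun_eq_iff image_iff)
qed

lemma continuous_on_rigid_motion: "rigid_motion g \<Longrightarrow> continuous_on X g"
  using homeomorphism_rigid_motion homeomorphism_cont1 by blast

lemma bij_rigid_motion: "rigid_motion g \<Longrightarrow> bij g"
  by (metis o_bij rigid_motion_inverse)

lemma rigid_motion_inv:
  assumes "rigid_motion g"
  shows "rigid_motion (motion_inv g)" "motion_inv g (g x) = x" "g (motion_inv g x) = x"
    "linear_part (motion_inv g) (linear_part g v) = v" "linear_part g (linear_part (motion_inv g) v) = v"
proof -
  obtain g' where g': "rigid_motion g'" "g' \<circ> g = id" "g \<circ> g' = id"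
    "\<And>v. linear_part g' (linear_part g v) = v" "\<And>v. linear_part g (linear_part g' v) = v"
    using assms by (rule rigid_motion_inverse) blast
  have eq: "motion_inv g = g'"
    by (metis g'(2,3) inv_unique_comp)
  show "rigid_motion (motion_inv g)" "motion_inv g (g x) = x" "g (motion_inv g x) = x"
    "linear_part (motion_inv g) (linear_part g v) = v" "linear_part g (linear_part (motion_inv g) v) = v"
    unfolding eq using g' by (simp_all add: fun_eq_iff)
qed

text \<open>The rotation also fixes the cross product of the two fixed vectors, a third independent direction.
  Preservation of orientation is essential: the reflection in the plane fixes both vectors as well.\<close>

lemma rigid_motion_fixing_plane:
  assumes g: "rigid_motion g" and "linear_part g u = u" "linear_part g v = v"
    and nz: "cross3 u v \<noteq> 0" and p: "g p = p"
  shows "g = id"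
proof -
  obtain A b where A: "orthogonal_matrix A" "det A = 1" "g = (\<lambda>x. A *v x + b)" "linear_part g = (*v) A"
    using g by (rule rigid_motionE)
  let ?w = "cross3 u v"
  have w: "A *v ?w = ?w"
    using cross_rotation_matrix[of A u v] A(1,2) assms(2,3)
    unfolding A(4) rotation_matrix_def by metis
  have "linear_part g x = x" for x
  proof -
    have fixed: "linear_part g y = y" if "y \<in> span {u, v, ?w}" for y
    proof -
      have lw: "linear_part g ?w = ?w" using w A(4) by simp
      have "subspace {y. linear_part g y = y}"
        using linear_linear_part[OF g]
        by (simp add: subspace_def linear_0 linear_add linear_cmul)
      moreover have "{u, v, ?w} \<subseteq> {y. linear_part g y = y}"
        using assms(2,3) lw by blast
      ultimately have "span {u, v, ?w} \<subseteq> {y. linear_part g y = y}"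
        by (intro span_minimal)
      with that show ?thesis by blast
    qed
    have ind: "independent {u, v, ?w}" and card: "card {u,v,?w} = 3"
    proof -
      have orth: "?w \<bullet> u = 0" "?w \<bullet> v = 0"
        by (simp_all add: dot_cross_self)
      have "u \<noteq> v" using nz by auto
      have wu: "?w \<noteq> u" "?w \<noteq> v" using orth nz by auto
      show "card {u,v,?w} = 3" using \<open>u \<noteq> v\<close> wu by auto
      have v0: "v \<noteq> 0" using nz by auto
      have 1: "independent {v}" using v0 by (simp add: dependent_single)
      have "u \<notin> span {v}"
      proof
        assume "u \<in> span {v}"
        then obtain k where "u = k *\<^sub>R v" by (auto simp: span_singleton)
        then show False using nz by (simp add: cross_mult_left)
      qed
      then have 2: "independent {u, v}" using 1 by (simp add: independent_insert)
      have "?w \<notin> span {u,v}"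
      proof
        assume "?w \<in> span {u,v}"
        then have "orthogonal ?w ?w"
          by (rule orthogonal_to_span) (use orth in \<open>auto simp: orthogonal_def\<close>)
        then show False using nz by (simp add: orthogonal_def)
      qed
      then have "independent (insert ?w {u,v})" using 2 wu by (simp add: independent_insert)
      then show "independent {u,v,?w}" by (simp add: insert_commute)
    qed
    have "span {u,v,?w} = UNIV"
      using card_ge_dim_independent[OF _ ind, of UNIV] card by (auto simp: dim_UNIV)
    then show ?thesis using fixed by auto
  qed
  then have "g x - g p = x - p" for x
    by (metis linear_part_diff[OF g])
  then have "g x = x" for x
    using p by (metis diff_add_cancel)
  then show ?thesis by (simp add: fun_eq_iff)
qed

section \<open>Topological discs and their boundaries\<close>

text \<open>By invariance of domain a self-homeomorphism of the closed disc and its inverse map the open disc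
  into the interior of the closed disc.\<close>

lemma homeomorphism_cball_image_sphere:
  fixes f :: "complex \<Rightarrow> complex"
  assumes "homeomorphism (cball 0 1) (cball 0 1) f f'"
  shows "f ` sphere 0 1 = sphere 0 1"
proof -
  have ball: "f ` ball 0 1 \<subseteq> ball 0 1"
    if "homeomorphism (cball 0 1) (cball 0 1) f f'" for f f' :: "complex \<Rightarrow> complex"
  proof -
    have "inj_on f (ball 0 1)"
      using that unfolding homeomorphism_def by (intro inj_onI) (metis ball_subset_cball subset_iff)
    moreover have "continuous_on (ball 0 1) f"
      using that homeomorphism_cont1 continuous_on_subset by (metis ball_subset_cball)
    ultimately have "open (f ` ball 0 1)"
      by (intro invariance_of_domain) auto
    moreover have "f ` ball 0 1 \<subseteq> cball 0 1"
      using that by (auto simp: homeomorphism_def)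
    ultimately have "f ` ball 0 1 \<subseteq> interior (cball 0 1)"
      by (rule interior_maximal[rotated])
    then show ?thesis by simp
  qed
  have 1: "f ` ball 0 1 \<subseteq> ball 0 1" and 2: "f' ` ball 0 1 \<subseteq> ball 0 1"
    using ball[OF assms] ball[OF homeomorphism_symD[OF assms]] by auto
  have f: "f z \<in> cball 0 1" "f' z \<in> cball 0 1" "f' (f z) = z" "f (f' z) = z" if "z \<in> cball 0 1" for z
    using assms that by (auto simp: homeomorphism_def)
  have iff: "f z \<in> ball 0 1 \<longleftrightarrow> z \<in> ball 0 1" if "z \<in> cball 0 1" for z
    using 1 2 f[OF that] by (metis image_subset_iff)
  have sph: "z \<in> sphere 0 1 \<longleftrightarrow> z \<in> cball 0 1 \<and> z \<notin> ball 0 1" for z :: complex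
    by auto
  show ?thesis
  proof (intro subset_antisym subsetI)
    fix w assume "w \<in> f ` sphere 0 1"
    then show "w \<in> sphere 0 1" using iff f by (metis imageE sph)
  next
    fix w :: complex assume w: "w \<in> sphere 0 1"
    then have "f' w \<in> sphere 0 1" "f (f' w) = w" using f iff by (metis sph)+
    then show "w \<in> f ` sphere 0 1" by (metis imageI)
  qed
qed

text \<open>Two parameterizations of a disc differ by a self-homeomorphism of the closed unit disc, so the
  boundary can be computed from any one of them.\<close>

lemma disc_boundary_eq:
  assumes "homeomorphism (cball (0::complex) 1) T h h'"
  shows "disc_boundary T = h ` sphere 0 1"
proof
  show "h ` sphere 0 1 \<subseteq> disc_boundary T"
    unfolding disc_boundary_def using assms by blast
  show "disc_boundary T \<subseteq> h ` sphere 0 1"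
  proof
    fix x assume "x \<in> disc_boundary T"
    then obtain k k' where k: "homeomorphism (cball (0::complex) 1) T k k'" "x \<in> k ` sphere 0 1"
      unfolding disc_boundary_def by blast
    have "homeomorphism (cball 0 1) (cball 0 1) (h' \<circ> k) (k' \<circ> h)"
      by (rule homeomorphism_compose[OF k(1) homeomorphism_symD[OF assms]])
    then have "(h' \<circ> k) ` sphere 0 1 = sphere 0 1"
      by (rule homeomorphism_cball_image_sphere)
    moreover obtain z where z: "z \<in> sphere 0 1" "x = k z" using k(2) by blast
    ultimately have "h' x \<in> sphere 0 1" by (metis comp_apply imageI)
    moreover have "x \<in> T" using k(1) z unfolding homeomorphism_def
      by (metis image_eqI sphere_cball subsetD)
    then have "h (h' x) = x" using assms by (auto simp: homeomorphism_def)
    ultimately show "x \<in> h ` sphere 0 1" by (metis imageI)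
  qed
qed

lemma disc_boundary_image:
  assumes T: "homeomorphism (cball (0::complex) 1) T h h'" and f: "homeomorphism T U f f'"
  shows "disc_boundary U = f ` disc_boundary T"
  using disc_boundary_eq[OF homeomorphism_compose[OF T f]] disc_boundary_eq[OF T]
  by (simp add: image_comp)

lemma disc_boundary_rigid_image:
  assumes "T homeomorphic cball (0::complex) 1" "rigid_motion g"
  shows "disc_boundary (g ` T) = g ` disc_boundary T"
proof -
  obtain h h' where "homeomorphism (cball (0::complex) 1) T h h'"
    using assms(1) by (metis homeomorphic_def homeomorphic_sym)
  then show ?thesis
    using disc_boundary_image homeomorphism_rigid_motion assms(2) by blast
qed

locale disc =
  fixes T :: "(real^3) set" and h :: "complex \<Rightarrow> real^3" and h' :: "real^3 \<Rightarrow> complex"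
  assumes hom: "homeomorphism (cball 0 1) T h h'"
begin

lemma boundary: "disc_boundary T = h ` sphere 0 1"
  by (rule disc_boundary_eq[OF hom])

lemma cont: "continuous_on (cball 0 1) h" and cont': "continuous_on T h'"
  and im: "h ` cball 0 1 = T" and im': "h' ` T = cball 0 1"
  and left[simp]: "z \<in> cball 0 1 \<Longrightarrow> h' (h z) = z" and right[simp]: "x \<in> T \<Longrightarrow> h (h' x) = x"
  using hom by (auto simp: homeomorphism_def)

lemma inj: "inj_on h (cball 0 1)"
  by (metis inj_onI left)

lemma compact: "compact T"
  using compact_continuous_image[OF cont] im by simp

lemma closed: "closed T"
  using compact by (rule compact_imp_closed)

lemma connected: "connected T"
  using connected_continuous_image[OF cont] im by simp

lemma boundary_subset: "disc_boundary T \<subseteq> T"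
  using im boundary sphere_cball by blast

lemma interior_eq: "T - disc_boundary T = h ` ball 0 1"
proof -
  have "cball 0 1 - sphere 0 1 = ball (0::complex) 1" by auto
  then show ?thesis
    using inj_on_image_set_diff[OF inj, of "cball 0 1" "sphere 0 1"] im boundary by auto
qed

lemma in_boundary_iff: "z \<in> cball 0 1 \<Longrightarrow> h z \<in> disc_boundary T \<longleftrightarrow> z \<in> sphere 0 1"
  unfolding boundary using inj_on_image_mem_iff[OF inj, of z "sphere 0 1"] by (simp add: sphere_cball)

lemma closure_interior: "T \<subseteq> closure (T - disc_boundary T)"
proof -
  have "h ` closure (ball 0 1) \<subseteq> closure (h ` ball 0 1)"
    using cont by (intro image_closure_subset closed_closure closure_subset) simp
  then show ?thesis using im interior_eq by simp
qed

lemma compact_boundary: "compact (disc_boundary T)"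
  unfolding boundary by (intro compact_continuous_image continuous_on_subset[OF cont]) (auto simp: sphere_cball)

lemma interior_nonempty: "T - disc_boundary T \<noteq> {}"
  unfolding interior_eq by simp

end

lemma disc_exists:
  assumes "T homeomorphic cball (0::complex) 1"
  obtains h h' where "disc T h h'"
  using assms by (metis homeomorphic_def homeomorphic_sym disc_def)

lemma disc_rigid_image:
  assumes "disc T h h'" "rigid_motion g"
  shows "disc (g ` T) (g \<circ> h) (h' \<circ> motion_inv g)"
  using assms homeomorphism_compose homeomorphism_rigid_motion unfolding disc_def by blast

text \<open>Dividing by \<open>- z0\<close> moves the branch cut of the argument to the missing point.\<close>

lemma homeomorphism_punctured_circle:
  assumes "norm z0 = 1"
  shows "homeomorphism (sphere 0 1 - {z0}) {-pi<..<pi} (\<lambda>w. Arg (- w / z0)) (\<lambda>t. - z0 * cis t)"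
proof -
  have z0: "z0 \<noteq> 0" using assms by auto
  have A: "Arg (- w / z0) \<in> {-pi<..<pi}" "- z0 * cis (Arg (- w / z0)) = w" "- w / z0 \<notin> \<real>\<^sub>\<le>\<^sub>0"
    if w: "w \<in> sphere 0 1 - {z0}" for w
  proof -
    have n: "norm (- w / z0) = 1" using w assms by (simp add: norm_divide)
    then have nz: "- w / z0 \<noteq> 0" by (metis norm_zero zero_neq_one)
    have "- w / z0 = cis (Arg (- w / z0))"
      using cis_Arg[OF nz] n by (simp add: sgn_div_norm)
    then show e: "- z0 * cis (Arg (- w / z0)) = w" using z0 by (metis (no_types, lifting) divide_minus_left minus_equation_iff minus_mult_left nonzero_mult_div_cancel_left times_divide_eq_right)
    have "Arg (- w / z0) \<noteq> pi"
    proof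
      assume "Arg (- w / z0) = pi"
      with e have "w = z0" by simp
      with w show False by simp
    qed
    then show "Arg (- w / z0) \<in> {-pi<..<pi}" using mpi_less_Arg[of "- w / z0"] Arg_le_pi[of "- w / z0"] by auto
    show "- w / z0 \<notin> \<real>\<^sub>\<le>\<^sub>0"
      using \<open>Arg (- w / z0) \<noteq> pi\<close> nz by (metis Arg_eq_pi complex_nonpos_Reals_iff less_eq_real_def complex_eq_iff zero_complex.simps)
  qed
  have B: "- z0 * cis t \<in> sphere 0 1 - {z0}" "Arg (- (- z0 * cis t) / z0) = t" if "t \<in> {-pi<..<pi}" for t
  proof -
    show a: "Arg (- (- z0 * cis t) / z0) = t" using that z0 by (simp add: Arg_cis)
    have "- z0 * cis t \<noteq> z0"
    proof
      assume "- z0 * cis t = z0"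
      then have "Arg (- z0 / z0) = t" using a by simp
      then have "t = pi" using z0 Arg_cis[of pi] by simp
      with that show False by simp
    qed
    then show "- z0 * cis t \<in> sphere 0 1 - {z0}" using assms by (simp add: norm_mult)
  qed
  show ?thesis
    unfolding homeomorphism_def
  proof (intro conjI ballI)
    show "continuous_on (sphere 0 1 - {z0}) (\<lambda>w. Arg (- w / z0))"
      using A(3) z0 by (intro continuous_intros) auto
    show "continuous_on {-pi<..<pi} (\<lambda>t. - z0 * cis t)"
      by (intro continuous_intros)
    show "(\<lambda>w. Arg (- w / z0)) ` (sphere 0 1 - {z0}) = {-pi<..<pi}"
    proof (intro subset_antisym image_subsetI subsetI A(1))
      fix t :: real assume t: "t \<in> {-pi<..<pi}"
      show "t \<in> (\<lambda>w. Arg (- w / z0)) ` (sphere 0 1 - {z0})"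
        by (rule image_eqI[OF _ B(1)[OF t]]) (rule B(2)[OF t, symmetric])
    qed
    show "(\<lambda>t. - z0 * cis t) ` {-pi<..<pi} = sphere 0 1 - {z0}"
    proof (intro subset_antisym image_subsetI subsetI B(1))
      fix w assume w: "w \<in> sphere 0 1 - {z0}"
      show "w \<in> (\<lambda>t. - z0 * cis t) ` {-pi<..<pi}"
        by (rule image_eqI[OF _ A(1)[OF w]]) (rule A(2)[OF w, symmetric])
    qed
  qed (fact A(2) B(2))+
qed

text \<open>The circle without a point missed by \<open>K\<close> is an open interval, and the compact connected subsets of
  an interval are closed intervals.\<close>

lemma component_proper_subset_circle:
  assumes K: "closed K" "K \<subseteq> sphere (0::complex) 1" "K \<noteq> sphere 0 1" and C: "C \<in> components K"
  obtains a b where "a \<le> b" "b < a + 2 * pi" "C = cis ` {a..b}"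
proof -
  obtain z0 where z0: "z0 \<in> sphere 0 1" "z0 \<notin> K" using K by blast
  then have n: "norm z0 = 1" by simp
  obtain a where H: "homeomorphism (sphere 0 1 - {z0}) {-pi<..<pi} a (\<lambda>t. - z0 * cis t)"
    using homeomorphism_punctured_circle[OF n] by blast
  have CK: "C \<subseteq> K" using C by (rule in_components_subset)
  then have CS: "C \<subseteq> sphere 0 1 - {z0}" using K z0 by blast
  have "compact K" using K(1,2) by (meson bounded_subset bounded_sphere compact_eq_bounded_closed)
  then have cC: "compact C" using C by (metis closed_components compact_eq_bounded_closed bounded_subset CK)
  have conn: "connected C" using C by (rule in_components_connected)
  have ne: "C \<noteq> {}" using C by (rule in_components_nonempty)
  have cont: "continuous_on C a" using H CS by (meson continuous_on_subset homeomorphism_cont1)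
  obtain l u where lu: "a ` C = {l..u}"
    using connected_compact_interval_1[of "a ` C"] connected_continuous_image[OF cont conn]
      compact_continuous_image[OF cont cC] by auto
  have le: "l \<le> u" using lu ne by (metis atLeastatMost_empty_iff image_is_empty)
  have "{l..u} \<subseteq> {-pi<..<pi}" using lu CS H by (metis homeomorphism_image1 image_mono)
  then have "l \<in> {-pi<..<pi}" "u \<in> {-pi<..<pi}" using le by auto
  then have lt: "u < l + 2 * pi" by auto
  have "- z0 \<noteq> 0" using n by auto
  then have t0: "- z0 = cis t0" if "t0 = Arg (- z0)" for t0
    using that n by (simp add: cis_Arg sgn_div_norm)
  define t0 where "t0 = Arg (- z0)"
  note t0 = t0[OF t0_def]
  have "C = (\<lambda>t. - z0 * cis t) ` {l..u}"
  proof -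
    have "- z0 * cis (a w) = w" if "w \<in> C" for w
      by (rule homeomorphism_apply1[OF H]) (use that CS in blast)
    then have "(\<lambda>t. - z0 * cis t) ` a ` C = C"
      unfolding image_image by simp
    then show ?thesis using lu by simp
  qed
  also have "\<dots> = cis ` (\<lambda>t. t0 + t) ` {l..u}"
    unfolding image_image by (simp add: t0 cis_mult)
  also have "\<dots> = cis ` {t0 + l..t0 + u}" by (simp add: add.commute)
  finally show thesis using that[of "t0 + l" "t0 + u"] le lt by auto
qed

text \<open>Otherwise the circle would embed in an open interval.\<close>

lemma continuous_injective_circle_onto:
  fixes f :: "complex \<Rightarrow> complex"
  assumes "continuous_on (sphere 0 1) f" "inj_on f (sphere 0 1)" "f ` sphere 0 1 \<subseteq> sphere 0 1"
  shows "f ` sphere 0 1 = sphere 0 1"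
proof (rule ccontr)
  assume "f ` sphere 0 1 \<noteq> sphere 0 1"
  then obtain z0 where z0: "z0 \<in> sphere 0 1" "z0 \<notin> f ` sphere 0 1" using assms(3) by blast
  then have n: "norm z0 = 1" by simp
  obtain a b where H: "homeomorphism (sphere 0 1 - {z0}) {-pi<..<pi} a b"
    using homeomorphism_punctured_circle[OF n] by blast
  have sub: "f ` sphere 0 1 \<subseteq> sphere 0 1 - {z0}" using z0 assms(3) by blast
  have "continuous_on (sphere 0 1) (a \<circ> f)"
    using assms(1) H sub by (meson continuous_on_compose continuous_on_subset homeomorphism_cont1)
  moreover have "inj_on (a \<circ> f) (sphere 0 1)"
  proof (rule comp_inj_on[OF assms(2)])
    have "inj_on a (sphere 0 1 - {z0})"
      using H by (metis (no_types, lifting) homeomorphism_apply1 inj_onI)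
    then show "inj_on a (f ` sphere 0 1)" using sub inj_on_subset by blast
  qed
  ultimately have "DIM(complex) \<le> DIM(real)"
    by (intro no_embedding_sphere_lowdim) auto
  then show False by simp
qed

lemma disc_boundary_subset_imp_eq:
  assumes A: "disc A h h'" and B: "disc B k k'" and sub: "disc_boundary A \<subseteq> disc_boundary B"
  shows "disc_boundary A = disc_boundary B"
proof -
  interpret A: disc A h h' by fact
  interpret B: disc B k k' by fact
  have "(k' \<circ> h) ` sphere 0 1 = sphere 0 1"
  proof (rule continuous_injective_circle_onto)
    have hs: "h ` sphere 0 1 \<subseteq> B" using sub A.boundary B.boundary_subset by blast
    show "continuous_on (sphere 0 1) (k' \<circ> h)"
      using A.cont B.cont' hs by (meson continuous_on_compose continuous_on_subset sphere_cball)
    show "inj_on (k' \<circ> h) (sphere 0 1)"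
      using A.inj hs by (intro comp_inj_on) (metis inj_on_subset sphere_cball, metis B.right inj_onI subsetD)
    show "(k' \<circ> h) ` sphere 0 1 \<subseteq> sphere 0 1"
    proof
      fix w assume "w \<in> (k' \<circ> h) ` sphere 0 1"
      then obtain z where z: "z \<in> sphere 0 1" "w = k' (h z)" by auto
      then have "h z \<in> disc_boundary B" using sub A.boundary by blast
      then obtain y where "y \<in> sphere 0 1" "h z = k y" using B.boundary by blast
      then show "w \<in> sphere 0 1" using z(2) B.left[of y] by (simp add: sphere_cball)
    qed
  qed
  then have "k ` (k' \<circ> h) ` sphere 0 1 = disc_boundary B" using B.boundary by simp
  moreover have "k ` (k' \<circ> h) ` sphere 0 1 = h ` sphere 0 1"
    unfolding image_image comp_def
    using sub A.boundary B.boundary_subset by (intro image_cong refl B.right) blast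
  ultimately show ?thesis using A.boundary by simp
qed

section \<open>Embedded surfaces\<close>

lemma times_cont_diff_on_subset:
  "times_cont_diff_on n f U \<Longrightarrow> V \<subseteq> U \<Longrightarrow> times_cont_diff_on n f V"
  by (induction n arbitrary: f) (auto intro: continuous_on_subset)

lemma surface_param_subset:
  assumes "surface_param k \<phi> V" "open U" "U \<subseteq> V"
  shows "surface_param k \<phi> U"
  using assms homeomorphism_of_subsets[of V "\<phi> ` V" \<phi> _ U] times_cont_diff_on_subset[OF _ \<open>U \<subseteq> V\<close>]
  unfolding surface_param_def Ck_on_def by (metis homeomorphism_of_subsets image_mono subset_iff)

text \<open>This part of the definition of a surface passes to arbitrary subsets, and it is all that
  invariance of domain requires.\<close>

definition locally_in_surface :: "enat \<Rightarrow> (real^3) set \<Rightarrow> bool" where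
  "locally_in_surface k S \<longleftrightarrow>
     (\<forall>p\<in>S. \<exists>U \<phi> V. open U \<and> p \<in> U \<and> surface_param k \<phi> V \<and> S \<inter> U \<subseteq> \<phi> ` V)"

lemma Ck_surface_locally: "Ck_surface k S \<Longrightarrow> locally_in_surface k S"
  by (simp add: Ck_surface_def locally_in_surface_def)

lemma locally_in_surface_subset:
  "locally_in_surface k S \<Longrightarrow> S' \<subseteq> S \<Longrightarrow> locally_in_surface k S'"
  unfolding locally_in_surface_def by (meson Int_mono order_refl order_trans subsetD)

lemma surface_interior_subset: "surface_interior k S \<subseteq> S"
  by (auto simp: surface_interior_def)

lemma surface_interior_chart:
  assumes "p \<in> surface_interior k S"
  obtains \<phi> \<psi> V where "surface_param k \<phi> V" "p \<in> \<phi> ` V" "openin (top_of_set S) (\<phi> ` V)"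
    "homeomorphism V (\<phi> ` V) \<phi> \<psi>" "open V"
  using assms unfolding surface_interior_def surface_param_def by blast

text \<open>Invariance of domain, applied in local parameterizations of the surface.\<close>

lemma embedded_open_surface:
  fixes F :: "complex \<Rightarrow> real^3"
  assumes S: "locally_in_surface k S" and Z: "open Z" and F: "continuous_on Z F" "inj_on F Z" "F ` Z \<subseteq> S"
  shows "openin (top_of_set S) (F ` Z)" and "F ` Z \<subseteq> surface_interior k S"
proof -
  have *: "\<exists>W. openin (top_of_set S) W \<and> F z \<in> W \<and> W \<subseteq> F ` Z \<and> F z \<in> surface_interior k S"
    if z: "z \<in> Z" for z
  proof -
    have "F z \<in> S" using z F by blast
    then obtain U \<phi> V where U: "open U" "F z \<in> U" "surface_param k \<phi> V" "S \<inter> U \<subseteq> \<phi> ` V"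
      using S unfolding locally_in_surface_def by blast
    then obtain \<psi> where h: "homeomorphism V (\<phi> ` V) \<phi> \<psi>" and V: "open V"
      unfolding surface_param_def by blast
    define P where "P = Z \<inter> F -` U"
    have P: "open P" using continuous_open_preimage[OF F(1) Z U(1)] by (simp add: P_def)
    have zP: "z \<in> P" using z U by (simp add: P_def)
    have FP: "F ` P \<subseteq> S \<inter> U" using F(3) by (auto simp: P_def)
    have PO: "P \<subseteq> Z" by (auto simp: P_def)
    define Q where "Q = (\<psi> \<circ> F) ` P"
    have Q: "open Q" unfolding Q_def
    proof (rule invariance_of_domain_gen[OF P])
      show "continuous_on P (\<psi> \<circ> F)"
        using h F(1) PO FP U(4) by (meson continuous_on_compose continuous_on_subset homeomorphism_cont2 order_trans)
      have "inj_on \<psi> (\<phi> ` V)"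
        by (rule inj_on_inverseI[of _ \<phi>]) (rule homeomorphism_apply2[OF h])
      then show "inj_on (\<psi> \<circ> F) P"
        using FP U(4) by (intro comp_inj_on inj_on_subset[OF F(2) PO]) (erule inj_on_subset, blast)
    qed simp
    have "F ` P \<subseteq> \<phi> ` V" using FP U(4) by blast
    then have QV: "Q \<subseteq> V" unfolding Q_def using h by (auto simp: homeomorphism_def)
    have \<phi>Q: "\<phi> ` Q = F ` P"
      unfolding Q_def image_image comp_def
      by (intro image_cong refl homeomorphism_apply2[OF h]) (use FP U(4) in blast)
    have eq: "F ` P = (S \<inter> U) \<inter> \<psi> -` Q"
    proof
      show "F ` P \<subseteq> (S \<inter> U) \<inter> \<psi> -` Q" using FP by (auto simp: Q_def)
      show "(S \<inter> U) \<inter> \<psi> -` Q \<subseteq> F ` P"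
      proof
        fix y assume y: "y \<in> (S \<inter> U) \<inter> \<psi> -` Q"
        then have "\<phi> (\<psi> y) = y" using U(4) homeomorphism_apply2[OF h] by blast
        then show "y \<in> F ` P" using y \<phi>Q by (metis IntD2 imageI vimageE)
      qed
    qed
    have "openin (top_of_set (S \<inter> U)) (F ` P)"
      unfolding eq using h U(4) Q by (meson continuous_openin_preimage_gen continuous_on_subset homeomorphism_cont2)
    moreover have "openin (top_of_set S) (S \<inter> U)" using U(1) by auto
    ultimately have op: "openin (top_of_set S) (F ` P)" using openin_trans by blast
    have "surface_param k \<phi> Q" using U(3) Q QV by (rule surface_param_subset)
    then have "F z \<in> surface_interior k S"
      unfolding surface_interior_def using op \<phi>Q zP \<open>F z \<in> S\<close> by (metis (mono_tags, lifting) imageI mem_Collect_eq)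
    with op show ?thesis using zP PO by blast
  qed
  show "openin (top_of_set S) (F ` Z)"
    by (subst openin_subopen) (use * in blast)
  show "F ` Z \<subseteq> surface_interior k S"
    using * by blast
qed

context disc
begin

lemma interior_openin:
  assumes "locally_in_surface k S" "T \<subseteq> S"
  shows "openin (top_of_set S) (T - disc_boundary T)" "T - disc_boundary T \<subseteq> surface_interior k S"
proof -
  have sub: "ball 0 1 \<subseteq> cball (0::complex) 1" by auto
  have F: "continuous_on (ball 0 1) h" "inj_on h (ball 0 1)" "h ` ball 0 1 \<subseteq> S"
    using cont inj im assms(2) sub by (meson continuous_on_subset, meson inj_on_subset, blast)
  show "openin (top_of_set S) (T - disc_boundary T)" "T - disc_boundary T \<subseteq> surface_interior k S"
    unfolding interior_eq using embedded_open_surface[OF assms(1) open_ball F] by auto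
qed

text \<open>Otherwise a chart around \<open>p\<close> followed by the inverse of the parameterization of the disc would be an
  open map into the closed unit disc, taking a value on the unit circle.\<close>

lemma boundary_not_interior:
  assumes p: "p \<in> surface_interior k S" "p \<in> disc_boundary T" and W: "openin (top_of_set S) W" "p \<in> W"
  shows "\<not> W \<subseteq> T"
proof
  assume WT: "W \<subseteq> T"
  obtain \<phi> \<psi> V where c: "surface_param k \<phi> V" "p \<in> \<phi> ` V" "openin (top_of_set S) (\<phi> ` V)"
    "homeomorphism V (\<phi> ` V) \<phi> \<psi>" "open V"
    using p(1) by (rule surface_interior_chart)
  have "openin (top_of_set (\<phi> ` V)) (W \<inter> \<phi> ` V)"
    using openin_Int[OF W(1) c(3)] openin_imp_subset[OF c(3)]
    by (meson openin_subset_trans Int_lower2)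
  then have "openin (top_of_set V) (V \<inter> \<phi> -` (W \<inter> \<phi> ` V))"
    using c(4) by (metis continuous_on_open homeomorphism_cont1)
  then have op: "open (V \<inter> \<phi> -` (W \<inter> \<phi> ` V))" (is "open ?P")
    using c(5) openin_open_eq by blast
  have sub: "\<phi> ` ?P \<subseteq> T" using WT by blast
  have "open ((h' \<circ> \<phi>) ` ?P)"
  proof (rule invariance_of_domain_gen[OF op])
    show "continuous_on ?P (h' \<circ> \<phi>)"
      using c(4) cont' sub by (meson Int_lower1 continuous_on_compose continuous_on_subset homeomorphism_cont1)
    show "inj_on (h' \<circ> \<phi>) ?P"
    proof (rule comp_inj_on)
      show "inj_on \<phi> ?P"
        by (rule inj_on_inverseI[of _ \<psi>]) (use homeomorphism_apply1[OF c(4)] in blast)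
      show "inj_on h' (\<phi> ` ?P)"
        by (rule inj_on_inverseI[of _ h]) (use sub right in blast)
    qed
  qed simp
  moreover have "(h' \<circ> \<phi>) ` ?P \<subseteq> cball 0 1" using sub im' by auto
  ultimately have "(h' \<circ> \<phi>) ` ?P \<subseteq> ball 0 1"
    by (metis interior_cball interior_maximal)
  moreover obtain x where x: "x \<in> V" "p = \<phi> x" using c(2) by blast
  then have "x \<in> ?P" using W(2) by auto
  ultimately have "(h' \<circ> \<phi>) x \<in> ball 0 1" by blast
  then have "h' p \<in> ball 0 1" using x by simp
  moreover obtain z where "z \<in> sphere 0 1" "p = h z" using p(2) boundary by blast
  ultimately show False using left[of z] by simp
qed

end

text \<open>Two discs which meet only along their boundaries cover a neighbourhood of every relatively
  open part of the boundary that they share: the second disc, reflected in the unit circle, extends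
  the parameterization of the first one across the common arc, and invariance of domain applies.\<close>

lemma discs_glue_along_boundary:
  assumes S: "locally_in_surface k S" and A: "disc A h h'" "A \<subseteq> S" and B: "disc B g g'" "B \<subseteq> S"
    and AB: "A \<inter> B \<subseteq> disc_boundary A \<inter> disc_boundary B"
    and X: "openin (top_of_set (disc_boundary A)) X" "X \<subseteq> B"
  obtains W where "openin (top_of_set S) W" "X \<subseteq> W" "W \<subseteq> A \<union> B"
proof -
  interpret A: disc A h h' by fact
  interpret B: disc B g g' by fact
  have XA: "X \<subseteq> disc_boundary A" using X(1) by (rule openin_imp_subset)
  have XB: "X \<subseteq> disc_boundary B" using XA X(2) AB A.boundary_subset by blast
  have hs: "continuous_on (sphere 0 1) h" using A.cont by (meson continuous_on_subset sphere_cball)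
  have "openin (top_of_set (sphere 0 1)) (sphere 0 1 \<inter> h -` X)"
    using X(1) hs A.boundary by (metis continuous_on_open)
  then obtain J where J: "open J" "sphere 0 1 \<inter> h -` X = sphere 0 1 \<inter> J"
    by (metis openin_open)
  define \<tau> where "\<tau> = g' \<circ> h"
  have hX: "h z \<in> X" if "z \<in> sphere 0 1" "z \<in> J" for z using that J(2) by blast
  have \<tau>: "\<tau> z \<in> sphere 0 1" "g (\<tau> z) = h z" if "z \<in> sphere 0 1" "z \<in> J" for z
  proof -
    have "h z \<in> g ` sphere 0 1" using hX[OF that] XB B.boundary by blast
    then obtain w where w: "w \<in> sphere 0 1" "h z = g w" by blast
    then have "\<tau> z = w" using B.left[of w] by (simp add: \<tau>_def)
    then show "\<tau> z \<in> sphere 0 1" "g (\<tau> z) = h z" using w by auto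
  qed
  have \<tau>inj: "z = w" if "z \<in> sphere 0 1 \<inter> J" "w \<in> sphere 0 1 \<inter> J" "\<tau> z = \<tau> w" for z w
  proof -
    have "h z = h w" using \<tau>(2) that by (metis IntD1 IntD2)
    then show ?thesis using A.inj that by (metis IntD1 inj_onD sphere_cball subsetD)
  qed
  have c\<tau>: "continuous_on (sphere 0 1 \<inter> J) \<tau>"
    unfolding \<tau>_def
  proof (rule continuous_on_compose)
    show "continuous_on (sphere 0 1 \<inter> J) h" using hs by (rule continuous_on_subset) auto
    show "continuous_on (h ` (sphere 0 1 \<inter> J)) g'"
      using B.cont' by (rule continuous_on_subset) (use hX X(2) in blast)
  qed
  define Z where "Z = {z::complex. z \<noteq> 0 \<and> norm z < 2 \<and> sgn z \<in> J}"
  have sgn: "sgn z \<in> sphere 0 1 \<inter> J" if "z \<in> Z" for z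
    using that by (simp add: Z_def norm_sgn)
  have csgn: "continuous_on D sgn" if "0 \<notin> D" for D :: "complex set"
    unfolding sgn_div_norm using that by (intro continuous_intros) auto
  have opZ: "open Z"
  proof -
    have "open ({z. z \<noteq> 0} \<inter> sgn -` J)"
      by (rule continuous_open_preimage[OF csgn]) (auto simp: J open_Collect_neq)
    moreover have "Z = ({z. z \<noteq> 0} \<inter> sgn -` J) \<inter> ball 0 2" by (auto simp: Z_def)
    ultimately show ?thesis by auto
  qed
  define F where "F z = (if norm z \<le> 1 then h z else g ((2 - norm z) *\<^sub>R \<tau> (sgn z)))" for z
  have outer: "(2 - norm z) *\<^sub>R \<tau> (sgn z) \<in> cball 0 1" "norm ((2 - norm z) *\<^sub>R \<tau> (sgn z)) = 2 - norm z"
    if "z \<in> Z" "norm z \<ge> 1" for z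
  proof -
    have "norm (\<tau> (sgn z)) = 1" using \<tau>(1) sgn[OF that(1)] by simp
    then show "norm ((2 - norm z) *\<^sub>R \<tau> (sgn z)) = 2 - norm z" using that by (simp add: Z_def)
    then show "(2 - norm z) *\<^sub>R \<tau> (sgn z) \<in> cball 0 1" using that by simp
  qed
  have cF: "continuous_on Z F"
  proof -
    have "continuous_on ((Z \<inter> {z. norm z \<le> 1}) \<union> (Z \<inter> {z. norm z \<ge> 1})) F"
      unfolding F_def
    proof (rule continuous_on_cases_local)
      have le: "closed {z. cmod z \<le> 1}" and ge: "closed {z. 1 \<le> cmod z}"
        by (intro closed_Collect_le continuous_intros)+
      show "closedin (top_of_set (Z \<inter> {z. cmod z \<le> 1} \<union> Z \<inter> {z. 1 \<le> cmod z})) (Z \<inter> {z. cmod z \<le> 1})"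
        unfolding closedin_closed by (rule exI[of _ "{z. cmod z \<le> 1}"]) (use le in blast)
      show "closedin (top_of_set (Z \<inter> {z. cmod z \<le> 1} \<union> Z \<inter> {z. 1 \<le> cmod z})) (Z \<inter> {z. 1 \<le> cmod z})"
        unfolding closedin_closed by (rule exI[of _ "{z. 1 \<le> cmod z}"]) (use ge in blast)
      show "continuous_on (Z \<inter> {z. cmod z \<le> 1}) h"
        using A.cont by (rule continuous_on_subset) auto
      show "continuous_on (Z \<inter> {z. 1 \<le> cmod z}) (\<lambda>z. g ((2 - cmod z) *\<^sub>R \<tau> (sgn z)))"
      proof (rule continuous_on_compose2[OF B.cont])
        have "continuous_on (Z \<inter> {z. 1 \<le> cmod z}) (\<lambda>z. \<tau> (sgn z))"
          by (rule continuous_on_compose2[OF c\<tau> csgn]) (use sgn Z_def in auto)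
        then show "continuous_on (Z \<inter> {z. 1 \<le> cmod z}) (\<lambda>z. (2 - cmod z) *\<^sub>R \<tau> (sgn z))"
          by (intro continuous_intros)
        show "(\<lambda>z. (2 - cmod z) *\<^sub>R \<tau> (sgn z)) ` (Z \<inter> {z. 1 \<le> cmod z}) \<subseteq> cball 0 1"
          using outer(1) by blast
      qed
      show "h z = g ((2 - cmod z) *\<^sub>R \<tau> (sgn z))"
        if "z \<in> Z \<inter> {z. cmod z \<le> 1} \<and> \<not> cmod z \<le> 1 \<or> z \<in> Z \<inter> {z. 1 \<le> cmod z} \<and> cmod z \<le> 1" for z
      proof -
        have z: "z \<in> Z" "norm z = 1" using that by auto
        then have "sgn z = z" by (simp add: sgn_div_norm)
        then show ?thesis using \<tau>(2)[of z] sgn[OF z(1)] z by simp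
      qed
    qed
    moreover have "(Z \<inter> {z. norm z \<le> 1}) \<union> (Z \<inter> {z. norm z \<ge> 1}) = Z" by auto
    ultimately show ?thesis by simp
  qed
  have inA: "F z \<in> A" if "norm z \<le> 1" for z
    using that A.im by (auto simp: F_def)
  have inB: "F z \<in> B" if "z \<in> Z" "norm z > 1" for z
    using outer(1)[OF that(1)] that B.im by (auto simp: F_def)
  have cross: "False" if zw: "z \<in> Z" "w \<in> Z" "F z = F w" "norm z \<le> 1" "norm w > 1" for z w
  proof -
    have "F w \<in> disc_boundary B" using inA[of z] inB[of w] zw AB by auto
    then have "g ((2 - cmod w) *\<^sub>R \<tau> (sgn w)) \<in> disc_boundary B" using zw by (simp add: F_def)
    then have "norm ((2 - cmod w) *\<^sub>R \<tau> (sgn w)) = 1"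
      using B.in_boundary_iff[OF outer(1)[of w]] zw by simp
    then show False using outer(2)[of w] zw by simp
  qed
  have iF: "inj_on F Z"
  proof (rule inj_onI)
    fix z w assume zw: "z \<in> Z" "w \<in> Z" "F z = F w"
    consider "norm z \<le> 1" "norm w \<le> 1" | "norm z > 1" "norm w > 1"
      using cross zw by (metis linorder_not_le)
    then show "z = w"
    proof cases
      case 1
      then show ?thesis using zw A.inj by (auto simp: F_def dest: inj_onD)
    next
      case 2
      then have eq: "(2 - norm z) *\<^sub>R \<tau> (sgn z) = (2 - norm w) *\<^sub>R \<tau> (sgn w)"
        using zw outer(1)[of z] outer(1)[of w] B.inj by (auto simp: F_def dest: inj_onD)
      then have n: "norm z = norm w" using outer(2)[of z] outer(2)[of w] 2 zw by (metis diff_left_imp_eq less_imp_le)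
      have "2 - norm w \<noteq> 0" using zw by (simp add: Z_def)
      then have "\<tau> (sgn z) = \<tau> (sgn w)" using eq n by simp
      then have "sgn z = sgn w" using \<tau>inj sgn zw by blast
      then have "norm z *\<^sub>R sgn z = norm w *\<^sub>R sgn w" using n by simp
      moreover have "norm u *\<^sub>R sgn u = u" for u :: complex
        by (cases "u = 0") (simp_all add: sgn_div_norm)
      ultimately show ?thesis by simp
    qed
  qed
  have FS: "F ` Z \<subseteq> A \<union> B" using inA inB by (metis UnCI image_subsetI linorder_not_le)
  show thesis
  proof (rule that)
    show "openin (top_of_set S) (F ` Z)"
      using embedded_open_surface(1)[OF S opZ cF iF] FS A B by blast
    show "F ` Z \<subseteq> A \<union> B" by fact
    show "X \<subseteq> F ` Z"
    proof
      fix x assume x: "x \<in> X"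
      then obtain z where z: "z \<in> sphere 0 1" "x = h z" using XA A.boundary by blast
      then have "z \<in> J" using J(2) x by blast
      moreover have "sgn z = z" using z by (simp add: sgn_div_norm)
      moreover have "z \<noteq> 0" using z by auto
      ultimately have "z \<in> Z" using z by (simp add: Z_def)
      moreover have "F z = x" using z by (simp add: F_def)
      ultimately show "x \<in> F ` Z" by blast
    qed
  qed
qed

section \<open>Tangent cones and projection to the tangent plane\<close>

text \<open>In a chart the derivative maps to the tangent plane at \<open>p\<close>, expands by at least some factor \<open>m\<close>, and
  differs little from the difference quotients nearby. So the secants near \<open>p\<close> are nearly tangential. The
  later arguments use this conclusion as a substitute for writing the surface as a graph over its
  tangent plane.\<close>

lemma surface_secant_angle:
  assumes k: "1 \<le> k" and N: "unit_normal k S N" and p: "p \<in> surface_interior k S" and e: "0 < e"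
  obtains \<rho> where "0 < \<rho>" "\<And>y z. y \<in> S \<inter> ball p \<rho> \<Longrightarrow> z \<in> S \<inter> ball p \<rho> \<Longrightarrow> \<bar>(y - z) \<bullet> N p\<bar> \<le> e * norm (y - z)"
proof -
  obtain \<phi> \<psi> V where c: "surface_param k \<phi> V" "p \<in> \<phi> ` V" "openin (top_of_set S) (\<phi> ` V)"
    "homeomorphism V (\<phi> ` V) \<phi> \<psi>" "open V"
    using p by (rule surface_interior_chart)
  have \<phi>S: "\<phi> ` V \<subseteq> S" using c(3) by (rule openin_imp_subset)
  define D where "D x = frechet_derivative \<phi> (at x)" for x
  have "times_cont_diff_on (Suc 0) \<phi> V"
    using c(1) k unfolding surface_param_def Ck_on_def by (metis One_nat_def one_enat_def)
  then have diff: "\<And>x. x \<in> V \<Longrightarrow> \<phi> differentiable (at x)" and Dc: "\<And>v. continuous_on V (\<lambda>x. D x v)"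
    by (auto simp: D_def)
  have der: "(\<phi> has_derivative D x) (at x)" if "x \<in> V" for x
    using diff[OF that] unfolding D_def by (simp add: frechet_derivative_works)
  obtain x0 where x0: "x0 \<in> V" "\<phi> x0 = p" using c(2) by blast
  have \<psi>p: "\<psi> p = x0" using homeomorphism_apply1[OF c(4) x0(1)] x0(2) by simp
  have linD: "linear (D x)" if "x \<in> V" for x
    using der[OF that] by (metis has_derivative_linear)
  have "inj (D x0)" using c(1) x0(1) unfolding surface_param_def D_def by blast
  then obtain m where m: "0 < m" "\<And>v. m * norm v \<le> norm (D x0 v)"
    using linear_inj_bounded_below_pos[OF linD[OF x0(1)]] by blast
  have normal: "N p \<bullet> D x0 v = 0" for v
    using N c(1) \<phi>S x0 unfolding unit_normal_def D_def by blast
  have Np: "norm (N p) = 1" using N c(2) \<phi>S unfolding unit_normal_def by blast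
  define \<eta> where "\<eta> = min (m / 2) (e * m / 2)"
  have \<eta>: "0 < \<eta>" "\<eta> \<le> m / 2" "\<eta> \<le> e * m / 2" using m e by (auto simp: \<eta>_def)
  define s where "s x = (\<Sum>i\<in>(Basis::(real^2) set). norm (D x i - D x0 i))" for x
  have "continuous_on V s"
    unfolding s_def by (intro continuous_intros Dc)
  then have "open (V \<inter> s -` {..<\<eta>})"
    using c(5) by (intro continuous_open_preimage) auto
  moreover have "x0 \<in> V \<inter> s -` {..<\<eta>}" using x0 \<eta> by (simp add: s_def)
  ultimately obtain r where r: "0 < r" "ball x0 r \<subseteq> V \<inter> s -` {..<\<eta>}"
    by (meson openE)
  define f where "f x = \<phi> x - D x0 x" for x
  have fd: "(f has_derivative (\<lambda>v. D x v - D x0 v)) (at x within ball x0 r)" if "x \<in> ball x0 r" for x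
  proof -
    have "x \<in> V" using that r by blast
    moreover have "(D x0 has_derivative D x0) (at x)"
      using linD[OF x0(1)] by (simp add: linear_imp_has_derivative)
    ultimately have "(f has_derivative (\<lambda>v. D x v - D x0 v)) (at x)"
      unfolding f_def by (intro has_derivative_diff der)
    then show ?thesis by (rule has_derivative_at_withinI)
  qed
  have on: "onorm (\<lambda>v. D x v - D x0 v) \<le> \<eta>" if x: "x \<in> ball x0 r" for x
  proof (rule onorm_le)
    fix v :: "real^2"
    have xV: "x \<in> V" and sx: "s x < \<eta>" using x r by blast+
    have lin: "linear (\<lambda>v. D x v - D x0 v)" using linD xV x0 by (intro linear_compose_sub) auto
    have "D x v - D x0 v = D x (\<Sum>i\<in>Basis. (v \<bullet> i) *\<^sub>R i) - D x0 (\<Sum>i\<in>Basis. (v \<bullet> i) *\<^sub>R i)"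
      by (simp only: euclidean_representation)
    also have "\<dots> = (\<Sum>i\<in>Basis. (v \<bullet> i) *\<^sub>R (D x i - D x0 i))"
      using linear_sum[OF lin, of "\<lambda>i. (v \<bullet> i) *\<^sub>R i" Basis] linear_cmul[OF lin] by simp
    finally have ex: "D x v - D x0 v = (\<Sum>i\<in>Basis. (v \<bullet> i) *\<^sub>R (D x i - D x0 i))" .
    have "norm (D x v - D x0 v) \<le> (\<Sum>i\<in>Basis. norm v * norm (D x i - D x0 i))"
      unfolding ex by (intro sum_norm_le) (auto intro!: mult_right_mono Basis_le_norm)
    also have "\<dots> = norm v * s x" by (simp add: s_def sum_distrib_left)
    also have "\<dots> \<le> \<eta> * norm v" using sx mult_left_mono[of "s x" \<eta> "norm v"] by (simp add: mult.commute)
    finally show "norm (D x v - D x0 v) \<le> \<eta> * norm v" .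
  qed
  have bound: "norm (f a - f b) \<le> \<eta> * norm (a - b)" if "a \<in> ball x0 r" "b \<in> ball x0 r" for a b
    using differentiable_bound[OF convex_ball fd on that] .
  have "\<exists>\<rho>1>0. \<forall>y\<in>\<phi> ` V. dist y p < \<rho>1 \<longrightarrow> dist (\<psi> y) (\<psi> p) < r"
    using homeomorphism_cont2[OF c(4)] c(2) r(1) unfolding continuous_on_iff by blast
  then obtain \<rho>1 where \<rho>1: "0 < \<rho>1" "\<And>y. y \<in> \<phi> ` V \<Longrightarrow> dist y p < \<rho>1 \<Longrightarrow> dist (\<psi> y) (\<psi> p) < r"
    by blast
  have "\<exists>\<rho>2>0. ball p \<rho>2 \<inter> S \<subseteq> \<phi> ` V"
    using c(2,3) unfolding openin_contains_ball by blast
  then obtain \<rho>2 where \<rho>2: "0 < \<rho>2" "ball p \<rho>2 \<inter> S \<subseteq> \<phi> ` V" by blast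
  show thesis
  proof (rule that[of "min \<rho>1 \<rho>2"])
    show "0 < min \<rho>1 \<rho>2" using \<rho>1 \<rho>2 by simp
    fix y z assume yz: "y \<in> S \<inter> ball p (min \<rho>1 \<rho>2)" "z \<in> S \<inter> ball p (min \<rho>1 \<rho>2)"
    have par: "\<exists>a\<in>ball x0 r. y = \<phi> a" if "y \<in> S \<inter> ball p (min \<rho>1 \<rho>2)" for y
    proof -
      have yV: "y \<in> \<phi> ` V" and d: "dist y p < \<rho>1" using that \<rho>2(2) by (auto simp: dist_commute)
      have "dist (\<psi> y) x0 < r" using \<rho>1(2)[OF yV d] \<psi>p by simp
      moreover have "\<phi> (\<psi> y) = y" using homeomorphism_apply2[OF c(4) yV] .
      ultimately show ?thesis by (metis dist_commute mem_ball)
    qed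
    obtain a b where ab: "a \<in> ball x0 r" "y = \<phi> a" "b \<in> ball x0 r" "z = \<phi> b"
      using par yz by meson
    have "D x0 (a - b) = D x0 a - D x0 b" using linD[OF x0(1)] by (simp add: linear_diff)
    then have eq: "y - z = (f a - f b) + D x0 (a - b)"
      by (simp add: f_def ab algebra_simps)
    have "norm (D x0 (a - b)) \<le> norm (y - z) + norm (f a - f b)"
      unfolding eq using norm_triangle_ineq4[of "f a - f b + D x0 (a - b)" "f a - f b"] by simp
    then have "m * norm (a - b) \<le> norm (y - z) + \<eta> * norm (a - b)"
      using m(2)[of "a - b"] bound[OF ab(1,3)] by linarith
    moreover have "\<eta> * norm (a - b) \<le> m / 2 * norm (a - b)" using \<eta>(2) by (intro mult_right_mono) auto
    ultimately have 1: "m / 2 * norm (a - b) \<le> norm (y - z)" by linarith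
    have "(y - z) \<bullet> N p = (f a - f b) \<bullet> N p"
      unfolding eq inner_add_left using normal[of "a - b"] by (simp add: inner_commute)
    then have "\<bar>(y - z) \<bullet> N p\<bar> \<le> norm (f a - f b)"
      using Cauchy_Schwarz_ineq2[of "f a - f b" "N p"] Np by simp
    also have "\<dots> \<le> \<eta> * norm (a - b)" by (rule bound[OF ab(1,3)])
    also have "\<dots> \<le> e * m / 2 * norm (a - b)" using \<eta>(3) by (intro mult_right_mono) auto
    also have "\<dots> = e * (m / 2 * norm (a - b))" by simp
    also have "\<dots> \<le> e * norm (y - z)" using 1 e by (intro mult_left_mono) auto
    finally show "\<bar>(y - z) \<bullet> N p\<bar> \<le> e * norm (y - z)" .
  qed
qed

text \<open>Near \<open>p\<close> the normal differs by less than \<open>1/4\<close> from the one at \<open>p\<close>, and the secants satisfy the bound with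
  \<open>1/4\<close> for the normal at \<open>p\<close>; a Lebesgue number of the resulting cover is a uniform radius.\<close>

lemma surface_secant_angle_uniform:
  assumes k: "1 \<le> k" and N: "unit_normal k S N" and X: "compact X" "X \<subseteq> surface_interior k S"
  obtains \<rho> where "0 < \<rho>" "\<And>p y z. p \<in> X \<Longrightarrow> y \<in> S \<inter> ball p \<rho> \<Longrightarrow> z \<in> S \<inter> ball p \<rho> \<Longrightarrow>
    \<bar>(y - z) \<bullet> N p\<bar> \<le> norm (y - z) / 2"
proof -
  have XS: "X \<subseteq> S" using X(2) surface_interior_subset by blast
  have "\<exists>\<rho>>0. \<forall>q\<in>X \<inter> ball p \<rho>. \<forall>y\<in>S \<inter> ball p \<rho>. \<forall>z\<in>S \<inter> ball p \<rho>. \<bar>(y - z) \<bullet> N q\<bar> \<le> norm (y - z) / 2"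
    if p: "p \<in> X" for p
  proof -
    obtain \<rho>1 where \<rho>1: "0 < \<rho>1" "\<And>y z. y \<in> S \<inter> ball p \<rho>1 \<Longrightarrow> z \<in> S \<inter> ball p \<rho>1 \<Longrightarrow> \<bar>(y - z) \<bullet> N p\<bar> \<le> 1/4 * norm (y - z)"
      by (rule surface_secant_angle[OF k N, of p "1/4"]) (use p X(2) in auto)
    have "continuous_on S N" "p \<in> S" using N p XS by (auto simp: unit_normal_def)
    then have "\<forall>e>0. \<exists>d>0. \<forall>q\<in>S. dist q p < d \<longrightarrow> dist (N q) (N p) < e"
      unfolding continuous_on_iff by blast
    from this[rule_format, of "1/4"]
    have "\<exists>d>0. \<forall>q\<in>S. dist q p < d \<longrightarrow> dist (N q) (N p) < 1/4" by simp
    then obtain d where d: "0 < d" "\<And>q. q \<in> S \<Longrightarrow> dist q p < d \<Longrightarrow> dist (N q) (N p) < 1/4"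
      by blast
    show ?thesis
    proof (intro exI[of _ "min \<rho>1 d"] conjI ballI)
      show "0 < min \<rho>1 d" using \<rho>1 d by simp
      fix q y z assume q: "q \<in> X \<inter> ball p (min \<rho>1 d)" and yz: "y \<in> S \<inter> ball p (min \<rho>1 d)" "z \<in> S \<inter> ball p (min \<rho>1 d)"
      have "norm (N q - N p) < 1/4" using d(2)[of q] q XS by (auto simp: dist_commute simp flip: dist_norm)
      moreover have "\<bar>(y - z) \<bullet> (N q - N p)\<bar> \<le> norm (y - z) * norm (N q - N p)"
        by (rule Cauchy_Schwarz_ineq2)
      ultimately have "\<bar>(y - z) \<bullet> (N q - N p)\<bar> \<le> norm (y - z) * (1/4)"
        by (meson less_eq_real_def mult_left_mono norm_ge_zero order_trans)
      moreover have "\<bar>(y - z) \<bullet> N p\<bar> \<le> 1/4 * norm (y - z)" using \<rho>1(2) yz by auto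
      moreover have "(y - z) \<bullet> N q = (y - z) \<bullet> N p + (y - z) \<bullet> (N q - N p)"
        by (simp add: inner_diff_right)
      ultimately show "\<bar>(y - z) \<bullet> N q\<bar> \<le> norm (y - z) / 2" by linarith
    qed
  qed
  then obtain r where r: "\<And>p. p \<in> X \<Longrightarrow> 0 < r p"
    "\<And>p q y z. p \<in> X \<Longrightarrow> q \<in> X \<inter> ball p (r p) \<Longrightarrow> y \<in> S \<inter> ball p (r p) \<Longrightarrow> z \<in> S \<inter> ball p (r p) \<Longrightarrow> \<bar>(y - z) \<bullet> N q\<bar> \<le> norm (y - z) / 2"
    by metis
  have "X \<subseteq> \<Union>((\<lambda>p. ball p (r p)) ` X)" using r(1) by fastforce
  then obtain \<rho> where \<rho>: "0 < \<rho>" "\<And>q. q \<in> X \<Longrightarrow> \<exists>G\<in>(\<lambda>p. ball p (r p)) ` X. ball q \<rho> \<subseteq> G"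
    using Heine_Borel_lemma[OF X(1), of "(\<lambda>p. ball p (r p)) ` X"] by blast
  show thesis
  proof (rule that[OF \<rho>(1)])
    fix q y z assume q: "q \<in> X" and yz: "y \<in> S \<inter> ball q \<rho>" "z \<in> S \<inter> ball q \<rho>"
    obtain p where p: "p \<in> X" "ball q \<rho> \<subseteq> ball p (r p)" using \<rho>(2)[OF q] by blast
    have "q \<in> ball q \<rho>" using \<rho>(1) by simp
    then show "\<bar>(y - z) \<bullet> N q\<bar> \<le> norm (y - z) / 2"
      using r(2)[OF p(1), of q y z] p(2) q yz by blast
  qed
qed

lemma parallel_secant_eq:
  assumes "\<bar>(y - z) \<bullet> \<nu>\<bar> \<le> norm (y - z) / 2" "y - z = s *\<^sub>R \<nu>" "norm \<nu> = 1"
  shows "y = z"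
proof -
  have "\<nu> \<bullet> \<nu> = 1" using assms(3) by (simp add: dot_square_norm)
  then have "\<bar>s\<bar> \<le> \<bar>s\<bar> / 2" using assms by simp
  then have "s = 0" by simp
  then show ?thesis using assms(2) by simp
qed

text \<open>The tangential part has at least \<open>3/4\<close> of the squared length, and \<open>4/3 \<le> (6/5)\<^sup>2\<close>. The simple
  bound \<open>6/5\<close> leaves enough room to stay inside the balls in the lemmas below.\<close>

lemma norm_le_tangential:
  fixes \<nu> :: "'a::real_inner"
  assumes "norm \<nu> = 1" "\<bar>x \<bullet> \<nu>\<bar> \<le> norm x / 2"
  shows "norm x \<le> 6/5 * norm (x - (x \<bullet> \<nu>) *\<^sub>R \<nu>)"
proof -
  let ?P = "x - (x \<bullet> \<nu>) *\<^sub>R \<nu>"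
  have nn: "\<nu> \<bullet> \<nu> = 1" using assms(1) by (simp add: dot_square_norm)
  have "(norm x)\<^sup>2 = (norm ?P)\<^sup>2 + (x \<bullet> \<nu>)\<^sup>2"
    unfolding power2_norm_eq_inner using nn
    by (simp add: inner_diff_left inner_diff_right inner_commute power2_eq_square)
  moreover have "(x \<bullet> \<nu>)\<^sup>2 \<le> (norm x / 2)\<^sup>2"
    using assms(2) by (metis abs_ge_zero power2_abs power_mono)
  ultimately have "3 * (norm x)\<^sup>2 \<le> 4 * (norm ?P)\<^sup>2" by (simp add: power_divide)
  moreover have "0 \<le> (norm ?P)\<^sup>2" by simp
  ultimately have "25 * (norm x)\<^sup>2 \<le> 36 * (norm ?P)\<^sup>2" by linarith
  then have "(norm x)\<^sup>2 \<le> (6/5 * norm ?P)\<^sup>2"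
    by (simp add: power_mult_distrib power_divide)
  then show ?thesis by (rule power2_le_imp_le) simp
qed

text \<open>Take a point of the surface whose projection to the tangent plane is closest to that of the line.
  If it did not lie on the line it could be moved closer, because the projection is injective on the
  surface near \<open>p\<close> and therefore open by invariance of domain.\<close>

lemma normal_line_meets_surface:
  fixes w :: "real^3"
  assumes S: "closed S" "S \<inter> ball p (3 * r) \<subseteq> surface_interior k S" and p: "p \<in> S" and \<nu>: "norm \<nu> = 1"
    and cone: "\<And>y z. y \<in> S \<inter> cball p (3 * r) \<Longrightarrow> z \<in> S \<inter> cball p (3 * r) \<Longrightarrow> \<bar>(y - z) \<bullet> \<nu>\<bar> \<le> norm (y - z) / 2"
    and w: "w \<in> cball p r"  and r: "0 < r"
  obtains y s where "y \<in> S \<inter> cball p (3 * r)" "w = y + s *\<^sub>R \<nu>" "\<bar>s\<bar> \<le> 4 * r"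
proof -
  define P where "P y = y - (y \<bullet> \<nu>) *\<^sub>R \<nu>" for y :: "real^3"
  have nn: "\<nu> \<bullet> \<nu> = 1" using \<nu> by (simp add: dot_square_norm)
  have Pdiff: "P (y - z) = P y - P z" for y z
    by (simp add: P_def inner_diff_left scaleR_diff_left)
  have normP: "norm (P y) \<le> norm y" for y
  proof (rule power2_le_imp_le)
    have "(norm y)\<^sup>2 = (norm (P y))\<^sup>2 + (y \<bullet> \<nu>)\<^sup>2"
      unfolding P_def power2_norm_eq_inner using nn
      by (simp add: inner_diff_left inner_diff_right inner_commute power2_eq_square)
    then show "(norm (P y))\<^sup>2 \<le> (norm y)\<^sup>2" by simp
  qed simp
  have Pinj: "y = z" if "P y = P z" "y \<in> S \<inter> cball p (3 * r)" "z \<in> S \<inter> cball p (3 * r)" for y z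
  proof (rule parallel_secant_eq[OF cone[OF that(2,3)] _ \<nu>])
    show "y - z = ((y - z) \<bullet> \<nu>) *\<^sub>R \<nu>" using that(1) Pdiff[of y z] by (simp add: P_def)
  qed
  have Pc: "continuous_on X P" for X unfolding P_def by (intro continuous_intros)
  let ?K = "S \<inter> cball p (3 * r)"
  have K: "compact ?K" using S(1) by (simp add: closed_Int_compact)
  have pK: "p \<in> ?K" using p r by simp
  have "compact (P ` ?K)" using Pc K by (rule compact_continuous_image)
  then obtain u where u: "u \<in> P ` ?K" "\<And>v. v \<in> P ` ?K \<Longrightarrow> dist (P w) u \<le> dist (P w) v"
    using distance_attains_inf[of "P ` ?K" "P w"] pK by (metis compact_imp_closed empty_iff imageI)
  obtain y where y: "y \<in> ?K" "u = P y" using u(1) by blast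
  have "P w = P y"
  proof (rule ccontr)
    assume ne: "P w \<noteq> P y"
    have "dist (P w) (P y) \<le> dist (P w) (P p)" using u(2)[of "P p"] pK y by blast
    also have "\<dots> \<le> dist w p" unfolding dist_norm Pdiff[symmetric] by (rule normP)
    also have "\<dots> \<le> r" using w by (simp add: dist_commute)
    finally have 1: "dist (P w) (P y) \<le> r" .
    have "dist (P w) (P p) \<le> r" using w normP[of "w - p"] by (simp add: dist_norm Pdiff[symmetric] norm_minus_commute)
    with 1 have "dist (P y) (P p) \<le> 2 * r" using dist_triangle3[of "P y" "P p" "P w"] by simp
    then have "norm (P (y - p)) \<le> 2 * r" by (simp add: dist_norm Pdiff)
    moreover have "norm (y - p) \<le> 6/5 * norm (P (y - p))"
      unfolding P_def by (rule norm_le_tangential[OF \<nu> cone[OF y(1) pK]])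
    ultimately have "dist p y < 3 * r" using r by (simp add: dist_norm norm_minus_commute)
    then have yb: "y \<in> S \<inter> ball p (3 * r)" using y by simp
    then have "y \<in> surface_interior k S" using S(2) by blast
    then obtain \<phi> \<psi> V where c: "surface_param k \<phi> V" "y \<in> \<phi> ` V" "openin (top_of_set S) (\<phi> ` V)"
      "homeomorphism V (\<phi> ` V) \<phi> \<psi>" "open V"
      by (rule surface_interior_chart)
    define Q where "Q = V \<inter> \<phi> -` ball p (3 * r)"
    have Q: "open Q" unfolding Q_def
      using homeomorphism_cont1[OF c(4)] c(5) by (intro continuous_open_preimage) auto
    have QK: "\<phi> ` Q \<subseteq> ?K" using openin_imp_subset[OF c(3)] by (auto simp: Q_def)
    let ?H = "{x. \<nu> \<bullet> x = 0}"
    have "openin (top_of_set ?H) ((P \<circ> \<phi>) ` Q)"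
    proof (rule invariance_of_domain_subspaces[of UNIV])
      show "openin (top_of_set UNIV) Q" using Q by simp
      show "subspace ?H" by (rule subspace_hyperplane)
      have "\<nu> \<noteq> 0" using \<nu> by auto
      then show "dim ?H \<le> dim (UNIV :: (real^2) set)" by (simp add: dim_hyperplane)
      show "continuous_on Q (P \<circ> \<phi>)"
        using homeomorphism_cont1[OF c(4)] Pc by (intro continuous_on_compose) (auto simp: Q_def intro: continuous_on_subset)
      show "P \<circ> \<phi> \<in> Q \<rightarrow> ?H" using nn by (auto simp: P_def inner_diff_right inner_commute)
      show "inj_on (P \<circ> \<phi>) Q"
      proof (rule comp_inj_on)
        show "inj_on \<phi> Q"
          by (rule inj_on_inverseI[of _ \<psi>]) (use homeomorphism_apply1[OF c(4)] Q_def in blast)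
        show "inj_on P (\<phi> ` Q)" using Pinj QK by (meson inj_onI subsetD)
      qed
    qed simp_all
    moreover obtain x where "x \<in> V" "y = \<phi> x" using c(2) by blast
    then have "P y \<in> (P \<circ> \<phi>) ` Q" using yb by (auto simp: Q_def)
    ultimately obtain \<epsilon> where \<epsilon>: "0 < \<epsilon>" "ball (P y) \<epsilon> \<inter> ?H \<subseteq> (P \<circ> \<phi>) ` Q"
      unfolding openin_contains_ball by blast
    \<comment> \<open>The point at parameter \<open>t\<close> on the segment from the projection of \<open>y\<close> to that of \<open>w\<close>.\<close>
    define t where "t = min (1/2) (\<epsilon> / 2 / norm (P w - P y))"
    have nz: "norm (P w - P y) > 0" using ne by simp
    have t: "0 < t" "t < 1" using \<epsilon> nz by (auto simp: t_def)
    have "t * norm (P w - P y) \<le> \<epsilon> / 2" using nz by (simp add: t_def min_def field_simps)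
    define v where "v = P y + t *\<^sub>R (P w - P y)"
    have "v \<in> ball (P y) \<epsilon>"
      using \<open>t * norm (P w - P y) \<le> \<epsilon> / 2\<close> \<epsilon>(1) t by (simp add: v_def dist_norm)
    moreover have "v \<in> ?H" using nn by (simp add: v_def P_def inner_add_right inner_diff_right inner_commute)
    ultimately have "v \<in> (P \<circ> \<phi>) ` Q" using \<epsilon>(2) by blast
    then have "v \<in> P ` ?K" using QK by auto
    then have "dist (P w) (P y) \<le> dist (P w) v" using u(2) y by blast
    moreover have "P w - v = (1 - t) *\<^sub>R (P w - P y)" by (simp add: v_def algebra_simps)
    then have "dist (P w) v = (1 - t) * norm (P w - P y)" using t by (simp add: dist_norm)
    ultimately have "norm (P w - P y) \<le> (1 - t) * norm (P w - P y)" by (simp add: dist_norm)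
    then show False using nz t by simp
  qed
  then have eq: "w = y + ((w - y) \<bullet> \<nu>) *\<^sub>R \<nu>"
    using Pdiff[of w y] by (simp add: P_def algebra_simps)
  have "\<bar>(w - y) \<bullet> \<nu>\<bar> \<le> norm (w - y)" using Cauchy_Schwarz_ineq2[of "w - y" \<nu>] \<nu> by simp
  also have "\<dots> \<le> 4 * r" using w y norm_triangle_ineq4[of "w - p" "y - p"] by (simp add: dist_norm norm_minus_commute)
  finally show thesis using that[OF y(1) eq] by blast
qed

section \<open>Rigid images of surfaces\<close>

lemma times_cont_diff_on_cong:
  assumes "open U" "\<And>x. x \<in> U \<Longrightarrow> f x = g x" "times_cont_diff_on n f U"
  shows "times_cont_diff_on n g U"
  using assms
proof (induction n arbitrary: f g)
  case 0
  then show ?case using continuous_on_cong[of U U f g] by simp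
next
  case (Suc n)
  have fd: "(f has_derivative D) (at x) \<longleftrightarrow> (g has_derivative D) (at x)" if x: "x \<in> U" for x D
    using has_derivative_transform_within_open[OF _ Suc.prems(1) x, of f D UNIV g]
      has_derivative_transform_within_open[OF _ Suc.prems(1) x, of g D UNIV f] Suc.prems(2) by auto
  have eq: "frechet_derivative f (at x) = frechet_derivative g (at x)" if "x \<in> U" for x
    using fd[OF that] by (simp add: frechet_derivative_def)
  have "g differentiable (at x)" if "x \<in> U" for x
  proof -
    have "f differentiable (at x)" using Suc.prems(3) that by simp
    then show ?thesis using fd[OF that] unfolding differentiable_def by blast
  qed
  moreover have "times_cont_diff_on n (\<lambda>x. frechet_derivative g (at x) v) U" for v
    by (rule Suc.IH[OF Suc.prems(1), of "\<lambda>x. frechet_derivative f (at x) v"]) (use eq Suc.prems(3) in auto)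
  ultimately show ?case by simp
qed

lemma times_cont_diff_on_linear_compose:
  fixes L :: "'b::real_normed_vector \<Rightarrow> 'c::real_normed_vector"
  assumes L: "bounded_linear L" and U: "open U" and f: "times_cont_diff_on n f U"
  shows "times_cont_diff_on n (\<lambda>x. L (f x) + b) U"
  using f
proof (induction n arbitrary: f b)
  case 0
  then show ?case using L by (auto intro!: continuous_intros bounded_linear.continuous_on[OF L])
next
  case (Suc n)
  have der: "((\<lambda>x. L (f x) + b) has_derivative (\<lambda>v. L (frechet_derivative f (at x) v))) (at x)"
    if "x \<in> U" for x
  proof -
    have "(f has_derivative frechet_derivative f (at x)) (at x)"
      using Suc.prems that by (simp add: frechet_derivative_works)
    from has_derivative_add_const[OF bounded_linear.has_derivative[OF L this]] show ?thesis .
  qed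
  have eq: "frechet_derivative (\<lambda>x. L (f x) + b) (at x) = (\<lambda>v. L (frechet_derivative f (at x) v))"
    if "x \<in> U" for x
    using frechet_derivative_at[OF der[OF that]] by simp
  have "times_cont_diff_on n (\<lambda>x. frechet_derivative (\<lambda>x. L (f x) + b) (at x) v) U" for v
  proof (rule times_cont_diff_on_cong[OF U])
    show "times_cont_diff_on n (\<lambda>x. L (frechet_derivative f (at x) v) + 0) U"
      by (rule Suc.IH) (use Suc.prems in simp)
  qed (simp add: eq)
  then show ?case using der by (auto simp: differentiable_def)
qed

lemma surface_param_differentiable:
  assumes "1 \<le> k" "surface_param k \<phi> V" "x \<in> V"
  shows "\<phi> differentiable (at x)"
proof -
  have "times_cont_diff_on (Suc 0) \<phi> V"
    using assms unfolding surface_param_def Ck_on_def by (metis One_nat_def one_enat_def)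
  with assms(3) show ?thesis by simp
qed

lemma frechet_derivative_rigid_compose:
  assumes g: "rigid_motion g" and d: "\<phi> differentiable (at x)"
  shows "frechet_derivative (g \<circ> \<phi>) (at x) = linear_part g \<circ> frechet_derivative \<phi> (at x)"
proof -
  have L: "bounded_linear (linear_part g)"
    using linear_linear_part[OF g] by (simp add: linear_conv_bounded_linear)
  have geq: "g \<circ> \<phi> = (\<lambda>x. linear_part g (\<phi> x) + g 0)"
    by (rule ext) (simp add: linear_part_def)
  have "(\<phi> has_derivative frechet_derivative \<phi> (at x)) (at x)"
    using d by (simp add: frechet_derivative_works)
  from has_derivative_add_const[OF bounded_linear.has_derivative[OF L this], of "g 0"]
  have "((g \<circ> \<phi>) has_derivative (\<lambda>v. linear_part g (frechet_derivative \<phi> (at x) v))) (at x)"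
    by (simp only: geq)
  from frechet_derivative_at[OF this] show ?thesis by (simp add: comp_def)
qed

lemma surface_param_rigid:
  assumes k: "1 \<le> k" and g: "rigid_motion g" and \<phi>: "surface_param k \<phi> V"
  shows "surface_param k (g \<circ> \<phi>) V"
proof -
  have V: "open V" using \<phi> by (simp add: surface_param_def)
  have L: "bounded_linear (linear_part g)"
    using linear_linear_part[OF g] by (simp add: linear_conv_bounded_linear)
  have geq: "g \<circ> \<phi> = (\<lambda>x. linear_part g (\<phi> x) + g 0)"
    by (rule ext) (simp add: linear_part_def)
  have inj: "inj (linear_part g)"
    using orthogonal_transformation_linear_part[OF g] by (rule orthogonal_transformation_inj)
  have "Ck_on k (g \<circ> \<phi>) V"
    using \<phi> unfolding surface_param_def Ck_on_def geq
    by (auto intro: times_cont_diff_on_linear_compose[OF L V])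
  moreover have "inj (frechet_derivative (g \<circ> \<phi>) (at x))" if "x \<in> V" for x
    using frechet_derivative_rigid_compose[OF g surface_param_differentiable[OF k \<phi> that]]
      \<phi> that inj unfolding surface_param_def by (metis inj_compose)
  moreover obtain \<psi> where "homeomorphism V (\<phi> ` V) \<phi> \<psi>"
    using \<phi> unfolding surface_param_def by blast
  then have "homeomorphism V (g ` \<phi> ` V) (g \<circ> \<phi>) (\<psi> \<circ> motion_inv g)"
    using homeomorphism_rigid_motion[OF g] by (rule homeomorphism_compose)
  then have "\<exists>\<psi>. homeomorphism V ((g \<circ> \<phi>) ` V) (g \<circ> \<phi>) \<psi>"
    by (auto simp: image_comp)
  ultimately show ?thesis using V by (simp add: surface_param_def)
qed

lemma openin_rigid_image:
  assumes "rigid_motion g" "openin (top_of_set S) W"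
  shows "openin (top_of_set (g ` S)) (g ` W)"
  using homeomorphism_imp_open_map[OF homeomorphism_rigid_motion[OF assms(1)] assms(2)] .

lemma open_rigid_image:
  assumes "rigid_motion g" "open U"
  shows "open (g ` U)"
  using openin_rigid_image[OF assms(1), of UNIV U] assms bij_rigid_motion[OF assms(1)]
  by (simp add: bij_is_surj)

lemma surface_interior_rigid_image:
  assumes k: "1 \<le> k" and g: "rigid_motion g"
  shows "g ` surface_interior k S \<subseteq> surface_interior k (g ` S)"
proof
  fix q assume "q \<in> g ` surface_interior k S"
  then obtain p where p: "p \<in> surface_interior k S" "q = g p" by blast
  then obtain \<phi> V where c: "surface_param k \<phi> V" "p \<in> \<phi> ` V" "openin (top_of_set S) (\<phi> ` V)"
    by (metis surface_interior_chart)
  have "openin (top_of_set (g ` S)) ((g \<circ> \<phi>) ` V)"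
    using openin_rigid_image[OF g c(3)] by (simp add: image_comp)
  moreover have "q \<in> (g \<circ> \<phi>) ` V" using c(2) p(2) by auto
  moreover have "q \<in> g ` S" using p surface_interior_subset by blast
  ultimately show "q \<in> surface_interior k (g ` S)"
    unfolding surface_interior_def using surface_param_rigid[OF k g c(1)] by blast
qed

lemma Ck_surface_rigid_image:
  assumes k: "1 \<le> k" and g: "rigid_motion g" and S: "Ck_surface k S"
  shows "Ck_surface k (g ` S)"
proof -
  have hom: "homeomorphism UNIV UNIV g (motion_inv g)"
    using homeomorphism_rigid_motion[OF g, of UNIV] bij_rigid_motion[OF g] by (simp add: bij_is_surj)
  have 1: "g ` S \<noteq> {}" "closed (g ` S)" "connected (g ` S)"
    using S homeomorphism_imp_closed_map[OF hom, of S] connected_continuous_image[OF continuous_on_rigid_motion[OF g]]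
    by (auto simp: Ck_surface_def)
  have 2: "\<exists>U \<phi> V. open U \<and> q \<in> U \<and> surface_param k \<phi> V \<and> g ` S \<inter> U \<subseteq> \<phi> ` V" if q: "q \<in> g ` S" for q
  proof -
    obtain p where p: "p \<in> S" "q = g p" using q by blast
    obtain U \<phi> V where U: "open U" "p \<in> U" "surface_param k \<phi> V" "S \<inter> U \<subseteq> \<phi> ` V"
      using S p(1) unfolding Ck_surface_def by blast
    have "g ` S \<inter> g ` U = g ` (S \<inter> U)" using inj_rigid_motion[OF g] by (simp add: image_Int)
    then have "g ` S \<inter> g ` U \<subseteq> (g \<circ> \<phi>) ` V" using U(4) by auto
    then show ?thesis
      using open_rigid_image[OF g U(1)] U(2) p(2) surface_param_rigid[OF k g U(3)] by blast
  qed
  have "g ` S \<subseteq> g ` closure (surface_interior k S)" using S by (auto simp: Ck_surface_def)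
  also have "\<dots> \<subseteq> closure (g ` surface_interior k S)"
    by (intro image_closure_subset continuous_on_rigid_motion[OF g] closed_closure closure_subset)
  also have "\<dots> \<subseteq> closure (surface_interior k (g ` S))"
    by (intro closure_mono surface_interior_rigid_image[OF k g])
  finally have 3: "g ` S \<subseteq> closure (surface_interior k (g ` S))" .
  show ?thesis unfolding Ck_surface_def by (intro conjI ballI 1 2 3)
qed

lemma complete_surface_rigid_image:
  assumes k: "1 \<le> k" and g: "rigid_motion g" and S: "complete_surface k S"
  shows "complete_surface k (g ` S)"
proof -
  have "S \<subseteq> surface_interior k S" using S by (auto simp: complete_surface_def surface_boundary_def)
  then have "g ` S \<subseteq> surface_interior k (g ` S)"
    using surface_interior_rigid_image[OF k g, of S] by blast
  then show ?thesis
    using S Ck_surface_rigid_image[OF k g] by (auto simp: complete_surface_def surface_boundary_def)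
qed

lemma unit_normal_subset: "unit_normal k S N \<Longrightarrow> S' \<subseteq> S \<Longrightarrow> unit_normal k S' N"
  unfolding unit_normal_def by (meson continuous_on_subset order_trans subsetD)

lemma unit_normal_rigid_image:
  assumes k: "1 \<le> k" and g: "rigid_motion g" and N: "unit_normal k S N"
  shows "unit_normal k (g ` S) (\<lambda>x. linear_part g (N (motion_inv g x)))"
  unfolding unit_normal_def
proof (intro conjI ballI allI impI)
  have L: "bounded_linear (linear_part g)"
    using linear_linear_part[OF g] by (simp add: linear_conv_bounded_linear)
  show "continuous_on (g ` S) (\<lambda>x. linear_part g (N (motion_inv g x)))"
  proof (rule bounded_linear.continuous_on[OF L], rule continuous_on_compose2[of S N])
    show "continuous_on S N" using N by (simp add: unit_normal_def)
    show "continuous_on (g ` S) (motion_inv g)"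
      by (rule continuous_on_rigid_motion[OF rigid_motion_inv(1)[OF g]])
  qed (use rigid_motion_inv(2)[OF g] in auto)
  show "norm (linear_part g (N (motion_inv g p))) = 1" if "p \<in> g ` S" for p
    using that N rigid_motion_inv(2)[OF g] by (auto simp: norm_linear_part[OF g] unit_normal_def)
  fix \<phi> V x w assume \<phi>: "surface_param k \<phi> V \<and> \<phi> ` V \<subseteq> g ` S" and x: "x \<in> V"
  let ?f = "motion_inv g"
  have f: "rigid_motion ?f" by (rule rigid_motion_inv(1)[OF g])
  have "surface_param k (?f \<circ> \<phi>) V" using surface_param_rigid[OF k f] \<phi> by blast
  moreover have "(?f \<circ> \<phi>) ` V \<subseteq> S" using \<phi> rigid_motion_inv(2)[OF g] by force
  ultimately have "N ((?f \<circ> \<phi>) x) \<bullet> frechet_derivative (?f \<circ> \<phi>) (at x) w = 0"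
    using N x unfolding unit_normal_def by blast
  then have "N (?f (\<phi> x)) \<bullet> linear_part ?f (frechet_derivative \<phi> (at x) w) = 0"
    using frechet_derivative_rigid_compose[OF f surface_param_differentiable[OF k _ x], of \<phi>] \<phi> by simp
  then have "linear_part g (N (?f (\<phi> x))) \<bullet> linear_part g (linear_part ?f (frechet_derivative \<phi> (at x) w)) = 0"
    by (simp only: inner_linear_part[OF g])
  then show "linear_part g (N (?f (\<phi> x))) \<bullet> frechet_derivative \<phi> (at x) w = 0"
    by (simp only: rigid_motion_inv(5)[OF g])
qed

lemma surface_interior_relatively_open:
  assumes p: "p \<in> surface_interior k S" and W: "openin (top_of_set S) W" "p \<in> W" "W \<subseteq> S'" "S' \<subseteq> S"
  shows "p \<in> surface_interior k S'"
proof -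
  obtain \<phi> \<psi> V where c: "surface_param k \<phi> V" "p \<in> \<phi> ` V" "openin (top_of_set S) (\<phi> ` V)"
    "homeomorphism V (\<phi> ` V) \<phi> \<psi>" "open V"
    using p by (rule surface_interior_chart)
  define Q where "Q = V \<inter> \<phi> -` W"
  have \<phi>Q: "\<phi> ` Q = W \<inter> \<phi> ` V" by (auto simp: Q_def)
  have "openin (top_of_set (\<phi> ` V)) (W \<inter> \<phi> ` V)"
    using openin_Int[OF W(1) c(3)] openin_imp_subset[OF c(3)]
    by (meson openin_subset_trans Int_lower2)
  then have "openin (top_of_set V) (V \<inter> \<phi> -` (W \<inter> \<phi> ` V))"
    using c(4) by (metis continuous_on_open homeomorphism_cont1)
  moreover have "V \<inter> \<phi> -` (W \<inter> \<phi> ` V) = Q" by (auto simp: Q_def)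
  ultimately have Q: "open Q" using c(5) openin_open_eq by blast
  have "surface_param k \<phi> Q" using c(1) Q by (rule surface_param_subset) (simp add: Q_def)
  moreover have "openin (top_of_set S') (\<phi> ` Q)"
    unfolding \<phi>Q using openin_Int[OF W(1) c(3)] W(3,4) by (meson openin_subset_trans Int_lower1 order_trans)
  moreover have "p \<in> \<phi> ` Q" using \<phi>Q W(2) c(2) by blast
  ultimately show ?thesis unfolding surface_interior_def using W(2,3) by blast
qed

section \<open>Local finiteness of tilings and coronas\<close>

text \<open>By invariance of domain \<open>F\<close> covers a small disc around \<open>F 0\<close>. There \<open>w \<mapsto> w - G (F\<^sup>-\<^sup>1 w) + F 0\<close> is a
  self-map, and its fixed point given by Brouwer's theorem is mapped to \<open>F 0\<close> by \<open>G \<circ> F\<^sup>-\<^sup>1\<close>.\<close>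

lemma perturbed_embedding_hits_centre:
  fixes F :: "complex \<Rightarrow> real^3"
  assumes \<nu>: "\<nu> \<noteq> 0" and \<epsilon>: "0 < \<epsilon>" and F: "continuous_on (cball 0 \<epsilon>) F" "inj_on F (cball 0 \<epsilon>)"
    and H: "F ` cball 0 \<epsilon> \<subseteq> {x. \<nu> \<bullet> x = 0}"
  obtains \<eta> where "0 < \<eta>" "\<And>G. continuous_on (cball 0 \<epsilon>) G \<Longrightarrow> G ` cball 0 \<epsilon> \<subseteq> {x. \<nu> \<bullet> x = 0} \<Longrightarrow>
    (\<And>z. z \<in> cball 0 \<epsilon> \<Longrightarrow> norm (G z - F z) \<le> \<eta>) \<Longrightarrow> F 0 \<in> G ` cball 0 \<epsilon>"
proof -
  let ?H = "{x. \<nu> \<bullet> x = 0}"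
  have sub: "ball 0 \<epsilon> \<subseteq> cball (0::complex) \<epsilon>" by auto
  have FH: "F z \<in> ?H" if "z \<in> cball 0 \<epsilon>" for z using H that by blast
  have "openin (top_of_set ?H) (F ` ball 0 \<epsilon>)"
  proof (rule invariance_of_domain_subspaces[of UNIV])
    show "subspace ?H" by (rule subspace_hyperplane)
    show "dim ?H \<le> dim (UNIV :: complex set)" using \<nu> by (simp add: dim_hyperplane)
    show "continuous_on (ball 0 \<epsilon>) F" using F(1) sub by (rule continuous_on_subset)
    show "F \<in> ball 0 \<epsilon> \<rightarrow> ?H" using FH sub by blast
    show "inj_on F (ball 0 \<epsilon>)" using F(2) sub by (rule inj_on_subset)
  qed simp_all
  moreover have "F 0 \<in> F ` ball 0 \<epsilon>" using \<epsilon> by simp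
  ultimately obtain e where e: "0 < e" "ball (F 0) e \<inter> ?H \<subseteq> F ` ball 0 \<epsilon>"
    unfolding openin_contains_ball by blast
  obtain F' where F': "homeomorphism (cball 0 \<epsilon>) (F ` cball 0 \<epsilon>) F F'"
    using homeomorphism_compact[OF compact_cball F(1) refl F(2)] by blast
  define \<eta> where "\<eta> = e / 2"
  have \<eta>: "0 < \<eta>" "cball (F 0) \<eta> \<subseteq> ball (F 0) e" using e(1) by (auto simp: \<eta>_def)
  let ?B = "cball (F 0) \<eta> \<inter> ?H"
  have B: "?B \<subseteq> F ` cball 0 \<epsilon>" using e(2) \<eta>(2) sub by blast
  show thesis
  proof (rule that[OF \<eta>(1)])
    fix G assume G: "continuous_on (cball 0 \<epsilon>) G" "G ` cball 0 \<epsilon> \<subseteq> ?H"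
      and close: "\<And>z. z \<in> cball 0 \<epsilon> \<Longrightarrow> norm (G z - F z) \<le> \<eta>"
    define \<Phi> where "\<Phi> w = w - G (F' w) + F 0" for w
    have F'B: "F' w \<in> cball 0 \<epsilon>" "F (F' w) = w" if "w \<in> ?B" for w
    proof -
      have "w \<in> F ` cball 0 \<epsilon>" using B that by blast
      then show "F (F' w) = w" by (rule homeomorphism_apply2[OF F'])
      show "F' w \<in> cball 0 \<epsilon>" using \<open>w \<in> F ` cball 0 \<epsilon>\<close> homeomorphism_image2[OF F'] by blast
    qed
    have cpt: "compact ?B" by (intro compact_Int_closed compact_cball closed_hyperplane)
    have conv: "convex ?B" by (intro convex_Int convex_cball convex_hyperplane)
    have "F 0 \<in> ?B" using FH[of 0] \<epsilon> \<eta>(1) by simp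
    then have ne: "?B \<noteq> {}" by blast
    have "continuous_on ?B F'" using homeomorphism_cont2[OF F'] B by (rule continuous_on_subset)
    then have "continuous_on ?B (\<lambda>w. G (F' w))"
      by (rule continuous_on_compose2[OF G(1)]) (use F'B(1) in blast)
    then have cont: "continuous_on ?B \<Phi>" unfolding \<Phi>_def by (intro continuous_intros)
    have maps: "\<Phi> \<in> ?B \<rightarrow> ?B"
    proof
      fix w assume w: "w \<in> ?B"
      have "G (F' w) \<in> ?H" using F'B(1)[OF w] G(2) by blast
      then have "\<Phi> w \<in> ?H" using w FH[of 0] \<epsilon> by (simp add: \<Phi>_def inner_add_right inner_diff_right)
      moreover have "norm (F 0 - \<Phi> w) \<le> \<eta>"
        using close[OF F'B(1)[OF w]] F'B(2)[OF w] by (simp add: \<Phi>_def)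
      ultimately show "\<Phi> w \<in> ?B" by (simp add: dist_norm)
    qed
    obtain w where w: "w \<in> ?B" "\<Phi> w = w" using brouwer[OF cpt conv ne cont maps] .
    then have "G (F' w) = F 0" by (simp add: \<Phi>_def)
    then show "F 0 \<in> G ` cball 0 \<epsilon>" using F'B(1)[OF w(1)] by (metis imageI)
  qed
qed

text \<open>The normals \<open>N\<close> of the surface and \<open>n\<close> of the prototile are kept apart, since the prototile need not be
  one of the tiles, and since different surfaces are tiled by the same prototile.\<close>

locale tiled_surface =
  fixes k :: enat and S :: "(real^3) set" and N :: "real^3 \<Rightarrow> real^3" and \<T> :: "(real^3) set set"
    and T :: "(real^3) set" and n :: "real^3 \<Rightarrow> real^3"
  assumes k: "1 \<le> k" and tiling: "oriented_monotiling k S N \<T> T n"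
begin

lemma surface: "Ck_surface k S" and normal: "unit_normal k S N" and union: "S = \<Union>\<T>"
  and prototile: "T homeomorphic cball (0::complex) 1" and countable_tiles: "countable \<T>"
  using tiling by (auto simp: oriented_monotiling_def)

lemma closed_surface: "closed S" and connected_surface: "connected S"
  using surface by (auto simp: Ck_surface_def)

lemma locally: "locally_in_surface k S"
  by (rule Ck_surface_locally[OF surface])

lemma tiling_conditions:
  shows "\<forall>A\<in>\<T>. \<forall>B\<in>\<T>. A \<noteq> B \<longrightarrow> A \<inter> B \<subseteq> disc_boundary A \<inter> disc_boundary B"
  "\<forall>A\<in>\<T>. finite {B \<in> \<T>. B \<noteq> A \<and> A \<inter> B \<noteq> {}}"
  "\<forall>A\<in>\<T>. \<exists>g. rigid_motion g \<and> g ` T = A \<and> (\<forall>x\<in>T. linear_part g (n x) = N (g x))"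
  using tiling unfolding oriented_monotiling_def
  by - (elim conjE, assumption)+

lemma overlap: "A \<in> \<T> \<Longrightarrow> B \<in> \<T> \<Longrightarrow> A \<noteq> B \<Longrightarrow> A \<inter> B \<subseteq> disc_boundary A \<inter> disc_boundary B"
  by (rule tiling_conditions(1)[rule_format])

lemma tile_motion:
  assumes "A \<in> \<T>"
  obtains g where "rigid_motion g" "g ` T = A" "\<And>x. x \<in> T \<Longrightarrow> linear_part g (n x) = N (g x)"
  using tiling_conditions(3)[rule_format, OF assms] by blast

lemma tile_disc:
  assumes "A \<in> \<T>"
  obtains h h' where "disc A h h'"
  using tile_motion[OF assms] disc_exists[OF prototile] disc_rigid_image by metis

lemma tile_subset: "A \<in> \<T> \<Longrightarrow> A \<subseteq> S"
  using union by blast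

lemma finite_neighbours: "A \<in> \<T> \<Longrightarrow> finite {B \<in> \<T>. B \<noteq> A \<and> A \<inter> B \<noteq> {}}"
  by (rule tiling_conditions(2)[rule_format])

lemma tile_facts:
  assumes "A \<in> \<T>"
  shows "compact A" "closed A" "connected A" "disc_boundary A \<subseteq> A" "A \<subseteq> closure (A - disc_boundary A)"
    "A - disc_boundary A \<noteq> {}" "openin (top_of_set S) (A - disc_boundary A)"
    "A - disc_boundary A \<subseteq> surface_interior k S" "A \<noteq> {}" "closed (disc_boundary A)"
proof -
  obtain h h' where "disc A h h'" using assms by (rule tile_disc)
  then interpret A: disc A h h' .
  show "compact A" "closed A" "connected A" "disc_boundary A \<subseteq> A" "A \<subseteq> closure (A - disc_boundary A)"
    "A - disc_boundary A \<noteq> {}" "closed (disc_boundary A)"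
    by (fact A.compact A.closed A.connected A.boundary_subset A.closure_interior A.interior_nonempty
        compact_imp_closed[OF A.compact_boundary])+
  then show "A \<noteq> {}" by blast
  show "openin (top_of_set S) (A - disc_boundary A)" "A - disc_boundary A \<subseteq> surface_interior k S"
    using A.interior_openin[OF locally tile_subset[OF assms]] by auto
qed

lemma interior_unique: "A \<in> \<T> \<Longrightarrow> B \<in> \<T> \<Longrightarrow> x \<in> A - disc_boundary A \<Longrightarrow> x \<in> B \<Longrightarrow> A = B"
  using overlap by blast

lemma interior_meets_neighbourhood:
  assumes "A \<in> \<T>" "p \<in> A" "openin (top_of_set S) W" "p \<in> W"
  shows "W \<inter> (A - disc_boundary A) \<noteq> {}"
proof -
  obtain U where U: "open U" "W = S \<inter> U" using assms(3) by (auto simp: openin_open)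
  have "p \<in> closure (A - disc_boundary A)" using tile_facts(5)[OF assms(1)] assms(2) by blast
  then have "U \<inter> (A - disc_boundary A) \<noteq> {}"
    using U assms(4) by (metis IntD2 IntI closure_iff_nhds_not_empty inf.orderI inf.idem inf_commute order_refl empty_iff)
  then show ?thesis using U tile_subset[OF assms(1)] by blast
qed

end

locale complete_tiled_surface = tiled_surface +
  assumes complete: "complete_surface k S"
begin

lemma interior_eq: "surface_interior k S = S"
  using complete surface_interior_subset unfolding complete_surface_def surface_boundary_def by blast

text \<open>If infinitely many tiles met a bounded set, the motions placing them would converge along a
  subsequence by the theorem of Arzela and Ascoli. Projected to the tangent plane at the limit \<open>y\<close> of the
  images of an interior point of the prototile, the limit motion is an embedding, so \<open>y\<close> is
  interior to all tiles late in the subsequence, although distinct tiles have disjoint interiors.\<close>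

lemma locally_finite_tiling:
  assumes "bounded K"
  shows "finite {A \<in> \<T>. A \<inter> K \<noteq> {}}"
proof (rule ccontr)
  assume "\<not> finite {A \<in> \<T>. A \<inter> K \<noteq> {}}"
  then obtain A :: "nat \<Rightarrow> (real^3) set" where A: "inj A" "range A \<subseteq> {A \<in> \<T>. A \<inter> K \<noteq> {}}"
    using infinite_countable_subset by blast
  have AT: "A i \<in> \<T>" "A i \<inter> K \<noteq> {}" for i using A(2) by blast+
  have "\<exists>g. rigid_motion g \<and> g ` T = A i" for i using tile_motion[OF AT(1)[of i]] by metis
  then obtain g where g: "\<And>i. rigid_motion (g i)" "\<And>i. g i ` T = A i" by metis
  obtain h h' where "disc T h h'" using disc_exists[OF prototile] .
  then interpret T: disc T h h' .
  obtain b1 where b1: "\<And>x. x \<in> K \<Longrightarrow> norm x \<le> b1" using assms by (auto simp: bounded_iff)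
  define b2 where "b2 = diameter T"
  have b2: "dist x y \<le> b2" if "x \<in> T" "y \<in> T" for x y
    unfolding b2_def by (rule diameter_bounded_bound[OF compact_imp_bounded[OF T.compact] that])
  have bound: "norm (g i x) \<le> b1 + b2" if "x \<in> T" for i x
  proof -
    have "g i ` T \<inter> K \<noteq> {}" unfolding g(2) by (rule AT(2))
    then obtain t where t: "t \<in> T" "g i t \<in> K" by blast
    have "norm (g i x) \<le> norm (g i t) + dist (g i x) (g i t)"
      by (metis dist_norm norm_triangle_sub)
    then show ?thesis using b1[OF t(2)] b2[OF that t(1)] by (simp add: dist_rigid_motion[OF g(1)])
  qed
  obtain G and r :: "nat \<Rightarrow> nat" where G: "continuous_on T G" "strict_mono r"
    "\<And>e. 0 < e \<Longrightarrow> \<exists>M. \<forall>m x. M \<le> m \<and> x \<in> T \<longrightarrow> norm (g (r m) x - G x) < e"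
  proof (rule Arzela_Ascoli[OF T.compact, of g "b1 + b2"])
    show "norm (g i x) \<le> b1 + b2" if "x \<in> T" for i x by (rule bound[OF that])
    show "\<exists>d>0. \<forall>i y. y \<in> T \<and> norm (x - y) < d \<longrightarrow> norm (g i x - g i y) < e" if "0 < e" for x e
      using that by (intro exI[of _ e]) (simp add: dist_rigid_motion[OF g(1)] flip: dist_norm)
  qed blast
  have lim: "(\<lambda>m. g (r m) x) \<longlonglongrightarrow> G x" if "x \<in> T" for x
    unfolding LIMSEQ_def dist_norm using G(3) that by (metis)
  have GS: "G x \<in> S" if "x \<in> T" for x
  proof (rule closed_sequentially[OF closed_surface _ lim[OF that]])
    show "g (r m) x \<in> S" for m using g(2)[of "r m"] AT(1)[of "r m"] that tile_subset by blast
  qed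
  have Gdist: "dist (G x) (G y) = dist x y" if "x \<in> T" "y \<in> T" for x y
  proof (rule LIMSEQ_unique)
    show "(\<lambda>m. dist (g (r m) x) (g (r m) y)) \<longlonglongrightarrow> dist (G x) (G y)"
      by (intro tendsto_dist lim that)
    show "(\<lambda>m. dist (g (r m) x) (g (r m) y)) \<longlonglongrightarrow> dist x y"
      by (simp add: dist_rigid_motion[OF g(1)])
  qed
  have h0: "h 0 \<in> T" using T.im by auto
  define y where "y = G (h 0)"
  have y: "y \<in> S" using GS[OF h0] by (simp add: y_def)
  obtain \<rho> where \<rho>: "0 < \<rho>" "\<And>u v. u \<in> S \<inter> ball y \<rho> \<Longrightarrow> v \<in> S \<inter> ball y \<rho> \<Longrightarrow> \<bar>(u - v) \<bullet> N y\<bar> \<le> 1/2 * norm (u - v)"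
    using surface_secant_angle[OF k normal, of y "1/2"] y interior_eq by auto
  have Ny: "norm (N y) = 1" using normal y by (simp add: unit_normal_def)
  define P where "P u = u - (u \<bullet> N y) *\<^sub>R N y" for u
  have nn: "N y \<bullet> N y = 1" using Ny by (simp add: dot_square_norm)
  have Pinj: "u = v" if "P u = P v" "u \<in> S \<inter> ball y \<rho>" "v \<in> S \<inter> ball y \<rho>" for u v
  proof (rule parallel_secant_eq[OF _ _ Ny])
    show "\<bar>(u - v) \<bullet> N y\<bar> \<le> norm (u - v) / 2" using \<rho>(2)[OF that(2,3)] by simp
    show "u - v = ((u - v) \<bullet> N y) *\<^sub>R N y"
      using that(1) by (simp add: P_def inner_diff_left scaleR_diff_left algebra_simps)
  qed
  have Plip: "norm (P u - P v) \<le> 2 * norm (u - v)" for u v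
  proof -
    have "P u - P v = (u - v) - ((u - v) \<bullet> N y) *\<^sub>R N y"
      by (simp add: P_def inner_diff_left scaleR_diff_left)
    then have "norm (P u - P v) \<le> norm (u - v) + norm (((u - v) \<bullet> N y) *\<^sub>R N y)"
      by (metis norm_triangle_ineq4)
    also have "\<dots> \<le> 2 * norm (u - v)" using Cauchy_Schwarz_ineq2[of "u - v" "N y"] Ny by simp
    finally show ?thesis .
  qed
  have Pc: "continuous_on X P" for X unfolding P_def by (intro continuous_intros)
  have "continuous_on (cball 0 1) (\<lambda>z. dist (h z) (h 0))"
    by (intro continuous_intros T.cont)
  then obtain d where d: "0 < d" "\<And>z. z \<in> cball 0 1 \<Longrightarrow> dist z 0 < d \<Longrightarrow> dist (h z) (h 0) < \<rho> / 2"
    using T.cont \<rho>(1) unfolding continuous_on_iff by (metis centre_in_cball half_gt_zero zero_le_one)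
  define \<epsilon> where "\<epsilon> = min (1/2) (d / 2)"
  have \<epsilon>: "0 < \<epsilon>" "\<epsilon> < 1" "\<epsilon> < d" using d(1) by (auto simp: \<epsilon>_def)
  have hz: "h z \<in> T" "z \<in> cball 0 1" "z \<in> ball 0 1" "dist (h z) (h 0) < \<rho> / 2" if "z \<in> cball 0 \<epsilon>" for z
  proof -
    show z: "z \<in> cball 0 1" "z \<in> ball 0 1" using that \<epsilon> by auto
    show "h z \<in> T" using z T.im by blast
    show "dist (h z) (h 0) < \<rho> / 2" using d(2)[OF z(1)] that \<epsilon> by simp
  qed
  have ch: "continuous_on (cball 0 \<epsilon>) h" using T.cont by (rule continuous_on_subset) (use hz(2) in blast)
  have near: "G (h z) \<in> S \<inter> ball y \<rho>" if "z \<in> cball 0 \<epsilon>" for z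
    using GS[OF hz(1)[OF that]] hz(4)[OF that] Gdist[OF h0 hz(1)[OF that]] \<rho>(1) by (simp add: y_def dist_commute)
  obtain \<eta> where \<eta>: "0 < \<eta>" "\<And>F. continuous_on (cball 0 \<epsilon>) F \<Longrightarrow> F ` cball 0 \<epsilon> \<subseteq> {x. N y \<bullet> x = 0} \<Longrightarrow>
    (\<And>z. z \<in> cball 0 \<epsilon> \<Longrightarrow> norm (F z - (\<lambda>z. P (G (h z))) z) \<le> \<eta>) \<Longrightarrow> (\<lambda>z. P (G (h z))) 0 \<in> F ` cball 0 \<epsilon>"
  proof (rule perturbed_embedding_hits_centre[of "N y" \<epsilon> "\<lambda>z. P (G (h z))"])
    show "N y \<noteq> 0" using Ny by auto
    show "0 < \<epsilon>" by (rule \<epsilon>)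
    have "continuous_on (cball 0 \<epsilon>) (\<lambda>z. G (h z))"
      by (rule continuous_on_compose2[OF G(1) ch]) (use hz(1) in blast)
    then show "continuous_on (cball 0 \<epsilon>) (\<lambda>z. P (G (h z)))"
      by (rule continuous_on_compose2[OF Pc]) auto
    show "inj_on (\<lambda>z. P (G (h z))) (cball 0 \<epsilon>)"
    proof (rule inj_onI)
      fix z w assume zw: "z \<in> cball 0 \<epsilon>" "w \<in> cball 0 \<epsilon>" "P (G (h z)) = P (G (h w))"
      then have "G (h z) = G (h w)" using Pinj near by blast
      then have "h z = h w" using Gdist[OF hz(1)[OF zw(1)] hz(1)[OF zw(2)]] by simp
      then show "z = w" using T.inj hz(2) zw(1,2) by (meson inj_onD)
    qed
    show "(\<lambda>z. P (G (h z))) ` cball 0 \<epsilon> \<subseteq> {x. N y \<bullet> x = 0}"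
      using nn by (auto simp: P_def inner_diff_right inner_commute)
  qed blast
  obtain M where M: "\<And>m x. M \<le> m \<Longrightarrow> x \<in> T \<Longrightarrow> norm (g (r m) x - G x) < min (\<eta> / 2) (\<rho> / 2)"
    using G(3)[of "min (\<eta> / 2) (\<rho> / 2)"] \<eta>(1) \<rho>(1) by auto
  have "y \<in> A (r m) - disc_boundary (A (r m))" if m: "M \<le> m" for m
  proof -
    have "P y \<in> (\<lambda>z. P (g (r m) (h z))) ` cball 0 \<epsilon>"
      unfolding y_def
    proof (rule \<eta>(2))
      have "continuous_on (cball 0 \<epsilon>) (\<lambda>z. g (r m) (h z))"
        by (rule continuous_on_compose2[OF continuous_on_rigid_motion[OF g(1)] ch]) auto
      then show "continuous_on (cball 0 \<epsilon>) (\<lambda>z. P (g (r m) (h z)))"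
        by (rule continuous_on_compose2[OF Pc]) auto
      show "(\<lambda>z. P (g (r m) (h z))) ` cball 0 \<epsilon> \<subseteq> {x. N y \<bullet> x = 0}"
        using nn by (auto simp: P_def inner_diff_right inner_commute)
      show "norm (P (g (r m) (h z)) - P (G (h z))) \<le> \<eta>" if "z \<in> cball 0 \<epsilon>" for z
        using Plip[of "g (r m) (h z)" "G (h z)"] M[OF m hz(1)[OF that]] by simp
    qed
    then obtain z where z: "z \<in> cball 0 \<epsilon>" "P y = P (g (r m) (h z))" by blast
    have "dist (g (r m) (h z)) (G (h z)) < \<rho> / 2" using M[OF m hz(1)[OF z(1)]] by (simp add: dist_norm)
    moreover have "dist (G (h z)) y < \<rho> / 2" using Gdist[OF hz(1)[OF z(1)] h0] hz(4)[OF z(1)] by (simp add: y_def)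
    ultimately have "dist (g (r m) (h z)) y < \<rho>" using dist_triangle_half_r[of "G (h z)" "g (r m) (h z)" \<rho> y] by (simp add: dist_commute)
    moreover have "g (r m) (h z) \<in> S" using g(2)[of "r m"] AT(1)[of "r m"] hz(1)[OF z(1)] tile_subset by blast
    ultimately have "y = g (r m) (h z)" using Pinj[OF z(2)] y \<rho>(1) by (simp add: dist_commute)
    moreover have "h z \<in> T - disc_boundary T" using hz(3)[OF z(1)] T.interior_eq by blast
    moreover have "disc_boundary (A (r m)) = g (r m) ` disc_boundary T"
      using disc_boundary_rigid_image[OF prototile g(1)] g(2) by metis
    ultimately show ?thesis
      using g(2)[of "r m"] rigid_motion_image_iff[OF g(1)] by auto
  qed
  from this[of M] this[of "Suc M"] have "A (r M) = A (r (Suc M))"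
    using interior_unique AT(1) by (metis DiffD1 le_Suc_eq order_refl)
  then have "r M = r (Suc M)" using A(1) by (simp add: inj_eq)
  then show False using G(2) by (metis lessI less_irrefl strict_mono_less)
qed

lemma closed_union_tiles:
  assumes "\<F> \<subseteq> \<T>"
  shows "closed (\<Union>\<F>)"
proof -
  have "\<exists>U. open U \<and> x \<in> U \<and> U \<inter> \<Union>\<F> = {}" if x: "x \<notin> \<Union>\<F>" for x
  proof (intro exI conjI)
    let ?F = "{A \<in> \<F>. A \<inter> ball x 1 \<noteq> {}}"
    have "finite ?F"
      by (rule finite_subset[OF _ locally_finite_tiling[OF bounded_ball, of x 1]]) (use assms in blast)
    moreover have "closed A" if "A \<in> ?F" for A using that assms tile_facts(2) by blast
    ultimately have "closed (\<Union>?F)" by blast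
    then show "open (ball x 1 - \<Union>?F)" by (rule open_Diff[OF open_ball])
    show "x \<in> ball x 1 - \<Union>?F" using x by auto
    show "(ball x 1 - \<Union>?F) \<inter> \<Union>\<F> = {}" by auto
  qed
  then have "\<forall>x\<in>- \<Union>\<F>. \<exists>U. open U \<and> x \<in> U \<and> U \<subseteq> - \<Union>\<F>"
    unfolding disjoint_eq_subset_Compl by simp
  then have "open (- \<Union>\<F>)" by (rule open_subopen[THEN iffD2])
  then show ?thesis by (simp add: closed_def)
qed

text \<open>By local finiteness the tiles not meeting \<open>T\<close> form a closed set, so the union of the others
  contains a neighbourhood of \<open>T\<close>.\<close>

lemma corona_of_neighbours:
  assumes T: "T \<in> \<T>" and n: "\<And>x. x \<in> T \<Longrightarrow> N x = n x"
  shows "corona k T n {B \<in> \<T>. B \<inter> T \<noteq> {}}"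
proof -
  let ?C = "{B \<in> \<T>. B \<inter> T \<noteq> {}}"
  have TC: "T \<in> ?C" using T tile_facts(9)[OF T] by auto
  have CS: "\<Union>?C \<subseteq> S" using tile_subset by blast
  have fin: "finite ?C"
    by (rule finite_subset[of _ "insert T {B \<in> \<T>. B \<noteq> T \<and> T \<inter> B \<noteq> {}}"])
      (use finite_neighbours[OF T] in auto)
  have loc: "locally_in_surface k (\<Union>?C)" by (rule locally_in_surface_subset[OF locally CS])
  have "connected (\<Union>((\<lambda>B. T \<union> B) ` ?C))"
  proof (rule connected_Union)
    show "connected s" if s: "s \<in> (\<lambda>B. T \<union> B) ` ?C" for s
    proof -
      obtain B where B: "B \<in> ?C" "s = T \<union> B" using s by blast
      then show ?thesis using tile_facts(3) T by (auto intro!: connected_Un)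
    qed
    show "\<Inter> ((\<lambda>B. T \<union> B) ` ?C) \<noteq> {}" using tile_facts(9)[OF T] by blast
  qed
  moreover have "\<Union>((\<lambda>B. T \<union> B) ` ?C) = \<Union>?C" using TC by blast
  ultimately have conn: "connected (\<Union>?C)" by simp
  have clos: "closed (\<Union>?C)" by (rule closed_union_tiles) blast
  have dense: "\<Union>?C \<subseteq> closure (surface_interior k (\<Union>?C))"
  proof
    fix x assume "x \<in> \<Union>?C"
    then obtain B where B: "B \<in> ?C" "x \<in> B" by blast
    then have BT: "B \<in> \<T>" by blast
    obtain h h' where "disc B h h'" using tile_disc[OF BT] .
    then interpret B: disc B h h' .
    have "B - disc_boundary B \<subseteq> surface_interior k (\<Union>?C)"
      by (rule B.interior_openin(2)[OF loc]) (use B in blast)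
    then show "x \<in> closure (surface_interior k (\<Union>?C))"
      using B.closure_interior B(2) closure_mono by blast
  qed
  have surf: "Ck_surface k (\<Union>?C)"
    unfolding Ck_surface_def using conn clos dense loc TC tile_facts(9)[OF T]
    unfolding locally_in_surface_def by blast
  have int: "T \<subseteq> surface_interior k (\<Union>?C)"
  proof
    fix p assume p: "p \<in> T"
    have c: "closed (\<Union>(\<T> - ?C))" by (rule closed_union_tiles) blast
    have "openin (top_of_set S) (S - \<Union>(\<T> - ?C))"
      unfolding Diff_eq by (rule openin_open_Int) (use c in \<open>simp only: open_Compl Diff_eq\<close>)
    moreover have "p \<in> S - \<Union>(\<T> - ?C)" using p tile_subset[OF T] by blast
    moreover have "S - \<Union>(\<T> - ?C) \<subseteq> \<Union>?C" using union by blast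
    ultimately show "p \<in> surface_interior k (\<Union>?C)"
      using surface_interior_relatively_open[of p k S] CS interior_eq by blast
  qed
  have "oriented_monotiling k (\<Union>?C) N ?C T n"
    unfolding oriented_monotiling_def
  proof (intro conjI ballI impI)
    show "finite {B \<in> ?C. B \<noteq> A \<and> A \<inter> B \<noteq> {}}" for A by (rule finite_subset[OF _ fin]) blast
    show "countable ?C" using fin by (rule countable_finite)
    show "unit_normal k (\<Union>?C) N" using normal CS by (rule unit_normal_subset)
    show "A \<inter> B \<subseteq> disc_boundary A \<inter> disc_boundary B" if "A \<in> ?C" "B \<in> ?C" "A \<noteq> B" for A B
      using overlap that by blast
    show "\<exists>g. rigid_motion g \<and> g ` T = A \<and> (\<forall>x\<in>T. linear_part g (n x) = N (g x))" if "A \<in> ?C" for A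
      by (rule tiling_conditions(3)[rule_format]) (use that in blast)
  qed (use surf prototile in auto)
  then show ?thesis
    unfolding corona_def interior_tile_def surface_boundary_def using n int TC by blast
qed

end

text \<open>Moving a tiling back by the motion that places a tile turns that tile into the prototile. In this
  way statements about the prototile apply to every tile.\<close>

lemma complete_tiled_surface_rigid_image:
  assumes "complete_tiled_surface k S N \<T> T n" and g: "rigid_motion g"
  shows "complete_tiled_surface k (g ` S) (\<lambda>x. linear_part g (N (motion_inv g x))) ((`) g ` \<T>) T n"
proof -
  interpret complete_tiled_surface k S N \<T> T n by fact
  have bd: "disc_boundary (g ` A) = g ` disc_boundary A" if A: "A \<in> \<T>" for A
  proof -
    obtain h h' where "disc A h h'" using A by (rule tile_disc)
    then show ?thesis using disc_boundary_image homeomorphism_rigid_motion[OF g] unfolding disc_def by blast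
  qed
  have int: "g ` A \<inter> g ` B = g ` (A \<inter> B)" for A B
    using inj_rigid_motion[OF g] by (simp add: image_Int)
  have "oriented_monotiling k (g ` S) (\<lambda>x. linear_part g (N (motion_inv g x))) ((`) g ` \<T>) T n"
    unfolding oriented_monotiling_def
  proof (intro conjI ballI impI)
    show "Ck_surface k (g ` S)" by (rule Ck_surface_rigid_image[OF k g surface])
    show "unit_normal k (g ` S) (\<lambda>x. linear_part g (N (motion_inv g x)))"
      by (rule unit_normal_rigid_image[OF k g normal])
    show "T homeomorphic cball (0::complex) 1" by (rule prototile)
    show "countable ((`) g ` \<T>)" using countable_tiles by simp
    show "g ` S = \<Union> ((`) g ` \<T>)" using union by auto
    show "A' \<inter> B' \<subseteq> disc_boundary A' \<inter> disc_boundary B'"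
      if AB: "A' \<in> (`) g ` \<T>" "B' \<in> (`) g ` \<T>" "A' \<noteq> B'" for A' B'
    proof -
      obtain A B where A: "A \<in> \<T>" "A' = g ` A" and B: "B \<in> \<T>" "B' = g ` B" using AB(1,2) by blast
      have "A \<noteq> B" using AB(3) A(2) B(2) by blast
      then have "A \<inter> B \<subseteq> disc_boundary A \<inter> disc_boundary B" by (rule overlap[OF A(1) B(1)])
      then have "g ` (A \<inter> B) \<subseteq> g ` disc_boundary A \<inter> g ` disc_boundary B" by blast
      then show ?thesis unfolding A(2) B(2) int bd[OF A(1)] bd[OF B(1)] .
    qed
    show "finite {B' \<in> (`) g ` \<T>. B' \<noteq> A' \<and> A' \<inter> B' \<noteq> {}}" if A': "A' \<in> (`) g ` \<T>" for A'
    proof -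
      obtain A where A: "A \<in> \<T>" "A' = g ` A" using A' by blast
      show ?thesis
      proof (rule finite_subset[OF _ finite_imageI[OF finite_neighbours[OF A(1)], of "(`) g"]], rule subsetI)
        fix B' assume "B' \<in> {B' \<in> (`) g ` \<T>. B' \<noteq> A' \<and> A' \<inter> B' \<noteq> {}}"
        then obtain B where B: "B \<in> \<T>" "B' = g ` B" "g ` B \<noteq> g ` A" "g ` A \<inter> g ` B \<noteq> {}"
          unfolding A(2) by blast
        have "B \<noteq> A" using B(3) by blast
        moreover have "A \<inter> B \<noteq> {}" using B(4) unfolding int by blast
        ultimately show "B' \<in> (`) g ` {B \<in> \<T>. B \<noteq> A \<and> A \<inter> B \<noteq> {}}" using B(1,2) by blast
      qed
    qed
    show "\<exists>f. rigid_motion f \<and> f ` T = A' \<and> (\<forall>x\<in>T. linear_part f (n x) = linear_part g (N (motion_inv g (f x))))"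
      if A': "A' \<in> (`) g ` \<T>" for A'
    proof -
      obtain A where A: "A \<in> \<T>" "A' = g ` A" using A' by blast
      obtain f where f: "rigid_motion f" "f ` T = A" "\<And>x. x \<in> T \<Longrightarrow> linear_part f (n x) = N (f x)"
        using tile_motion[OF A(1)] by metis
      show ?thesis
        by (intro exI[of _ "g \<circ> f"] conjI ballI)
          (use rigid_motion_comp[OF g f(1)] f A rigid_motion_inv(2)[OF g] in auto)
    qed
  qed
  then show ?thesis
    using k complete_surface_rigid_image[OF k g complete] by unfold_locales
qed

section \<open>Congruences of edges\<close>

text \<open>In the parameter the motion is an increasing bijection of an interval, so the iterates of \<open>x\<close> converge. Thus
  the distance of successive iterates tends to \<open>0\<close>, but it is constant.\<close>

lemma arc_isometry_fixes_points:
  fixes g :: "real^3 \<Rightarrow> real^3"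
  assumes e: "arc e" and g: "rigid_motion g" "g ` path_image e = path_image e"
    and ends: "g (pathstart e) = pathstart e" "g (pathfinish e) = pathfinish e" and x: "x \<in> path_image e"
  shows "g x = x"
proof -
  obtain e' where h: "homeomorphism {0..1} (path_image e) e e'" using homeomorphism_arc[OF e] .
  have ei: "e t \<in> path_image e" "e' (e t) = t" if "t \<in> {0..1}" for t
    using that homeomorphism_apply1[OF h] by (auto simp: path_image_def)
  have e'i: "e' y \<in> {0..1}" "e (e' y) = y" if "y \<in> path_image e" for y
    using that homeomorphism_apply2[OF h] homeomorphism_image2[OF h] by auto
  have gi: "g y \<in> path_image e" if "y \<in> path_image e" for y using g(2) that by blast
  define f where "f t = e' (g (e t))" for t
  have f: "f t \<in> {0..1}" "e (f t) = g (e t)" if "t \<in> {0..1}" for t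
    using e'i gi ei that by (auto simp: f_def)
  have f01: "f 0 = 0" "f 1 = 1"
    using ends ei(2)[of 0] ei(2)[of 1] by (auto simp: f_def pathstart_def pathfinish_def)
  have fc: "continuous_on {0..1} f"
    unfolding f_def
  proof (rule continuous_on_compose2[OF homeomorphism_cont2[OF h]])
    show "continuous_on {0..1} (\<lambda>t. g (e t))"
      by (rule continuous_on_compose2[OF continuous_on_rigid_motion[OF g(1)] homeomorphism_cont1[OF h]]) auto
  qed (use ei gi in auto)
  have finj: "inj_on f {0..1}"
  proof (rule inj_onI)
    fix s t assume st: "s \<in> {0..1}" "t \<in> {0..1}" "f s = f t"
    then have "g (e s) = g (e t)" using f(2) by metis
    then have "e s = e t" using inj_rigid_motion[OF g(1)] by (simp add: inj_eq)
    then show "s = t" using ei(2) st by metis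
  qed
  have mono: "f s \<le> f t" if st: "0 \<le> s" "s \<le> t" "t \<le> 1" for s t
  proof -
    consider "s = t" | "s = 0" | "0 < s" "s < t" using st by linarith
    then show ?thesis
    proof cases
      case 2
      then show ?thesis using f01 f(1)[of t] st by simp
    next
      case 3
      have sub: "{0..t} \<subseteq> {0..1}" using st by simp
      have "(f 0 < f s \<and> f s < f t) \<or> (f t < f s \<and> f s < f 0)"
        by (rule continuous_inj_imp_mono[OF 3 continuous_on_subset[OF fc sub] inj_on_subset[OF finj sub]])
      then show ?thesis using f01 f(1)[of s] st by auto
    qed simp
  qed
  define s where "s n = (f ^^ n) (e' x)" for n
  have s: "s n \<in> {0..1}" "s (Suc n) = f (s n)" for n
    by (induction n) (use e'i(1)[OF x] f(1) in \<open>auto simp: s_def\<close>)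
  have "monoseq s"
  proof (cases "s 0 \<le> s (Suc 0)")
    case True
    have "s n \<le> s (Suc n)" for n
    proof (induction n)
      case (Suc n)
      have "f (s n) \<le> f (s (Suc n))" using Suc s(1)[of n] s(1)[of "Suc n"] by (intro mono) auto
      then show ?case by (simp only: s(2)[symmetric])
    qed (rule True)
    then show ?thesis by (simp add: monoseq_Suc)
  next
    case False
    have "s (Suc n) \<le> s n" for n
    proof (induction n)
      case (Suc n)
      have "f (s (Suc n)) \<le> f (s n)" using Suc s(1)[of n] s(1)[of "Suc n"] by (intro mono) auto
      then show ?case by (simp only: s(2)[symmetric])
    qed (use False in simp)
    then show ?thesis by (simp add: monoseq_Suc)
  qed
  moreover have "Bseq s" by (rule BseqI'[of s 1]) (use s(1) in auto)
  ultimately have "convergent s" by (rule Bseq_monoseq_convergent[rotated])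
  then obtain L where L: "s \<longlonglongrightarrow> L" by (auto simp: convergent_def)
  have L01: "L \<in> {0..1}" by (rule closed_sequentially[OF _ _ L]) (use s(1) in auto)
  have "(\<lambda>n. e (s n)) \<longlonglongrightarrow> e L"
    using continuous_on_tendsto_compose[OF homeomorphism_cont1[OF h] L L01] s(1) by simp
  then have "(\<lambda>n. dist (e (s (Suc n))) (e (s n))) \<longlonglongrightarrow> dist (e L) (e L)"
    by (intro tendsto_dist LIMSEQ_Suc[of "\<lambda>n. e (s n)"])
  moreover have "dist (e (s (Suc n))) (e (s n)) = dist (g x) x" for n
  proof (induction n)
    case 0
    have "e (s 0) = x" using e'i(2)[OF x] by (simp add: s_def)
    moreover have "e (s (Suc 0)) = g (e (s 0))" using f(2)[OF s(1)[of 0]] s(2)[of 0] by simp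
    ultimately show ?case by simp
  next
    case (Suc n)
    have "e (s (Suc m)) = g (e (s m))" for m using f(2)[OF s(1)[of m]] s(2)[of m] by simp
    then show ?case using Suc by (simp add: dist_rigid_motion[OF g(1)])
  qed
  ultimately have "(\<lambda>n. dist (g x) x) \<longlonglongrightarrow> 0" by simp
  then show ?thesis by (simp add: LIMSEQ_const_iff)
qed

lemma arc_image_endpoints:
  fixes e f :: "real \<Rightarrow> 'a::t2_space"
  assumes "arc e" "arc f" "path_image e = path_image f"
  shows "(pathstart e = pathstart f \<and> pathfinish e = pathfinish f) \<or>
         (pathstart e = pathfinish f \<and> pathfinish e = pathstart f)"
proof -
  obtain e' where e: "homeomorphism {0..1} (path_image e) e e'" using homeomorphism_arc[OF assms(1)] .
  obtain f' where f: "homeomorphism {0..1} (path_image e) f f'"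
    using homeomorphism_arc[OF assms(2)] assms(3) by metis
  have h: "homeomorphism {0..1} {0..1} (f' \<circ> e) (e' \<circ> f)"
    by (rule homeomorphism_compose[OF e homeomorphism_symD[OF f]])
  define u where "u = f' \<circ> e"
  have uc: "continuous_on {0..1} u" and ui: "inj_on u {0..1}" and uim: "u ` {0..1} = {0..1}"
    using homeomorphism_cont1[OF h] homeomorphism_image1[OF h]
      inj_on_inverseI[of "{0..1}" "e' \<circ> f" u] homeomorphism_apply1[OF h] by (auto simp: u_def)
  have u01: "u 0 \<in> {0..1}" "u 1 \<in> {0..1}" "u 0 \<noteq> u 1"
    using uim inj_on_eq_iff[OF ui, of 0 1] by auto
  have inner: "u t \<noteq> c" if t: "0 < t" "t < 1" and c: "c = 0 \<or> c = 1" for t c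
    using continuous_inj_imp_mono[OF t uc ui] u01 c by auto
  have "\<exists>t\<in>{0..1}. u t = c" if "c = 0 \<or> c = 1" for c using uim that by (metis atLeastAtMost_iff image_iff order_refl zero_le_one)
  then have "\<exists>t\<in>{0,1}. u t = c" if "c = 0 \<or> c = 1" for c
    using inner that by (metis atLeastAtMost_iff insertI1 insertI2 less_eq_real_def)
  from this[of 0] this[of 1] have "(u 0 = 0 \<and> u 1 = 1) \<or> (u 0 = 1 \<and> u 1 = 0)"
    by auto
  moreover have "f (u t) = e t" if "t \<in> {0..1}" for t
    using homeomorphism_apply2[OF f] that by (simp add: u_def path_image_def)
  then have "f (u 0) = e 0" "f (u 1) = e 1" by auto
  ultimately show ?thesis unfolding pathstart_def pathfinish_def by auto
qed

text \<open>The last condition holds for arcs in a differentiable surface with normal \<open>n\<close>, whose secants at a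
  point become tangential. It excludes that the arc lies on the line through its start in the
  direction of the normal.\<close>

definition tangential_start :: "(real^3 \<Rightarrow> real^3) \<Rightarrow> (real \<Rightarrow> real^3) \<Rightarrow> bool" where
  "tangential_start n e \<longleftrightarrow> arc e \<and> norm (n (pathstart e)) = 1 \<and>
     (\<exists>\<rho>>0. \<forall>z\<in>path_image e \<inter> ball (pathstart e) \<rho>.
        \<bar>(z - pathstart e) \<bullet> n (pathstart e)\<bar> \<le> norm (z - pathstart e) / 2)"

text \<open>A motion fixing the endpoints of an edge and its normals is trivial. It fixes the edge
  pointwise, so otherwise it is a rotation about an axis containing the edge; the axis also contains
  the normal at an endpoint, which cannot be, as the secants of the edge are nearly tangential.\<close>

lemma edge_motion_fixing_ends:
  assumes e: "tangential_start n e" and g: "rigid_motion g" "maps_edge n g e e"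
  shows "g = id"
proof (rule ccontr)
  assume ne: "g \<noteq> id"
  let ?p = "pathstart e"
  have arc: "arc e" and np: "norm (n ?p) = 1" using e by (auto simp: tangential_start_def)
  obtain \<rho> where \<rho>: "0 < \<rho>" "\<And>z. z \<in> path_image e \<Longrightarrow> dist ?p z < \<rho> \<Longrightarrow> \<bar>(z - ?p) \<bullet> n ?p\<bar> \<le> norm (z - ?p) / 2"
    using e unfolding tangential_start_def by (metis IntI mem_ball)
  have fixed: "g x = x" if "x \<in> path_image e" for x
    using arc_isometry_fixes_points[OF arc g(1) _ _ _ that] g(2) by (simp add: maps_edge_def)
  have pe: "?p \<in> path_image e" by (rule pathstart_in_path_image)
  have ln: "linear_part g (n ?p) = n ?p" using g(2) fixed[OF pe] pe by (metis maps_edge_def)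
  have cr: "cross3 (n ?p) (x - ?p) = 0" if "x \<in> path_image e" for x
  proof (rule ccontr)
    assume "cross3 (n ?p) (x - ?p) \<noteq> 0"
    moreover have "linear_part g (x - ?p) = x - ?p" using linear_part_diff[OF g(1)] fixed[OF that] fixed[OF pe] by metis
    ultimately have "g = id" using rigid_motion_fixing_plane[OF g(1) ln] fixed[OF pe] by blast
    with ne show False by simp
  qed
  have "continuous_on {0..1} e" using arc by (simp add: arc_def path_def)
  then obtain d where d: "0 < d" "\<And>t. t \<in> {0..1} \<Longrightarrow> dist t 0 < d \<Longrightarrow> dist (e t) (e 0) < \<rho>"
    using \<rho>(1) unfolding continuous_on_iff by (metis atLeastAtMost_iff order_refl zero_le_one)
  define t where "t = min 1 (d / 2)"
  have t: "t \<in> {0..1}" "t \<noteq> 0" "dist t 0 < d" using d(1) by (auto simp: t_def)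
  have x: "e t \<in> path_image e" using t(1) by (auto simp: path_image_def)
  have "e t \<noteq> e 0" using arc t(1,2) by (auto simp: arc_def inj_on_def)
  then have neq: "e t - ?p \<noteq> 0" by (simp add: pathstart_def)
  have "\<bar>(e t - ?p) \<bullet> n ?p\<bar> \<le> norm (e t - ?p) / 2"
    using \<rho>(2)[OF x] d(2)[OF t(1,3)] by (simp add: pathstart_def dist_commute)
  moreover have "\<bar>(e t - ?p) \<bullet> n ?p\<bar> = norm (e t - ?p)"
  proof -
    have "(norm (0 :: real^3))\<^sup>2 = 1\<^sup>2 * (norm (e t - ?p))\<^sup>2 - (n ?p \<bullet> (e t - ?p))\<^sup>2"
      using norm_cross[of "n ?p" "e t - ?p"] unfolding cr[OF x] np .
    then have "(n ?p \<bullet> (e t - ?p))\<^sup>2 = (norm (e t - ?p))\<^sup>2" by (simp only: norm_zero) simp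
    then have "sqrt ((n ?p \<bullet> (e t - ?p))\<^sup>2) = sqrt ((norm (e t - ?p))\<^sup>2)" by (rule arg_cong)
    then show ?thesis by (simp only: real_sqrt_abs abs_norm_cancel inner_commute)
  qed
  ultimately show False using neq by simp
qed

lemma maps_edge_comp:
  assumes "rigid_motion f" "rigid_motion g" "maps_edge n g e1 e2" "maps_edge n f e2 e3"
  shows "maps_edge n (f \<circ> g) e1 e3"
  unfolding maps_edge_def
proof (intro conjI ballI)
  show "(f \<circ> g) ` path_image e1 = path_image e3"
    using assms(3,4) unfolding maps_edge_def by (metis image_comp)
  show "(f \<circ> g) (pathstart e1) = pathstart e3" "(f \<circ> g) (pathfinish e1) = pathfinish e3"
    using assms(3,4) by (simp_all add: maps_edge_def)
  fix x assume x: "x \<in> path_image e1"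
  then have "g x \<in> path_image e2" using assms(3) by (auto simp: maps_edge_def)
  then show "linear_part (f \<circ> g) (n x) = n ((f \<circ> g) x)"
    using assms(3,4) x by (simp add: rigid_motion_comp(2)[OF assms(1,2)] maps_edge_def)
qed

lemma maps_edge_inv:
  assumes g: "rigid_motion g" and m: "maps_edge n g e1 e2"
  shows "maps_edge n (motion_inv g) e2 e1"
  unfolding maps_edge_def
proof (intro conjI ballI)
  note [simp] = rigid_motion_inv(2,3,4)[OF g]
  have im: "path_image e2 = g ` path_image e1" using m by (simp add: maps_edge_def)
  show "motion_inv g ` path_image e2 = path_image e1" unfolding im by (simp add: image_image)
  have "pathstart e2 = g (pathstart e1)" "pathfinish e2 = g (pathfinish e1)" using m by (auto simp: maps_edge_def)
  then show "motion_inv g (pathstart e2) = pathstart e1" "motion_inv g (pathfinish e2) = pathfinish e1"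
    by simp_all
  fix x assume "x \<in> path_image e2"
  then obtain y where y: "y \<in> path_image e1" "x = g y" using im by blast
  then have "n x = linear_part g (n y)" using m by (simp add: maps_edge_def)
  then show "linear_part (motion_inv g) (n x) = n (motion_inv g x)" using y by simp
qed

text \<open>The quotient of the two motions fixes the ends of the edge.\<close>

lemma edge_motions_eq:
  assumes e: "tangential_start n e" and f: "rigid_motion f" "maps_edge n f e e2"
    and g: "rigid_motion g" "maps_edge n g e e2"
  shows "f = g"
proof -
  have "motion_inv g \<circ> f = id"
    using edge_motion_fixing_ends[OF e rigid_motion_comp(1)[OF rigid_motion_inv(1)[OF g(1)] f(1)]
        maps_edge_comp[OF rigid_motion_inv(1)[OF g(1)] f(1) f(2) maps_edge_inv[OF g]]] .
  then have "motion_inv g (f x) = x" for x by (metis comp_apply id_apply)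
  then have "f x = g x" for x using rigid_motion_inv(3)[OF g(1)] by metis
  then show ?thesis by (rule ext)
qed

lemma rigid_motion_half_turn:
  assumes u: "norm u = 1"
  shows "rigid_motion (half_turn a u)"
proof -
  define f where "f v = 2 *\<^sub>R ((v \<bullet> u) *\<^sub>R u) - v" for v :: "real^3"
  have uu: "u \<bullet> u = 1" using u by (simp add: dot_square_norm)
  have lin: "linear f"
    by (rule linearI) (simp_all add: f_def inner_add_left algebra_simps)
  have "norm (f v) = norm v" for v
  proof -
    have "f v \<bullet> f v = v \<bullet> v"
      using uu by (simp add: f_def inner_diff_left inner_diff_right inner_commute algebra_simps)
    then show ?thesis by (simp add: norm_eq_sqrt_inner)
  qed
  then have "orthogonal_transformation f" using lin by (simp add: orthogonal_transformation)
  then have om: "orthogonal_matrix (matrix f)" by (simp add: orthogonal_transformation_matrix)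
  have u1: "u$1 * u$1 + u$2 * u$2 + u$3 * u$3 = 1"
    using uu by (simp add: inner_vec_def sum_3)
  have comp: "matrix f $ i $ j = 2 * u$j * u$i - (if i = j then 1 else 0)" for i j
  proof -
    have "axis j 1 \<bullet> u = u $ j" by (simp add: cart_eq_inner_axis inner_commute)
    moreover have "matrix f $ i $ j = f (axis j 1) $ i" by (simp add: matrix_def)
    ultimately show ?thesis by (simp add: f_def axis_def)
  qed
  have "det (matrix f) = 2 * (u$1 * u$1 + u$2 * u$2 + u$3 * u$3) - 1"
    unfolding det_3 comp by (simp add: algebra_simps)
  have matrix_works': "matrix f *v x = f x" for x
    by (rule fun_cong[OF matrix_vector_mul(2)[OF lin]])
  from \<open>det (matrix f) = 2 * (u$1 * u$1 + u$2 * u$2 + u$3 * u$3) - 1\<close> have "rotation_matrix (matrix f)" using om u1 by (simp add: rotation_matrix_def)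
  moreover have "half_turn a u = (\<lambda>x. matrix f *v x + (a - f a))"
    by (rule ext) (simp add: matrix_works' half_turn_def f_def inner_diff_left algebra_simps)
  ultimately show ?thesis unfolding rigid_motion_def by blast
qed

text \<open>The linear part of an involution is an involution, so \<open>v + L v\<close> is fixed by it for every \<open>v\<close>. It is nonzero
  for some \<open>v\<close>, since \<open>-1\<close> has determinant \<open>-1\<close>; this gives the axis. On the plane perpendicular to the axis
  the linear part is \<open>-1\<close>, as another fixed vector would make the motion trivial.\<close>

lemma involution_half_turn:
  assumes g: "rigid_motion g" and inv: "\<And>x. g (g x) = x" and ne: "g \<noteq> id" and m: "g m = m"
  obtains u where "norm u = 1" "g = half_turn m u"
proof -
  obtain A b where A: "orthogonal_matrix A" "det A = 1" "g = (\<lambda>x. A *v x + b)" "linear_part g = (*v) A"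
    using g by (rule rigid_motionE)
  let ?L = "linear_part g"
  have lin: "linear ?L" by (rule linear_linear_part[OF g])
  have LL: "?L (?L v) = v" for v
    using rigid_motion_comp(2)[OF g g] inv by (metis (no_types, lifting) comp_apply diff_zero linear_part_def linear_part_diff[OF g] )
  have Lm: "?L (x - m) = g x - m" for x using linear_part_diff[OF g, of x m] m by simp
  obtain v where v: "v + ?L v \<noteq> 0"
  proof (rule ccontr)
    assume "\<not> thesis"
    then have "v + ?L v = 0" for v using that by blast
    then have "A *v v = - v" for v using A(4) by (metis add_eq_0_iff)
    then have "column j A = - axis j 1" for j by (metis matrix_vector_mult_basis)
    then have "A $ i $ j = (- axis j 1) $ i" for i j by (metis column_def vec_lambda_beta)
    then have entries: "A $ i $ j = (if i = j then - 1 else 0)" for i j by (simp add: axis_def)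
    have "det A = -1" unfolding det_3 entries by simp
    then show False using A(2) by simp
  qed
  define w where "w = v + ?L v"
  have Lw: "?L w = w" using LL by (simp add: w_def linear_add[OF lin] add.commute)
  define u where "u = w /\<^sub>R norm w"
  have u: "norm u = 1" using v by (simp add: u_def w_def)
  have Lu: "?L u = u" using Lw by (simp add: u_def linear_cmul[OF lin])
  have uu: "u \<bullet> u = 1" using u by (simp add: dot_square_norm)
  have "g x = half_turn m u x" for x
  proof -
    define y where "y = x - m"
    define z where "z = y - (y \<bullet> u) *\<^sub>R u"
    have zu: "z \<bullet> u = 0" using uu by (simp add: z_def inner_diff_left)
    have "?L z \<bullet> u = 0" using inner_linear_part[OF g, of z u] Lu zu by simp
    then have zz: "(z + ?L z) \<bullet> u = 0" using zu by (simp add: inner_add_left)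
    have Lzz: "?L (z + ?L z) = z + ?L z" using LL by (simp add: linear_add[OF lin] add.commute)
    have "z + ?L z = 0"
    proof (rule ccontr)
      assume nz: "z + ?L z \<noteq> 0"
      have "(norm (cross3 u (z + ?L z)))\<^sup>2 = (norm (z + ?L z))\<^sup>2"
        using norm_cross[of u "z + ?L z"] u zz by (simp add: inner_commute)
      then have "cross3 u (z + ?L z) \<noteq> 0" using nz by auto
      then have "g = id" by (rule rigid_motion_fixing_plane[OF g Lu Lzz _ m])
      with ne show False by simp
    qed
    then have Lz: "?L z = - z" by (metis add.commute add_eq_0_iff)
    have "?L y = ?L (z + (y \<bullet> u) *\<^sub>R u)" by (simp add: z_def)
    also have "\<dots> = - z + (y \<bullet> u) *\<^sub>R u" by (simp add: linear_add[OF lin] linear_cmul[OF lin] Lz Lu)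
    also have "\<dots> = ((y \<bullet> u) *\<^sub>R u + (y \<bullet> u) *\<^sub>R u) - y" by (simp add: z_def)
    finally have Ly: "?L y = 2 *\<^sub>R ((y \<bullet> u) *\<^sub>R u) - y" unfolding scaleR_2 .
    have "g x = m + ?L y" using Lm[of x] by (simp add: y_def)
    then have "g x = m + (2 *\<^sub>R ((y \<bullet> u) *\<^sub>R u) - y)" unfolding Ly .
    then show ?thesis unfolding y_def by (simp add: half_turn_def)
  qed
  then have "g = half_turn m u" by (rule ext)
  with u show thesis by (rule that)
qed

lemma maps_edge_reversed:
  "maps_edge n g (reversepath e1) (reversepath e2) \<longleftrightarrow> maps_edge n g e1 e2"
  by (auto simp: maps_edge_def)

text \<open>The motion reversing a self-congruent edge is an involution, because its square fixes the ends
  of the edge; it fixes the midpoint of the ends, so it is the half-turn in question.\<close>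

lemma edge_rotation:
  assumes e: "tangential_start n e" and sc: "self_congruent n e"
  shows "rigid_motion (edge_rotation n e)" "maps_edge n (edge_rotation n e) e (reversepath e)"
    "edge_rotation n e \<circ> edge_rotation n e = id"
proof -
  obtain g where g: "rigid_motion g" "maps_edge n g e (reversepath e)"
    using sc unfolding self_congruent_def edge_congruent_def by blast
  have "maps_edge n g (reversepath e) e"
    using g(2) maps_edge_reversed[of n g e "reversepath e"] by simp
  then have gg: "g \<circ> g = id"
    by (rule edge_motion_fixing_ends[OF e rigid_motion_comp(1)[OF g(1) g(1)] maps_edge_comp[OF g(1) g(1) g(2)]])
  have ends: "g (pathstart e) = pathfinish e" "g (pathfinish e) = pathstart e"
    using g(2) by (auto simp: maps_edge_def)
  have "pathfinish e \<noteq> pathstart e" using e arc_distinct_ends unfolding tangential_start_def by blast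
  then have ne: "g \<noteq> id" using ends(1) by auto
  have mid: "g (midpoint (pathstart e) (pathfinish e)) = midpoint (pathstart e) (pathfinish e)"
  proof -
    obtain A b where A: "g = (\<lambda>x. A *v x + b)" using g(1) unfolding rigid_motion_def by blast
    have "g (midpoint x y) = midpoint (g x) (g y)" for x y
    proof -
      have "g (midpoint x y) = (1/2) *\<^sub>R (A *v x + A *v y) + (1/2) *\<^sub>R (b + b)"
        by (simp add: A midpoint_def matrix_vector_right_distrib matrix_vector_mult_scaleR scaleR_half_double)
      also have "\<dots> = midpoint (g x) (g y)"
        unfolding scaleR_add_right[symmetric] by (simp add: A midpoint_def add.assoc add.left_commute)
      finally show ?thesis .
    qed
    then show ?thesis using ends by (simp add: midpoint_sym)
  qed
  obtain u where u: "norm u = 1" "g = half_turn (midpoint (pathstart e) (pathfinish e)) u"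
    using involution_half_turn[OF g(1) _ ne mid] gg by (metis comp_apply id_apply)
  have "edge_rotation n e = g"
    unfolding edge_rotation_def
  proof (rule the_equality)
    show "(\<exists>u. norm u = 1 \<and> g = half_turn (midpoint (pathstart e) (pathfinish e)) u) \<and> maps_edge n g e (reversepath e)"
      using u g(2) by blast
    show "R = g" if "(\<exists>u. norm u = 1 \<and> R = half_turn (midpoint (pathstart e) (pathfinish e)) u) \<and> maps_edge n R e (reversepath e)" for R
      using that edge_motions_eq[OF e _ _ g] rigid_motion_half_turn by blast
  qed
  then show "rigid_motion (edge_rotation n e)" "maps_edge n (edge_rotation n e) e (reversepath e)"
    "edge_rotation n e \<circ> edge_rotation n e = id" using g gg by auto
qed

lemma unoriented_edge_motion:
  assumes e: "arc e1" "arc e2" and g: "rigid_motion g" "g ` path_image e1 = path_image e2"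
    and n: "\<And>x. x \<in> path_image e1 \<Longrightarrow> linear_part g (n x) = n (g x)"
  shows "maps_edge n g e1 e2 \<or> maps_edge n g e1 (reversepath e2)"
proof -
  have a: "arc (g \<circ> e1)"
    using e(1) continuous_on_rigid_motion[OF g(1)] inj_rigid_motion[OF g(1)]
    by (auto simp: arc_def intro!: path_continuous_image comp_inj_on intro: inj_on_subset)
  have "path_image (g \<circ> e1) = path_image e2" using g(2) by (simp add: path_image_compose)
  from arc_image_endpoints[OF a e(2) this] show ?thesis
    using g(2) n by (auto simp: maps_edge_def pathstart_compose pathfinish_compose)
qed

lemma unoriented_edge_congruence:
  assumes e: "arc e1" "arc e2" and g: "rigid_motion g" "g ` path_image e1 = path_image e2"
    and n: "\<And>x. x \<in> path_image e1 \<Longrightarrow> linear_part g (n x) = n (g x)" and sc: "self_congruent n e2"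
  shows "edge_congruent n e1 e2"
proof -
  consider "maps_edge n g e1 e2" | "maps_edge n g e1 (reversepath e2)"
    using unoriented_edge_motion[OF e g, of n] n by blast
  then show ?thesis
  proof cases
    case 1
    then show ?thesis using g(1) by (auto simp: edge_congruent_def)
  next
    case 2
    obtain f where f: "rigid_motion f" "maps_edge n f e2 (reversepath e2)"
      using sc unfolding self_congruent_def edge_congruent_def by blast
    have "maps_edge n f (reversepath e2) e2"
      using f(2) maps_edge_reversed[of n f e2 "reversepath e2"] by simp
    then have "maps_edge n (f \<circ> g) e1 e2" by (rule maps_edge_comp[OF f(1) g(1) 2])
    then show ?thesis using rigid_motion_comp(1)[OF f(1) g(1)] by (auto simp: edge_congruent_def)
  qed
qed

section \<open>Edges in coronas\<close>

lemma cis_injective: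
  assumes "cis s = cis t" "\<bar>s - t\<bar> < 2 * pi"
  shows "s = t"
proof -
  have "sin s = sin t \<and> cos s = cos t" using assms(1) by (simp add: complex_eq_iff)
  then obtain j :: int where j: "s = t + 2 * pi * j" using sin_cos_eq_iff by blast
  then have "\<bar>real_of_int j\<bar> * (2 * pi) < 1 * (2 * pi)" using assms(2) by (simp add: abs_mult mult.commute)
  then have "\<bar>real_of_int j\<bar> < 1" using pi_gt_zero by (simp add: mult_less_cancel_right)
  then have "j = 0" by linarith
  then show ?thesis using j by simp
qed

lemma homeomorphism_components:
  assumes h: "homeomorphism K L f g" and C: "C \<in> components K"
  shows "f ` C \<in> components L"
proof -
  have CK: "C \<subseteq> K" "connected C" "C \<noteq> {}"
    using C in_components_subset in_components_connected in_components_nonempty by blast+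
  have max: "d = C" if "C \<subseteq> d" "d \<subseteq> K" "connected d" for d
    using C that CK(3) in_components_maximal[of C K] by blast
  have fc: "f ` C \<subseteq> L" "connected (f ` C)" "f ` C \<noteq> {}"
    using CK h connected_continuous_image[of C f] continuous_on_subset[OF homeomorphism_cont1[OF h] CK(1)]
      homeomorphism_image1[OF h] by auto
  have "d = f ` C" if d: "f ` C \<subseteq> d" "d \<subseteq> L" "connected d" for d
  proof -
    have fg: "f ` g ` d = d" using homeomorphism_apply2[OF h] d(2) by (auto simp: image_image subset_iff intro!: image_eqI)
    have "connected (g ` d)"
      using connected_continuous_image[OF continuous_on_subset[OF homeomorphism_cont2[OF h] d(2)] d(3)] .
    moreover have "g ` d \<subseteq> K" using d(2) homeomorphism_image2[OF h] by blast
    moreover have "C \<subseteq> g ` d"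
    proof
      fix x assume x: "x \<in> C"
      then have "g (f x) = x" using homeomorphism_apply1[OF h] CK(1) by blast
      moreover have "f x \<in> d" using x d(1) by blast
      ultimately show "x \<in> g ` d" by (metis imageI)
    qed
    ultimately have "g ` d = C" by (intro max)
    then show ?thesis using fg by simp
  qed
  then show ?thesis unfolding in_components_maximal using fc by blast
qed

lemma corona_tiled_surface:
  assumes "1 \<le> k" "corona k T n \<C>"
  obtains N where "tiled_surface k (\<Union>\<C>) N \<C> T n" "T \<in> \<C>" "\<And>x. x \<in> T \<Longrightarrow> N x = n x"
    "T \<subseteq> surface_interior k (\<Union>\<C>)" "finite \<C>"
proof -
  obtain N where N: "oriented_monotiling k (\<Union>\<C>) N \<C> T n" "\<And>x. x \<in> T \<Longrightarrow> N x = n x"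
    using assms(2) unfolding corona_def by blast
  have T: "T \<in> \<C>" "T \<inter> surface_boundary k (\<Union>\<C>) = {}" "\<And>A. A \<in> \<C> \<Longrightarrow> A \<inter> T \<noteq> {}"
    using assms(2) unfolding corona_def interior_tile_def by blast+
  interpret tiled_surface k "\<Union>\<C>" N \<C> T n by unfold_locales (use assms N in auto)
  have "\<C> \<subseteq> insert T {B \<in> \<C>. B \<noteq> T \<and> T \<inter> B \<noteq> {}}" using T(3) by blast
  then have "finite \<C>" using finite_neighbours[OF T(1)] by (meson finite.insertI finite_subset)
  moreover have "T \<subseteq> surface_interior k (\<Union>\<C>)"
    using T(1,2) unfolding surface_boundary_def by blast
  ultimately show thesis using that tiled_surface_axioms N(2) T(1) by blast
qed

context tiled_surface
begin

text \<open>If \<open>p\<close> were not on one of the tiles in \<open>\<B>\<close>, these finitely many closed tiles would avoid a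
  neighbourhood of \<open>p\<close>, which would then be contained in \<open>A\<close>.\<close>

lemma boundary_covered:
  assumes A: "A \<in> \<T>" "A \<subseteq> surface_interior k S" and fin: "finite \<T>"
    and p: "p \<in> disc_boundary A" and W: "openin (top_of_set S) W" "p \<in> W"
    and cov: "W \<subseteq> A \<union> \<Union>\<B>" and B: "\<B> \<subseteq> \<T>"
  shows "p \<in> \<Union>\<B>"
proof (rule ccontr)
  assume np: "p \<notin> \<Union>\<B>"
  obtain h h' where "disc A h h'" using A(1) by (rule tile_disc)
  then interpret A: disc A h h' .
  have "closed (\<Union>\<B>)" using fin B tile_facts(2) by (meson closed_Union finite_subset subsetD)
  then have "openin (top_of_set S) (W - \<Union>\<B>)"
    using W(1) by (metis Diff_Int_distrib2 Int_Diff closed_subset openin_Int_open open_Compl Diff_eq)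
  then show False
    using A.boundary_not_interior[of p k S "W - \<Union>\<B>"] p A(2) A.boundary_subset np W(2) cov by blast
qed

lemma boundary_covered_by_neighbours:
  assumes A: "A \<in> \<T>" "A \<subseteq> surface_interior k S" and fin: "finite \<T>" and p: "p \<in> disc_boundary A"
  obtains B where "B \<in> \<T>" "B \<noteq> A" "p \<in> B"
proof -
  have "p \<in> \<Union>(\<T> - {A})"
    by (rule boundary_covered[OF A fin p, of S]) (use p A tile_facts(4) union in auto)
  then show thesis using that by blast
qed

text \<open>\<open>A\<close> and \<open>B\<close> cover a neighbourhood of the common part of their boundaries, so the interior of a
  third tile has no room there.\<close>

lemma two_tiles_at_common_arc:
  assumes A: "A \<in> \<T>" "B \<in> \<T>" "A \<noteq> B" and C: "C \<in> \<T>" "p \<in> C"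
    and X: "openin (top_of_set (disc_boundary A)) X" "X \<subseteq> B" "p \<in> X"
  shows "C = A \<or> C = B"
proof -
  obtain h h' where h: "disc A h h'" using tile_disc A(1) by blast
  obtain g g' where g: "disc B g g'" using tile_disc A(2) by blast
  obtain W where W: "openin (top_of_set S) W" "X \<subseteq> W" "W \<subseteq> A \<union> B"
    using discs_glue_along_boundary[OF locally h tile_subset[OF A(1)] g tile_subset[OF A(2)] overlap[OF A] X(1,2)] .
  have "W \<inter> (C - disc_boundary C) \<noteq> {}"
    using interior_meets_neighbourhood[OF C W(1)] W(2) X(3) by blast
  then show ?thesis using W(3) interior_unique[OF C(1) A(1)] interior_unique[OF C(1) A(2)] by blast
qed

text \<open>Glued along their whole boundary, the two tiles form an open subset of the surface, which is also
  closed, hence the entire surface.\<close>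

lemma circle_neighbour_unique:
  assumes A: "A \<in> \<T>" "A \<subseteq> surface_interior k S" and B: "B \<in> \<T>" "B \<noteq> A" "A \<inter> B = disc_boundary A"
  shows "\<T> = {A, B}" and "disc_boundary B = disc_boundary A" and "S \<subseteq> surface_interior k S"
proof -
  obtain h h' where h: "disc A h h'" using A(1) by (rule tile_disc)
  then interpret A: disc A h h' .
  obtain g g' where g: "disc B g g'" using B(1) by (rule tile_disc)
  then interpret B: disc B g g' .
  have "disc_boundary A \<subseteq> disc_boundary B" using overlap[OF A(1) B(1)] B(2,3) by blast
  then show bd: "disc_boundary B = disc_boundary A"
    using disc_boundary_subset_imp_eq[OF h g] by simp
  obtain W where W: "openin (top_of_set S) W" "disc_boundary A \<subseteq> W" "W \<subseteq> A \<union> B"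
    using discs_glue_along_boundary[OF locally h tile_subset[OF A(1)] g tile_subset[OF B(1)]
        overlap[OF A(1) B(1)] _ , of "disc_boundary A"] B(2,3) by auto
  have eq: "A \<union> B = (A - disc_boundary A) \<union> (B - disc_boundary B) \<union> W"
    using W(2,3) bd by blast
  have op: "openin (top_of_set S) (A \<union> B)"
    unfolding eq using tile_facts(7) A(1) B(1) W(1) by (intro openin_Un) auto
  have cl: "closedin (top_of_set S) (A \<union> B)"
    using A.closed B.closed tile_subset[OF A(1)] tile_subset[OF B(1)] by (intro closed_subset) auto
  have SAB: "S = A \<union> B"
    using connected_surface op cl tile_facts(9)[OF A(1)] unfolding connected_clopen by blast
  show "\<T> = {A, B}"
  proof -
    have "C = A \<or> C = B" if "C \<in> \<T>" for C
    proof -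
      note C = that
      have "C - disc_boundary C \<noteq> {}" by (rule tile_facts(6)[OF C])
      then obtain x where x: "x \<in> C - disc_boundary C" by blast
      then have "x \<in> A \<or> x \<in> B" using SAB tile_subset[OF C] by blast
      then show ?thesis using interior_unique[OF C _ x] A(1) B(1) by blast
    qed
    then show ?thesis using A(1) B(1) by blast
  qed
  have "B \<subseteq> (B - disc_boundary B) \<union> A" using bd A.boundary_subset by blast
  then show "S \<subseteq> surface_interior k S" using SAB A(2) tile_facts(8)[OF B(1)] by blast
qed

end

lemma finite_closed_cover_has_interior:
  fixes X :: "'a::topological_space set"
  assumes "finite \<F>" "openin (top_of_set D) X" "X \<noteq> {}" "\<And>F. F \<in> \<F> \<Longrightarrow> closed F" "X \<subseteq> \<Union>\<F>"
  obtains F Y where "F \<in> \<F>" "openin (top_of_set D) Y" "Y \<noteq> {}" "Y \<subseteq> X" "Y \<subseteq> F"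
proof -
  have "\<exists>F\<in>\<F>. \<exists>Y. openin (top_of_set D) Y \<and> Y \<noteq> {} \<and> Y \<subseteq> X \<and> Y \<subseteq> F"
    using assms
  proof (induction \<F> arbitrary: X rule: finite_induct)
    case empty
    then show ?case by auto
  next
    case (insert F \<F>)
    show ?case
    proof (cases "X \<subseteq> F")
      case True
      then show ?thesis using insert.prems by blast
    next
      case False
      have "openin (top_of_set D) (X \<inter> - F)"
        using insert.prems(1,3) by (intro openin_Int_open) auto
      moreover have "X \<inter> - F \<noteq> {}" using False by blast
      moreover have "X \<inter> - F \<subseteq> \<Union>\<F>" using insert.prems(4) by blast
      moreover have "\<And>G. G \<in> \<F> \<Longrightarrow> closed G" using insert.prems(3) by blast
      ultimately obtain G Y where "G \<in> \<F>" "openin (top_of_set D) Y" "Y \<noteq> {}" "Y \<subseteq> X \<inter> - F" "Y \<subseteq> G"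
        using insert.IH[of "X \<inter> - F"] by metis
      then show ?thesis by blast
    qed
  qed
  then show thesis using that by blast
qed

context disc
begin

lemma arc_in_boundary:
  assumes "a < b" "b < a + 2 * pi"
  obtains e where "arc e" "path_image e = (\<lambda>t. h (cis t)) ` {a..b}" "pathstart e = h (cis a)" "pathfinish e = h (cis b)"
proof -
  define l where "l s = a + s * (b - a)" for s
  define e where "e s = h (cis (l s))" for s :: real
  have sph: "cis t \<in> cball 0 1" for t by simp
  have img: "l ` {0..1} = {a..b}"
  proof
    show "l ` {0..1} \<subseteq> {a..b}"
    proof
      fix x assume "x \<in> l ` {0..1}"
      then obtain s where s: "0 \<le> s" "s \<le> 1" "x = l s" by auto
      have "0 \<le> s * (b - a)" "s * (b - a) \<le> 1 * (b - a)" using s assms(1) by (auto intro: mult_right_mono)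
      then show "x \<in> {a..b}" using s by (simp add: l_def)
    qed
    show "{a..b} \<subseteq> l ` {0..1}"
    proof
      fix x assume x: "x \<in> {a..b}"
      have "x = l ((x - a) / (b - a))" using assms(1) by (simp add: l_def)
      moreover have "(x - a) / (b - a) \<in> {0..1}" using x assms(1) by (simp add: field_simps)
      ultimately show "x \<in> l ` {0..1}" by blast
    qed
  qed
  have "arc e"
    unfolding arc_def
  proof
    show "path e"
      unfolding path_def e_def
      by (rule continuous_on_compose2[OF cont]) (auto simp: l_def intro!: continuous_intros)
    show "inj_on e {0..1}"
    proof (rule inj_onI)
      fix s t assume st: "s \<in> {0..1}" "t \<in> {0..1}" "e s = e t"
      then have "cis (l s) = cis (l t)" using inj sph by (auto simp: e_def dest: inj_onD)
      moreover have "l s \<in> {a..b}" "l t \<in> {a..b}" using st img by blast+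
      then have "\<bar>l s - l t\<bar> < 2 * pi" using assms(2) by auto
      ultimately have "l s = l t" by (rule cis_injective)
      then show "s = t" using assms(1) by (simp add: l_def)
    qed
  qed
  moreover have "path_image e = (\<lambda>t. h (cis t)) ` l ` {0..1}"
    by (simp add: path_image_def e_def image_image)
  ultimately show thesis
    using that[of e] img by (simp add: pathstart_def pathfinish_def e_def l_def)
qed

lemma component_in_boundary:
  assumes K: "closed K" "K \<subseteq> disc_boundary T" "K \<noteq> disc_boundary T" and C: "C \<in> components K"
  obtains a b where "a \<le> b" "b < a + 2 * pi" "C = (\<lambda>t. h (cis t)) ` {a..b}"
proof -
  have KT: "K \<subseteq> T" using K(2) boundary_subset by blast
  have hom': "homeomorphism K (h' ` K) h' h"
    by (rule homeomorphism_of_subsets[OF homeomorphism_symD[OF hom] KT _ refl, of "h' ` K"]) (use im' KT in blast)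
  have hh: "h ` h' ` K = K" using right KT by (auto simp: image_image subset_iff intro!: image_eqI)
  have sub: "h' ` K \<subseteq> sphere 0 1"
  proof
    fix w assume "w \<in> h' ` K"
    then obtain x where x: "x \<in> K" "w = h' x" by blast
    then obtain z where "z \<in> sphere 0 1" "x = h z" using K(2) boundary by blast
    then show "w \<in> sphere 0 1" using x(2) left[of z] by simp
  qed
  have cK: "compact K" using compact KT K(1) by (metis compact_Int_closed inf.absorb2)
  have "closed (h' ` K)"
    by (intro compact_imp_closed compact_continuous_image[OF continuous_on_subset[OF cont' KT] cK])
  moreover have "h' ` K \<noteq> sphere 0 1" using hh boundary K(3) by metis
  moreover have "h' ` C \<in> components (h' ` K)"
    by (rule homeomorphism_components[OF hom' C])
  ultimately obtain a b where ab: "a \<le> b" "b < a + 2 * pi" "h' ` C = cis ` {a..b}"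
    using component_proper_subset_circle[OF _ sub] by metis
  have "C \<subseteq> T" using in_components_subset[OF C] KT by blast
  then have "h ` h' ` C = C" using right by (auto simp: image_image subset_iff intro!: image_eqI)
  then have "C = (\<lambda>t. h (cis t)) ` {a..b}" using ab(3) by (metis image_image)
  with ab(1,2) show thesis by (rule that)
qed

end

text \<open>The neighbours of the tile cover its boundary by finitely many closed sets, so one of them contains
  an open piece of the given edge. The component of the intersection around that piece is an arc,
  hence an edge, and it can only be the given one.\<close>

lemma corona_edge_neighbour:
  assumes k: "1 \<le> k" and C: "corona k T n \<C>"
    and X: "openin (top_of_set (disc_boundary T)) X" "X \<noteq> {}" "X \<subseteq> E"
    and disj: "\<And>F. F \<in> tile_edges k T n \<Longrightarrow> F \<noteq> E \<Longrightarrow> X \<inter> F = {}"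
    and nocircle: "\<And>B. B \<in> \<C> \<Longrightarrow> B \<noteq> T \<Longrightarrow> T \<inter> B \<noteq> disc_boundary T"
  obtains B where "B \<in> \<C>" "B \<noteq> T" "E \<in> components (T \<inter> B)"
proof -
  obtain N where N: "tiled_surface k (\<Union>\<C>) N \<C> T n" "T \<in> \<C>" "T \<subseteq> surface_interior k (\<Union>\<C>)" "finite \<C>"
    using corona_tiled_surface[OF k C] by metis
  interpret tiled_surface k "\<Union>\<C>" N \<C> T n by fact
  obtain h h' where "disc T h h'" using tile_disc[OF N(2)] .
  then interpret T: disc T h h' .
  have Xb: "X \<subseteq> disc_boundary T" using X(1) by (rule openin_imp_subset)
  have cov: "X \<subseteq> \<Union>((\<lambda>B. T \<inter> B) ` (\<C> - {T}))"
  proof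
    fix x assume x: "x \<in> X"
    then obtain B where "B \<in> \<C>" "B \<noteq> T" "x \<in> B"
      using boundary_covered_by_neighbours[OF N(2,3,4)] Xb by blast
    then show "x \<in> \<Union>((\<lambda>B. T \<inter> B) ` (\<C> - {T}))" using x Xb T.boundary_subset by blast
  qed
  have clos: "\<And>F. F \<in> (\<lambda>B. T \<inter> B) ` (\<C> - {T}) \<Longrightarrow> closed F"
    using tile_facts(2) T.closed by auto
  have fin: "finite ((\<lambda>B. T \<inter> B) ` (\<C> - {T}))" using N(4) by simp
  obtain F Y where F: "F \<in> (\<lambda>B. T \<inter> B) ` (\<C> - {T})"
    and Y: "openin (top_of_set (disc_boundary T)) Y" "Y \<noteq> {}" "Y \<subseteq> X" "Y \<subseteq> F"
    by (rule finite_closed_cover_has_interior[OF fin X(1,2) clos cov]) blast+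
  then obtain B where B: "B \<in> \<C>" "B \<noteq> T" "F = T \<inter> B" by blast
  obtain y where y: "y \<in> Y" using Y(2) by blast
  define C where "C = connected_component_set F y"
  have yF: "y \<in> F" using y Y(4) by blast
  have CF: "C \<in> components F" unfolding C_def using yF by (rule componentsI)
  have yC: "y \<in> C" unfolding C_def using yF by simp
  have Fb: "F \<subseteq> disc_boundary T" using overlap[OF N(2) B(1)] B by blast
  obtain a b where ab: "a \<le> b" "b < a + 2 * pi" "C = (\<lambda>t. h (cis t)) ` {a..b}"
    using T.component_in_boundary[OF clos[OF F] Fb _ CF] nocircle[OF B(1,2)] B(3) by metis
  have hc: "continuous_on UNIV (\<lambda>t. h (cis t))"
    by (rule continuous_on_compose2[OF T.cont]) (auto intro!: continuous_intros)
  have hci: "h (cis t) \<in> disc_boundary T" for t using T.boundary by simp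
  obtain t0 where t0: "y = h (cis t0)" using yC ab(3) by blast
  obtain U where U: "open U" "Y = disc_boundary T \<inter> U" using Y(1) by (auto simp: openin_open)
  have "open ((\<lambda>t. h (cis t)) -` U)" using hc U(1) by (rule open_vimage[rotated])
  moreover have "t0 \<in> (\<lambda>t. h (cis t)) -` U" using y U(2) t0 by simp
  ultimately obtain d where d: "0 < d" "cball t0 d \<subseteq> (\<lambda>t. h (cis t)) -` U"
    by (meson open_contains_cball)
  define s where "s = min d 1"
  have s: "0 < s" "s \<le> 1" "{t0..t0 + s} \<subseteq> cball t0 d" using d(1) by (auto simp: s_def dist_real_def)
  have seg: "(\<lambda>t. h (cis t)) ` {t0..t0 + s} \<subseteq> Y" using d(2) s(3) U(2) hci by blast
  have "(\<lambda>t. h (cis t)) ` {t0..t0 + s} \<subseteq> C"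
    unfolding C_def
  proof (rule connected_component_maximal)
    show "y \<in> (\<lambda>t. h (cis t)) ` {t0..t0 + s}" using t0 s(1) by auto
    show "connected ((\<lambda>t. h (cis t)) ` {t0..t0 + s})"
      by (intro connected_continuous_image continuous_on_subset[OF hc]) auto
    show "(\<lambda>t. h (cis t)) ` {t0..t0 + s} \<subseteq> F" using seg Y(4) by blast
  qed
  then have "h (cis t0) \<in> C" "h (cis (t0 + s)) \<in> C" using s(1) by auto
  moreover have "h (cis t0) \<noteq> h (cis (t0 + s))"
  proof
    assume "h (cis t0) = h (cis (t0 + s))"
    then have "cis (t0 + s) = cis t0" using T.inj by (auto dest: inj_onD)
    then have "t0 + s = t0" by (rule cis_injective) (use s pi_gt3 in auto)
    with s(1) show False by simp
  qed
  ultimately have "a \<noteq> b" using ab(3) by auto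
  then obtain e where "arc e" "path_image e = C"
    using T.arc_in_boundary[of a b] ab by (metis order_le_less)
  then have "C \<in> tile_edges k T n"
    unfolding tile_edges_def using C N(2) B CF in_components_subset[OF CF] Fb by blast
  then have "C = E" using disj yC y Y(3) by blast
  then show thesis using that[OF B(1,2)] CF B(3) by simp
qed

section \<open>Shadows of tiles along a normal direction\<close>

text \<open>The points near \<open>p\<close> whose line in direction \<open>\<nu>\<close> meets \<open>A\<close> near \<open>p\<close>. Keeping this set three-dimensional, instead
  of projecting to a plane, makes it behave well under motions. The bounds \<open>3 * r\<close> and \<open>4 * r\<close> make it
  compact, and they are those in \<open>normal_line_meets_surface\<close>.\<close>

definition shadow :: "real \<Rightarrow> (real^3) set \<Rightarrow> real^3 \<Rightarrow> real^3 \<Rightarrow> (real^3) set" where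
  "shadow r A p \<nu> = {w \<in> cball p r. \<exists>y\<in>A \<inter> cball p (3 * r). \<exists>s. \<bar>s\<bar> \<le> 4 * r \<and> w = y + s *\<^sub>R \<nu>}"

lemma compact_shadow:
  assumes "compact A"
  shows "compact (shadow r A p \<nu>)"
proof -
  have "compact ((A \<inter> cball p (3 * r)) \<times> {- (4 * r)..4 * r})"
    using assms by (intro compact_Times compact_Int_closed) auto
  then have "compact ((\<lambda>z. fst z + snd z *\<^sub>R \<nu>) ` ((A \<inter> cball p (3 * r)) \<times> {- (4 * r)..4 * r}))"
    by (rule compact_continuous_image[rotated]) (intro continuous_intros)
  moreover have "shadow r A p \<nu> = cball p r \<inter> (\<lambda>z. fst z + snd z *\<^sub>R \<nu>) ` ((A \<inter> cball p (3 * r)) \<times> {- (4 * r)..4 * r})"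
    (is "_ = _ \<inter> ?I")
  proof (intro subset_antisym subsetI)
    fix w assume "w \<in> shadow r A p \<nu>"
    then obtain y s where w: "w \<in> cball p r" "y \<in> A \<inter> cball p (3 * r)" "\<bar>s\<bar> \<le> 4 * r" "w = y + s *\<^sub>R \<nu>"
      unfolding shadow_def by blast
    then have "w \<in> ?I" by (intro image_eqI[of _ _ "(y, s)"]) auto
    with w(1) show "w \<in> cball p r \<inter> ?I" by blast
  next
    fix w assume w: "w \<in> cball p r \<inter> ?I"
    then obtain z where z: "z \<in> (A \<inter> cball p (3 * r)) \<times> {- (4 * r)..4 * r}" "w = fst z + snd z *\<^sub>R \<nu>" by blast
    then have "fst z \<in> A \<inter> cball p (3 * r)" "\<bar>snd z\<bar> \<le> 4 * r" by auto
    then show "w \<in> shadow r A p \<nu>" unfolding shadow_def using w z(2) by blast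
  qed
  ultimately show ?thesis by (simp add: closed_Int_compact)
qed

lemma shadow_rigid_image:
  assumes g: "rigid_motion g"
  shows "shadow r (g ` A) (g p) (linear_part g \<nu>) = g ` shadow r A p \<nu>"
proof -
  have add: "g (y + s *\<^sub>R v) = g y + s *\<^sub>R linear_part g v" for y v s
    using linear_part_diff[OF g, of "y + s *\<^sub>R v" y] linear_cmul[OF linear_linear_part[OF g]]
    by (simp add: algebra_simps)
  show ?thesis
  proof
    show "g ` shadow r A p \<nu> \<subseteq> shadow r (g ` A) (g p) (linear_part g \<nu>)"
    proof (rule image_subsetI)
      fix w assume "w \<in> shadow r A p \<nu>"
      then obtain y s where w: "w \<in> cball p r" "y \<in> A \<inter> cball p (3 * r)" "\<bar>s\<bar> \<le> 4 * r" "w = y + s *\<^sub>R \<nu>"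
        unfolding shadow_def by blast
      have "g w \<in> cball (g p) r" "g y \<in> g ` A \<inter> cball (g p) (3 * r)"
        using w(1,2) by (auto simp: dist_rigid_motion[OF g])
      moreover have "g w = g y + s *\<^sub>R linear_part g \<nu>" unfolding w(4) by (rule add)
      ultimately show "g w \<in> shadow r (g ` A) (g p) (linear_part g \<nu>)"
        unfolding shadow_def using w(3) by blast
    qed
    show "shadow r (g ` A) (g p) (linear_part g \<nu>) \<subseteq> g ` shadow r A p \<nu>"
    proof
      fix w assume "w \<in> shadow r (g ` A) (g p) (linear_part g \<nu>)"
      then obtain y s where w: "dist (g p) w \<le> r" "y \<in> A" "dist p y \<le> 3 * r" "\<bar>s\<bar> \<le> 4 * r"
        "w = g (y + s *\<^sub>R \<nu>)"
        unfolding shadow_def by (auto simp: add dist_rigid_motion[OF g])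
      then have "y + s *\<^sub>R \<nu> \<in> shadow r A p \<nu>"
        unfolding shadow_def by (auto simp: dist_rigid_motion[OF g])
      then show "w \<in> g ` shadow r A p \<nu>" using w(5) by blast
    qed
  qed
qed

lemma measure_rigid_image:
  assumes g: "rigid_motion g" and X: "compact X"
  shows "measure lebesgue (g ` X) = measure lebesgue X"
proof -
  have "g = (\<lambda>x. g 0 + x) \<circ> linear_part g" by (rule ext) (simp add: linear_part_def)
  then have "g ` X = (+) (g 0) ` linear_part g ` X" by (metis image_comp)
  then have "measure lebesgue (g ` X) = measure lebesgue (linear_part g ` X)"
    by (simp add: measure_translation)
  also have "\<dots> = measure lebesgue X"
    by (rule measure_orthogonal_image[OF orthogonal_transformation_linear_part[OF g] lmeasurable_compact[OF X]])
  finally show ?thesis .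
qed

text \<open>Moving along the normal does not change the tangential part, which controls the length of a
  nearly tangential secant.\<close>

lemma near_on_normal_line:
  fixes \<nu> :: "'a::real_inner"
  assumes "norm \<nu> = 1" "\<bar>(z - y) \<bullet> \<nu>\<bar> \<le> norm (z - y) / 2" "w = z + s *\<^sub>R \<nu>"
  shows "norm (z - y) \<le> 6/5 * norm (w - y)"
proof -
  have nn: "\<nu> \<bullet> \<nu> = 1" using assms(1) by (simp add: dot_square_norm)
  let ?P = "\<lambda>v. v - (v \<bullet> \<nu>) *\<^sub>R \<nu>"
  have e1: "?P (w - y) = ?P (z - y)"
    using nn by (simp add: assms(3) inner_diff_left inner_add_left algebra_simps)
  have e2: "norm (?P (w - y)) \<le> norm (w - y)"
  proof (rule power2_le_imp_le)
    have "(norm (w - y))\<^sup>2 = (norm (?P (w - y)))\<^sup>2 + ((w - y) \<bullet> \<nu>)\<^sup>2"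
      unfolding power2_norm_eq_inner using nn
      by (simp add: inner_diff_left inner_diff_right inner_commute power2_eq_square algebra_simps)
    then show "(norm (?P (w - y)))\<^sup>2 \<le> (norm (w - y))\<^sup>2" by simp
  qed simp
  have "norm (z - y) \<le> 6/5 * norm (?P (z - y))"
    by (rule norm_le_tangential[OF assms(1,2)])
  then have "norm (z - y) \<le> 6/5 * norm (?P (w - y))" unfolding e1 .
  with e2 show ?thesis by linarith
qed

text \<open>A normal line through \<open>A\<close> also meets the surface made of \<open>T\<close> and \<open>B\<close>. If it does so in \<open>T\<close>, it meets the
  surface containing \<open>T\<close> and \<open>A\<close> twice, unless both points agree and lie in \<open>A \<inter> T \<subseteq> B\<close>. So it meets \<open>B\<close>.\<close>

lemma shadow_subset:
  assumes S0: "closed S0" "S0 \<subseteq> T \<union> B" "p \<in> S0" "S0 \<inter> ball p (3 * r) \<subseteq> surface_interior k S0" and r: "0 < r"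
    and \<nu>: "norm \<nu> = 1"
    and cone0: "\<And>y z. y \<in> S0 \<inter> cball p (3 * r) \<Longrightarrow> z \<in> S0 \<inter> cball p (3 * r) \<Longrightarrow> \<bar>(y - z) \<bullet> \<nu>\<bar> \<le> norm (y - z) / 2"
    and cone: "\<And>y z. y \<in> S \<inter> cball p (3 * r) \<Longrightarrow> z \<in> S \<inter> cball p (3 * r) \<Longrightarrow> \<bar>(y - z) \<bullet> \<nu>\<bar> \<le> norm (y - z) / 2"
    and TA: "T \<subseteq> S" "A \<subseteq> S" "A \<inter> T \<subseteq> B"
  shows "shadow r A p \<nu> \<subseteq> shadow r B p \<nu>"
proof
  fix w assume "w \<in> shadow r A p \<nu>"
  then obtain y s where w: "w \<in> cball p r" "y \<in> A" "y \<in> cball p (3 * r)" "w = y + s *\<^sub>R \<nu>"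
    unfolding shadow_def by blast
  obtain z s' where z: "z \<in> S0 \<inter> cball p (3 * r)" "w = z + s' *\<^sub>R \<nu>" "\<bar>s'\<bar> \<le> 4 * r"
    using normal_line_meets_surface[OF S0(1,4,3) \<nu> cone0 w(1) r] by metis
  have "z \<in> B"
  proof (cases "z \<in> T")
    case True
    have "y = z"
    proof (rule parallel_secant_eq[OF cone _ \<nu>])
      show "y - z = (s' - s) *\<^sub>R \<nu>" using w(4) z(2) by (simp add: algebra_simps)
    qed (use w True z TA in auto)
    then show ?thesis using True w(2) TA(3) by blast
  qed (use z(1) S0(2) in blast)
  then show "w \<in> shadow r B p \<nu>" unfolding shadow_def using w(1) z by blast
qed

section \<open>A tiling by two tiles excludes all other coronas\<close>

text \<open>Two surfaces tiled by copies of \<open>T\<close> and containing \<open>T\<close> in their interior: \<open>S0\<close> is made of \<open>T\<close> and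
  the copy \<open>B0\<close> glued to it along the whole boundary, \<open>S\<close> is another one. The radius \<open>r\<close> is such that the
  secants of both surfaces in balls of radius \<open>4 * r\<close> at the boundary of \<open>T\<close> are nearly tangential. A
  contradiction is derived if the boundary of \<open>T\<close> is covered by proper arcs shared with tiles of \<open>\<C>\<close>.\<close>

locale circle_corona =
  two: tiled_surface k S0 N0 \<C>0 T n + other: tiled_surface k S N \<C> T n + disc T h h'
  for k S0 N0 \<C>0 T n S N \<C> h h' +
  fixes B0 g r
  assumes T0: "T \<in> \<C>0" "\<C>0 = {T, B0}" "B0 \<noteq> T" "disc_boundary B0 = disc_boundary T"
    and S0_int: "S0 \<subseteq> surface_interior k S0" and N0: "\<And>x. x \<in> T \<Longrightarrow> N0 x = n x"
    and T1: "T \<in> \<C>" "T \<subseteq> surface_interior k S" "finite \<C>" and N1: "\<And>x. x \<in> T \<Longrightarrow> N x = n x"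
    and g: "rigid_motion g" "g ` T = B0" "\<And>x. x \<in> T \<Longrightarrow> linear_part g (n x) = N0 (g x)"
    and r: "0 < r"
    and secant0: "\<And>p y z. p \<in> disc_boundary T \<Longrightarrow> y \<in> S0 \<inter> cball p (4 * r) \<Longrightarrow> z \<in> S0 \<inter> cball p (4 * r) \<Longrightarrow>
      \<bar>(y - z) \<bullet> n p\<bar> \<le> norm (y - z) / 2"
    and secant: "\<And>p y z. p \<in> disc_boundary T \<Longrightarrow> y \<in> S \<inter> cball p (4 * r) \<Longrightarrow> z \<in> S \<inter> cball p (4 * r) \<Longrightarrow>
      \<bar>(y - z) \<bullet> n p\<bar> \<le> norm (y - z) / 2"
begin

abbreviation "c \<equiv> disc_boundary T"

definition \<sigma> :: "real \<Rightarrow> real^3" where "\<sigma> t = h (cis t)"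

definition area :: "real^3 \<Rightarrow> real" where "area x = measure lebesgue (shadow r T x (n x))"

lemma \<sigma>_in: "\<sigma> t \<in> c"
  by (simp add: \<sigma>_def boundary)

lemma \<sigma>_onto: "x \<in> c \<Longrightarrow> \<exists>t. x = \<sigma> t"
proof -
  assume "x \<in> c"
  then obtain z where z: "norm z = 1" "x = h z" using boundary by auto
  then have "z = cis (Arg z)" by (metis cis_Arg complex_norm_eq_1_exp div_by_1 norm_zero of_real_1 sgn_eq zero_neq_one)
  then have "x = h (cis (Arg z))" using z(2) by metis
  then show "\<exists>t. x = \<sigma> t" unfolding \<sigma>_def by blast
qed

lemma \<sigma>_cont: "continuous_on X \<sigma>"
  unfolding \<sigma>_def by (rule continuous_on_compose2[OF cont]) (auto intro!: continuous_intros)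

lemma \<sigma>_inj: "\<sigma> s = \<sigma> t \<Longrightarrow> \<bar>s - t\<bar> < 2 * pi \<Longrightarrow> s = t"
  unfolding \<sigma>_def using inj by (intro cis_injective) (auto dest: inj_onD)

lemma \<sigma>_periodic: "\<sigma> (t + 2 * pi * real_of_int j) = \<sigma> t"
proof -
  have "cis (t + 2 * pi * real_of_int j) = cis t"
    using sin_cos_eq_iff[of "t + 2 * pi * real_of_int j" t] by (auto simp: complex_eq_iff)
  then show ?thesis by (simp add: \<sigma>_def)
qed

lemma \<sigma>_reduce:
  obtains t' where "a \<le> t'" "t' < a + 2 * pi" "\<sigma> t' = \<sigma> t"
proof -
  define j where "j = - \<lfloor>(t - a) / (2 * pi)\<rfloor>"
  have "0 \<le> (t - a) / (2 * pi) + real_of_int j" "(t - a) / (2 * pi) + real_of_int j < 1"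
    unfolding j_def by linarith+
  then have "0 \<le> ((t - a) / (2 * pi) + real_of_int j) * (2 * pi)"
    "((t - a) / (2 * pi) + real_of_int j) * (2 * pi) < 1 * (2 * pi)"
    by (intro mult_nonneg_nonneg mult_strict_right_mono; simp)+
  moreover have "((t - a) / (2 * pi) + real_of_int j) * (2 * pi) = t - a + 2 * pi * real_of_int j"
    by (simp add: field_simps)
  ultimately show thesis using that[of "t + 2 * pi * real_of_int j"] \<sigma>_periodic by simp
qed

lemma arc_neighbourhood:
  assumes "a < b" "b \<le> a + 2 * pi"
  obtains U where "open U" "\<sigma> ` {a<..<b} \<subseteq> U" "c \<inter> U \<subseteq> \<sigma> ` {a<..<b}"
proof
  let ?U = "- \<sigma> ` {b..a + 2 * pi}"
  show "open ?U"
    by (intro open_Compl compact_imp_closed compact_continuous_image \<sigma>_cont) simp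
  show "\<sigma> ` {a<..<b} \<subseteq> ?U"
  proof clarsimp
    fix s t assume st: "a < s" "s < b" "b \<le> t" "t \<le> a + 2 * pi" "\<sigma> s = \<sigma> t"
    then have "s = t" by (intro \<sigma>_inj) auto
    with st show False by simp
  qed
  show "c \<inter> ?U \<subseteq> \<sigma> ` {a<..<b}"
  proof
    fix x assume x: "x \<in> c \<inter> ?U"
    then obtain t where "x = \<sigma> t" using \<sigma>_onto by blast
    then obtain t' where t': "a \<le> t'" "t' < a + 2 * pi" "x = \<sigma> t'" using \<sigma>_reduce[of a t] by metis
    have "t' \<noteq> a"
    proof
      assume "t' = a"
      then have "x = \<sigma> (a + 2 * pi)" using t'(3) \<sigma>_periodic[of a 1] by simp
      moreover have "a + 2 * pi \<in> {b..a + 2 * pi}" using assms by simp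
      ultimately show False using x by blast
    qed
    moreover have "t' < b" using x t' by (metis ComplD IntD2 atLeastAtMost_iff image_eqI less_eq_real_def linorder_not_le)
    ultimately show "x \<in> \<sigma> ` {a<..<b}" using t' by auto
  qed
qed

text \<open>The boundary points of \<open>E\<close> relative to the circle. Defined without a parameterization, they are
  visibly respected by motions preserving the circle; for an arc they are its two ends.\<close>

definition ends :: "(real^3) set \<Rightarrow> (real^3) set" where
  "ends E = {e \<in> E. \<not> (\<exists>U. open U \<and> e \<in> U \<and> c \<inter> U \<subseteq> E)}"

lemma finite_ends:
  assumes "a \<le> b" "b < a + 2 * pi"
  shows "finite (ends (\<sigma> ` {a..b}))"
proof -
  have "ends (\<sigma> ` {a..b}) \<subseteq> {\<sigma> a, \<sigma> b}"
  proof
    fix e assume e: "e \<in> ends (\<sigma> ` {a..b})"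
    then obtain s where s: "s \<in> {a..b}" "e = \<sigma> s" by (auto simp: ends_def)
    show "e \<in> {\<sigma> a, \<sigma> b}"
    proof (rule ccontr)
      assume "e \<notin> {\<sigma> a, \<sigma> b}"
      then have ab: "a < s" "s < b" using s by (auto simp: less_eq_real_def)
      then obtain U where U: "open U" "\<sigma> ` {a<..<b} \<subseteq> U" "c \<inter> U \<subseteq> \<sigma> ` {a<..<b}"
        using arc_neighbourhood[of a b] assms by auto
      have "\<sigma> ` {a<..<b} \<subseteq> \<sigma> ` {a..b}" by auto
      then have "c \<inter> U \<subseteq> \<sigma> ` {a..b}" "e \<in> U" using U(2,3) ab s(2) by auto
      then show False using e U(1) unfolding ends_def by blast
    qed
  qed
  then show ?thesis by (rule finite_subset) simp
qed

lemma connected_subset_arc: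
  assumes "compact M" "connected M" "M \<noteq> {}" "M \<subseteq> c" "M \<noteq> c"
  obtains a b where "a \<le> b" "b < a + 2 * pi" "M = \<sigma> ` {a..b}"
proof -
  have "M \<in> components M" using assms(2,3) by (metis connected_component_eq_self componentsI ex_in_conv)
  then show thesis
    using component_in_boundary[OF compact_imp_closed[OF assms(1)] assms(4,5)] that
    unfolding \<sigma>_def by metis
qed

lemma arc_end_in_ends:
  assumes "a \<le> b" "b < a + 2 * pi"
  shows "\<sigma> a \<in> ends (\<sigma> ` {a..b})" "\<sigma> b \<in> ends (\<sigma> ` {a..b})"
proof -
  have no: "\<not> (\<exists>U. open U \<and> \<sigma> t \<in> U \<and> c \<inter> U \<subseteq> \<sigma> ` {a..b})"
    if t: "\<And>d. 0 < d \<Longrightarrow> \<exists>s. \<bar>s - t\<bar> < d \<and> \<sigma> s \<notin> \<sigma> ` {a..b}" for t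
  proof
    assume "\<exists>U. open U \<and> \<sigma> t \<in> U \<and> c \<inter> U \<subseteq> \<sigma> ` {a..b}"
    then obtain U where U: "open U" "\<sigma> t \<in> U" "c \<inter> U \<subseteq> \<sigma> ` {a..b}" by blast
    have "open (\<sigma> -` U)" using \<sigma>_cont U(1) by (rule open_vimage[rotated])
    then obtain d where d: "0 < d" "ball t d \<subseteq> \<sigma> -` U" using U(2) by (metis openE vimageI)
    obtain s where s: "\<bar>s - t\<bar> < d" "\<sigma> s \<notin> \<sigma> ` {a..b}" using t[OF d(1)] by blast
    have "s \<in> ball t d" using s(1) by (simp add: dist_real_def abs_minus_commute)
    then have "\<sigma> s \<in> U" using d(2) by blast
    then show False using U(3) \<sigma>_in[of s] s(2) by blast
  qed
  have out: "\<sigma> s \<notin> \<sigma> ` {a..b}" if "b < s \<and> s < a + 2 * pi \<or> b - 2 * pi < s \<and> s < a" for s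
  proof
    assume "\<sigma> s \<in> \<sigma> ` {a..b}"
    then obtain t where t: "a \<le> t" "t \<le> b" "\<sigma> s = \<sigma> t" by auto
    then have "s = t" using that assms by (intro \<sigma>_inj) auto
    with t that assms show False by auto
  qed
  have small: "\<exists>m>0. m < d \<and> m < a + 2 * pi - b" if "0 < d" for d
    using that assms(2) dense[of 0 "min d (a + 2 * pi - b)"] by auto
  have 1: "\<exists>s. \<bar>s - b\<bar> < d \<and> \<sigma> s \<notin> \<sigma> ` {a..b}" if "0 < d" for d
  proof -
    obtain m where m: "0 < m" "m < d" "m < a + 2 * pi - b" using small[OF \<open>0 < d\<close>] by blast
    then show ?thesis by (intro exI[of _ "b + m"] conjI out) auto
  qed
  have 2: "\<exists>s. \<bar>s - a\<bar> < d \<and> \<sigma> s \<notin> \<sigma> ` {a..b}" if "0 < d" for d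
  proof -
    obtain m where m: "0 < m" "m < d" "m < a + 2 * pi - b" using small[OF \<open>0 < d\<close>] by blast
    then show ?thesis by (intro exI[of _ "a - m"] conjI out) auto
  qed
  show "\<sigma> a \<in> ends (\<sigma> ` {a..b})" "\<sigma> b \<in> ends (\<sigma> ` {a..b})"
    unfolding ends_def using no[of a] no[of b] 1 2 assms by auto
qed

lemma unit_n: "x \<in> T \<Longrightarrow> norm (n x) = 1"
  using two.normal two.tile_subset[OF T0(1)] N0 unfolding unit_normal_def by (metis subsetD)

lemma g_boundary: "g ` c = c"
  using disc_boundary_rigid_image[OF two.prototile g(1)] g(2) T0(4) by simp

lemma g_normal: "x \<in> c \<Longrightarrow> linear_part g (n x) = n (g x)"
  using g(3) g_boundary boundary_subset N0 by (metis imageI subsetD)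

text \<open>\<open>g\<close> maps \<open>T\<close> to \<open>B0\<close> and preserves volume.\<close>

lemma area_two: "x \<in> c \<Longrightarrow> area x = measure lebesgue (shadow r B0 (g x) (n (g x)))"
  using measure_rigid_image[OF g(1) compact_shadow[OF compact], of r x "n x"]
    shadow_rigid_image[OF g(1), of r T x "n x"] g_normal g(2)
  by (simp add: area_def)

lemma S0_eq: "S0 = T \<union> B0"
  using two.union T0(2) by auto

end

context circle_corona
begin

text \<open>At an end \<open>e\<close> of the common arc the other tile leaves the boundary of \<open>T\<close>. If every interior
  point of \<open>B0\<close> near \<open>e\<close> lay in the shadow of \<open>A\<close>, then \<open>T\<close> and \<open>A\<close> would cover a neighbourhood of
  \<open>e\<close> in the other surface, and the common arc would continue beyond \<open>e\<close>.\<close>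

lemma shadow_gap:
  assumes A: "A \<in> \<C>" "A \<noteq> T" and E: "E \<in> components (T \<inter> A)" and e: "e \<in> ends E"
  obtains y where "y \<in> B0 - c" "norm (y - e) < r / 2"
    "\<And>x s. x \<in> A \<inter> cball e (4 * r) \<Longrightarrow> y \<noteq> x + s *\<^sub>R n e"
proof (rule ccontr)
  note gap = that
  assume neg: "\<not> thesis"
  have eE: "e \<in> E" using e by (simp add: ends_def)
  have ETA: "E \<subseteq> T \<inter> A" using E by (rule in_components_subset)
  have ec: "e \<in> c" using eE ETA other.overlap[OF T1(1) A(1)] A(2) by blast
  have eT: "e \<in> T" using ec boundary_subset by blast
  have all: "\<exists>x s. x \<in> A \<inter> cball e (4 * r) \<and> y = x + s *\<^sub>R n e" if "y \<in> B0 - c" "norm (y - e) < r / 2" for y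
  proof (rule ccontr)
    assume "\<nexists>x s. x \<in> A \<inter> cball e (4 * r) \<and> y = x + s *\<^sub>R n e"
    then have "\<And>x s. x \<in> A \<inter> cball e (4 * r) \<Longrightarrow> y \<noteq> x + s *\<^sub>R n e" by blast
    from gap[OF \<open>y \<in> B0 - c\<close> \<open>norm (y - e) < r / 2\<close> this] neg show False by blast
  qed
  have cov: "S \<inter> ball e (r / 8) \<subseteq> T \<union> A"
  proof
    fix y' assume y': "y' \<in> S \<inter> ball e (r / 8)"
    have w: "y' \<in> cball e r" using y' r by auto
    have eS0: "e \<in> S0" using eT S0_eq by blast
    have s0: "\<And>y z. y \<in> S0 \<inter> cball e (3 * r) \<Longrightarrow> z \<in> S0 \<inter> cball e (3 * r) \<Longrightarrow> \<bar>(y - z) \<bullet> n e\<bar> \<le> norm (y - z) / 2"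
      using secant0[OF ec] r by (simp add: mem_cball)
    obtain z s where z: "z \<in> S0 \<inter> cball e (3 * r)" "y' = z + s *\<^sub>R n e"
      using normal_line_meets_surface[OF two.closed_surface _ eS0 unit_n[OF eT] s0 w r] S0_int by blast
    have e3: "e \<in> S0 \<inter> cball e (3 * r)" using eS0 r by simp
    have "norm (z - e) \<le> 6/5 * norm (y' - e)"
      by (rule near_on_normal_line[OF unit_n[OF eT] s0[OF z(1) e3] z(2)])
    also have "\<dots> < r / 2" using y' r by (simp add: dist_norm norm_minus_commute)
    finally have ze: "norm (z - e) < r / 2" .
    have y4: "y' \<in> S \<inter> cball e (4 * r)" using y' r by auto
    show "y' \<in> T \<union> A"
    proof (cases "z \<in> T")
      case True
      have z4: "z \<in> S \<inter> cball e (4 * r)" using True other.tile_subset[OF T1(1)] z(1) r by auto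
      have "y' = z"
        by (rule parallel_secant_eq[OF secant[OF ec y4 z4] _ unit_n[OF eT], of s]) (simp add: z(2))
      then show ?thesis using True by blast
    next
      case False
      then have "z \<in> B0 - c" using z(1) S0_eq boundary_subset by blast
      then obtain x s' where x: "x \<in> A \<inter> cball e (4 * r)" "z = x + s' *\<^sub>R n e" using all ze by blast
      have x4: "x \<in> S \<inter> cball e (4 * r)" using x(1) other.tile_subset[OF A(1)] by blast
      have "y' = x"
        by (rule parallel_secant_eq[OF secant[OF ec y4 x4] _ unit_n[OF eT], of "s + s'"])
          (simp add: z(2) x(2) algebra_simps)
      then show ?thesis using x(1) by blast
    qed
  qed
  have near: "p \<in> A" if p: "p \<in> c" "p \<in> ball e (r / 8)" for p
  proof -
    have op: "openin (top_of_set S) (S \<inter> ball e (r / 8))" by auto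
    have pS: "p \<in> S \<inter> ball e (r / 8)" using p boundary_subset other.tile_subset[OF T1(1)] by blast
    have "p \<in> \<Union>{A}"
      by (rule other.boundary_covered[OF T1(1,2,3) p(1) op pS]) (use cov A in auto)
    then show ?thesis by simp
  qed
  obtain s0 where s0: "e = \<sigma> s0" using \<sigma>_onto[OF ec] by blast
  have "open (\<sigma> -` ball e (r / 8))" using \<sigma>_cont open_ball by (rule open_vimage[rotated])
  moreover have "s0 \<in> \<sigma> -` ball e (r / 8)" using s0 r by simp
  ultimately obtain d where d: "0 < d" "ball s0 d \<subseteq> \<sigma> -` ball e (r / 8)" by (meson openE)
  define d' where "d' = min d 1"
  have d': "0 < d'" "d' \<le> d" "d' \<le> 1" using d(1) by (auto simp: d'_def)
  let ?I = "{s0 - d'<..<s0 + d'}"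
  have IA: "\<sigma> ` ?I \<subseteq> T \<inter> A"
  proof
    fix x assume "x \<in> \<sigma> ` ?I"
    then obtain s where s: "s \<in> ?I" "x = \<sigma> s" by blast
    then have "s \<in> ball s0 d" using d'(2) by (auto simp: dist_real_def)
    then have "x \<in> ball e (r / 8)" using d(2) s(2) by blast
    then show "x \<in> T \<inter> A" using near \<sigma>_in boundary_subset s(2) by blast
  qed
  have IE: "\<sigma> ` ?I \<subseteq> E"
  proof -
    have conn: "connected (\<sigma> ` ?I)" by (intro connected_continuous_image \<sigma>_cont) simp
    have eI: "e \<in> \<sigma> ` ?I" using s0 d'(1) by auto
    have 1: "\<sigma> ` ?I \<subseteq> connected_component_set (T \<inter> A) e"
      by (rule connected_component_maximal[OF eI conn IA])
    obtain z where z: "E = connected_component_set (T \<inter> A) z" using E by (auto simp: components_def)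
    have "connected_component_set (T \<inter> A) e = E"
      unfolding z by (rule connected_component_eq) (use eE z in simp)
    with 1 show ?thesis by simp
  qed
  have "s0 + d' \<le> s0 - d' + 2 * pi" using d'(3) pi_gt3 by simp
  then obtain U where U: "open U" "\<sigma> ` ?I \<subseteq> U" "c \<inter> U \<subseteq> \<sigma> ` ?I"
    using arc_neighbourhood[of "s0 - d'" "s0 + d'"] d'(1) by auto
  have "e \<in> U" using U(2) s0 d'(1) by auto
  then show False using e U(1,3) IE unfolding ends_def by blast
qed

lemma shadow_mono:
  assumes A: "A \<in> \<C>" "A \<noteq> T" and p: "p \<in> c"
  shows "shadow r A p (n p) \<subseteq> shadow r B0 p (n p)"
proof -
  have pT: "p \<in> T" using p boundary_subset by blast
  have pS0: "p \<in> S0" using pT S0_eq by blast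
  have int: "S0 \<inter> ball p (3 * r) \<subseteq> surface_interior k S0" using S0_int by blast
  have c0: "\<bar>(y - z) \<bullet> n p\<bar> \<le> norm (y - z) / 2"
    if "y \<in> S0 \<inter> cball p (3 * r)" "z \<in> S0 \<inter> cball p (3 * r)" for y z
    by (rule secant0[OF p]) (use that r in auto)
  have c1: "\<bar>(y - z) \<bullet> n p\<bar> \<le> norm (y - z) / 2"
    if "y \<in> S \<inter> cball p (3 * r)" "z \<in> S \<inter> cball p (3 * r)" for y z
    by (rule secant[OF p]) (use that r in auto)
  have AB: "A \<inter> T \<subseteq> B0"
    using other.overlap[OF T1(1) A(1)] A(2) T0(4) two.tile_facts(4)[of B0] T0(2) by blast
  show ?thesis
    by (rule shadow_subset[OF two.closed_surface equalityD1[OF S0_eq] pS0 int r unit_n[OF pT] c0 c1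
          other.tile_subset[OF T1(1)] other.tile_subset[OF A(1)] AB])
qed

text \<open>A ball around the point found in \<open>shadow_gap\<close> lies in the shadow of \<open>B0\<close> and outside of that of \<open>A\<close>. By
  continuity of the normal, the same ball works for all points of the arc close to the end.\<close>

lemma area_drop_at_end:
  assumes A: "A \<in> \<C>" "A \<noteq> T" and E: "E \<in> components (T \<inter> A)" and e: "e \<in> ends E"
  obtains \<delta> \<kappa> where "0 < \<delta>" "0 < \<kappa>" "\<And>p. p \<in> E \<Longrightarrow> dist p e \<le> \<delta> \<Longrightarrow>
    measure lebesgue (shadow r A p (n p)) + \<kappa> \<le> measure lebesgue (shadow r B0 p (n p))"
proof -
  obtain y where y: "y \<in> B0 - c" "norm (y - e) < r / 2"
    "\<And>x s. x \<in> A \<inter> cball e (4 * r) \<Longrightarrow> y \<noteq> x + s *\<^sub>R n e"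
    by (rule shadow_gap[OF assms]) (rule that)
  have eE: "e \<in> E" using e by (simp add: ends_def)
  have Ec: "E \<subseteq> c" using in_components_subset[OF E] other.overlap[OF T1(1) A(1)] A(2) by blast
  have ec: "e \<in> c" using eE Ec by blast
  have B0: "B0 \<in> \<C>0" using T0(2) by blast
  let ?K = "A \<inter> cball e (4 * r)" and ?L = "(\<lambda>s. y - s *\<^sub>R n e) ` {- (4 * r)..4 * r}"
  have cK: "compact ?K" using other.tile_facts(1)[OF A(1)] by (intro compact_Int_closed) auto
  have cL: "closed ?L" by (intro compact_imp_closed compact_continuous_image continuous_intros) simp
  have disj: "?K \<inter> ?L = {}"
  proof (rule ccontr)
    assume "?K \<inter> ?L \<noteq> {}"
    then obtain s where "y - s *\<^sub>R n e \<in> ?K" by blast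
    from y(3)[OF this, of s] show False by simp
  qed
  obtain d where d: "0 < d" "\<And>x z. x \<in> ?K \<Longrightarrow> z \<in> ?L \<Longrightarrow> d \<le> dist x z"
    using separate_compact_closed[OF cK cL disj] by blast
  have "openin (top_of_set S0) (B0 - c)" using two.tile_facts(7)[OF B0] T0(4) by simp
  then obtain \<tau> where \<tau>: "0 < \<tau>" "ball y \<tau> \<inter> S0 \<subseteq> B0 - c"
    using y(1) unfolding openin_contains_ball by blast
  have "continuous_on T n"
    using two.normal two.tile_subset[OF T0(1)] N0 continuous_on_cong[of T T n N0]
    unfolding unit_normal_def by (metis continuous_on_subset)
  then have "\<forall>\<epsilon>>0. \<exists>d>0. \<forall>p\<in>T. dist p e < d \<longrightarrow> dist (n p) (n e) < \<epsilon>"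
    using ec boundary_subset unfolding continuous_on_iff by blast
  from this[rule_format, of "d / (8 * r)"] obtain d1 where d1: "0 < d1"
    "\<And>p. p \<in> T \<Longrightarrow> dist p e < d1 \<Longrightarrow> dist (n p) (n e) < d / (8 * r)" using d(1) r by auto
  define ob where "ob = min (\<tau> / 2) (min (d / 2) (r / 4))"
  have ob: "0 < ob" "ob \<le> \<tau> / 2" "ob \<le> d / 2" "ob \<le> r / 4" using \<tau> d(1) r by (auto simp: ob_def)
  define \<delta> where "\<delta> = min (d1 / 2) (r / 4)"
  have \<delta>: "0 < \<delta>" "\<delta> < d1" "\<delta> \<le> r / 4" using d1(1) r by (auto simp: \<delta>_def)
  define \<kappa> where "\<kappa> = measure lebesgue (ball y ob)"
  have \<kappa>: "0 < \<kappa>" unfolding \<kappa>_def using ob(1) by (simp add: content_ball_pos)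
  show thesis
  proof (rule that[OF \<delta>(1) \<kappa>])
    fix p assume p: "p \<in> E" "dist p e \<le> \<delta>"
    have pc: "p \<in> c" and pT: "p \<in> T" using p(1) Ec boundary_subset by blast+
    have pS0: "p \<in> S0" using pT S0_eq by blast
    have s0: "\<And>y z. y \<in> S0 \<inter> cball p (3 * r) \<Longrightarrow> z \<in> S0 \<inter> cball p (3 * r) \<Longrightarrow> \<bar>(y - z) \<bullet> n p\<bar> \<le> norm (y - z) / 2"
      using secant0[OF pc] r by simp
    have yp: "dist p y \<le> 3 / 4 * r"
      using dist_triangle[of p y e] p(2) \<delta>(3) y(2) by (simp add: dist_norm norm_minus_commute)
    have y3: "y \<in> S0 \<inter> cball p (3 * r)" using yp y(1) S0_eq r by auto
    have sub: "ball y ob \<subseteq> shadow r B0 p (n p)"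
    proof
      fix w assume w: "w \<in> ball y ob"
      have wp: "w \<in> cball p r" using w dist_triangle[of p w y] yp ob(4) by simp
      obtain z s where z: "z \<in> S0 \<inter> cball p (3 * r)" "w = z + s *\<^sub>R n p" "\<bar>s\<bar> \<le> 4 * r"
        using normal_line_meets_surface[OF two.closed_surface _ pS0 unit_n[OF pT] s0 wp r] S0_int by blast
      have "norm (z - y) \<le> 6/5 * norm (w - y)"
        by (rule near_on_normal_line[OF unit_n[OF pT] s0[OF z(1) y3] z(2)])
      also have "\<dots> < \<tau>" using w ob(1,2) by (simp add: dist_norm norm_minus_commute)
      finally have "z \<in> B0" using \<tau>(2) z(1) by (auto simp: dist_norm norm_minus_commute)
      then show "w \<in> shadow r B0 p (n p)" unfolding shadow_def using wp z by blast
    qed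
    have dj: "shadow r A p (n p) \<inter> ball y ob = {}"
    proof (rule ccontr)
      assume "shadow r A p (n p) \<inter> ball y ob \<noteq> {}"
      then obtain w x s where w: "w \<in> ball y ob" "x \<in> A" "x \<in> cball p (3 * r)" "\<bar>s\<bar> \<le> 4 * r" "w = x + s *\<^sub>R n p"
        unfolding shadow_def by blast
      have "x \<in> ?K" using w(2,3) p(2) \<delta>(3) r dist_triangle[of e x p] by (simp add: dist_commute)
      moreover have "y - s *\<^sub>R n e \<in> ?L" using w(4) by (auto simp: abs_le_iff)
      ultimately have "d \<le> dist x (y - s *\<^sub>R n e)" by (rule d(2))
      also have "\<dots> = norm ((w - y) + s *\<^sub>R (n e - n p))"
        by (simp add: dist_norm w(5) algebra_simps)
      also have "\<dots> \<le> norm (w - y) + \<bar>s\<bar> * norm (n e - n p)"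
        by (metis norm_scaleR norm_triangle_ineq)
      also have "\<dots> < d / 2 + d / 2"
      proof (rule add_less_le_mono)
        show "norm (w - y) < d / 2" using w(1) ob(3) by (simp add: dist_norm norm_minus_commute)
        have "norm (n e - n p) \<le> d / (8 * r)"
          using d1(2)[OF pT] p(2) \<delta>(2) by (simp add: dist_norm norm_minus_commute)
        then have "\<bar>s\<bar> * norm (n e - n p) \<le> 4 * r * (d / (8 * r))"
          using w(4) r by (intro mult_mono) auto
        then show "\<bar>s\<bar> * norm (n e - n p) \<le> d / 2" using r by simp
      qed
      finally show False by simp
    qed
    have lmA: "shadow r A p (n p) \<in> lmeasurable"
      by (rule lmeasurable_compact[OF compact_shadow[OF other.tile_facts(1)[OF A(1)]]])
    have lmB: "shadow r B0 p (n p) \<in> lmeasurable"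
      by (rule lmeasurable_compact[OF compact_shadow[OF two.tile_facts(1)[OF B0]]])
    have "measure lebesgue (shadow r A p (n p)) + \<kappa> = measure lebesgue (shadow r A p (n p) \<union> ball y ob)"
      using measure_Un3[OF lmA lmeasurable_ball, of y ob] dj by (simp add: \<kappa>_def)
    also have "\<dots> \<le> measure lebesgue (shadow r B0 p (n p))"
    proof (rule measure_mono_fmeasurable)
      show "shadow r A p (n p) \<union> ball y ob \<subseteq> shadow r B0 p (n p)" using shadow_mono[OF A pc] sub by blast
      show "shadow r A p (n p) \<union> ball y ob \<in> sets lebesgue" using lmA by (auto intro: fmeasurableD)
    qed (rule lmB)
    finally show "measure lebesgue (shadow r A p (n p)) + \<kappa> \<le> measure lebesgue (shadow r B0 p (n p))" .
  qed
qed

end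

lemma lex_decrease:
  fixes xs ys :: "nat list"
  assumes "length xs = length ys" "j < length xs" "xs ! j < ys ! j" "\<And>i. i < j \<Longrightarrow> xs ! i \<le> ys ! i"
  shows "(xs, ys) \<in> lex less_than"
  using assms
proof (induction xs ys arbitrary: j rule: list_induct2')
  case (4 x xs y ys)
  show ?case
  proof (cases "x < y")
    case True
    then show ?thesis using 4(2) by simp
  next
    case False
    then obtain i where i: "j = Suc i" using 4(4) by (cases j) auto
    have "x \<le> y" using 4(5)[of 0] i by simp
    moreover have "(xs, ys) \<in> lex less_than"
    proof (rule 4(1))
      show "length xs = length ys" "i < length xs" "xs ! i < ys ! i" using 4(2-4) i by auto
      show "xs ! m \<le> ys ! m" if "m < i" for m using 4(5)[of "Suc m"] i that by simp
    qed
    ultimately show ?thesis using False 4(2) by simp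
  qed
qed auto

lemma continuous_injective_direction:
  fixes \<theta> :: "real \<Rightarrow> real"
  assumes u: "0 \<le> u" and c: "continuous_on {0..u} \<theta>" and i: "inj_on \<theta> {0..u}"
  obtains \<epsilon> where "\<epsilon> \<in> {1, -1}" "\<And>s t. 0 \<le> s \<Longrightarrow> s < t \<Longrightarrow> t \<le> u \<Longrightarrow> \<epsilon> * \<theta> s < \<epsilon> * \<theta> t"
proof -
  have less: "\<theta> 0 < \<theta> s \<and> \<theta> s < \<theta> t \<or> \<theta> t < \<theta> s \<and> \<theta> s < \<theta> 0" if "0 < s" "s < t" "t \<le> u" for s t
  proof (rule continuous_inj_imp_mono[OF that(1,2)])
    have "{0..t} \<subseteq> {0..u}" using that by auto
    then show "continuous_on {0..t} \<theta>" "inj_on \<theta> {0..t}" using c i by (auto intro: continuous_on_subset inj_on_subset)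
  qed
  define \<epsilon> :: real where "\<epsilon> = (if \<theta> 0 \<le> \<theta> u then 1 else - 1)"
  have "\<epsilon> * \<theta> s < \<epsilon> * \<theta> t" if st: "0 \<le> s" "s < t" "t \<le> u" for s t
  proof -
    have ne: "\<theta> 0 \<noteq> \<theta> u" using inj_on_eq_iff[OF i, of 0 u] st by auto
    consider "s = 0" "t = u" | "s = 0" "t < u" | "0 < s" "t = u" | "0 < s" "t < u" using st by linarith
    then show ?thesis
    proof cases
      case 1
      then show ?thesis using ne by (auto simp: \<epsilon>_def)
    next
      case 2
      then show ?thesis using less[of t u] st by (auto simp: \<epsilon>_def)
    next
      case 3
      then show ?thesis using less[of s u] st by (auto simp: \<epsilon>_def)
    next
      case 4
      then show ?thesis using less[of s t] less[of t u] st by (auto simp: \<epsilon>_def)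
    qed
  qed
  then show thesis by (rule that[rotated]) (auto simp: \<epsilon>_def)
qed

context circle_corona
begin

text \<open>The first exit from the ball of radius \<open>\<delta>\<close> around \<open>\<sigma> t\<close> along the boundary in direction \<open>\<epsilon> = \<plusminus>1\<close>, and the
  sequence of first exits from balls around the previous exit. They depend only on
  distances and on the order along the boundary, so motions respect them.\<close>

definition next_exit :: "real \<Rightarrow> real \<Rightarrow> real \<Rightarrow> real" where
  "next_exit \<delta> t \<epsilon> = Inf {s. 0 \<le> s \<and> \<delta> \<le> dist (\<sigma> (t + \<epsilon> * s)) (\<sigma> t)}"

primrec exit_time :: "real \<Rightarrow> real \<Rightarrow> real \<Rightarrow> nat \<Rightarrow> real" where
  "exit_time \<delta> t \<epsilon> 0 = 0"
| "exit_time \<delta> t \<epsilon> (Suc j) = exit_time \<delta> t \<epsilon> j + next_exit \<delta> (t + \<epsilon> * exit_time \<delta> t \<epsilon> j) \<epsilon>"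

lemma next_exit:
  assumes wide: "\<And>x. \<exists>t. \<delta> \<le> dist (\<sigma> t) x" and \<epsilon>: "\<epsilon> \<in> {1, -1}"
  shows "0 \<le> next_exit \<delta> t \<epsilon>" "\<delta> \<le> dist (\<sigma> (t + \<epsilon> * next_exit \<delta> t \<epsilon>)) (\<sigma> t)"
    "\<And>s. 0 \<le> s \<Longrightarrow> s < next_exit \<delta> t \<epsilon> \<Longrightarrow> dist (\<sigma> (t + \<epsilon> * s)) (\<sigma> t) < \<delta>"
proof -
  let ?X = "{s. 0 \<le> s \<and> \<delta> \<le> dist (\<sigma> (t + \<epsilon> * s)) (\<sigma> t)}"
  have bdd: "bdd_below ?X" by (rule bdd_belowI[of _ 0]) simp
  have "closed ({0..} \<inter> {s. \<delta> \<le> dist (\<sigma> (t + \<epsilon> * s)) (\<sigma> t)})"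
    by (intro closed_Int closed_atLeast closed_Collect_le continuous_intros continuous_on_compose2[OF \<sigma>_cont]) auto
  moreover have "{0..} \<inter> {s. \<delta> \<le> dist (\<sigma> (t + \<epsilon> * s)) (\<sigma> t)} = ?X" by auto
  ultimately have cl: "closed ?X" by simp
  obtain t1 where t1: "\<delta> \<le> dist (\<sigma> t1) (\<sigma> t)" using wide by blast
  have ne: "?X \<noteq> {}"
  proof (cases "\<epsilon> = 1")
    case True
    obtain t2 where "t \<le> t2" "\<sigma> t2 = \<sigma> t1" using \<sigma>_reduce by metis
    then have "t2 - t \<in> ?X" using t1 True by simp
    then show ?thesis by blast
  next
    case False
    obtain t2 where "t - 2 * pi \<le> t2" "t2 < t" "\<sigma> t2 = \<sigma> t1" using \<sigma>_reduce[of "t - 2 * pi" t1] by auto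
    then have "t - t2 \<in> ?X" using t1 False \<epsilon> by auto
    then show ?thesis by blast
  qed
  have "Inf ?X \<in> ?X" by (rule closed_contains_Inf[OF ne bdd cl])
  then show "0 \<le> next_exit \<delta> t \<epsilon>" "\<delta> \<le> dist (\<sigma> (t + \<epsilon> * next_exit \<delta> t \<epsilon>)) (\<sigma> t)"
    by (auto simp: next_exit_def)
  show "dist (\<sigma> (t + \<epsilon> * s)) (\<sigma> t) < \<delta>" if "0 \<le> s" "s < next_exit \<delta> t \<epsilon>" for s
  proof (rule ccontr)
    assume "\<not> dist (\<sigma> (t + \<epsilon> * s)) (\<sigma> t) < \<delta>"
    then have "s \<in> ?X" using that by simp
    then have "Inf ?X \<le> s" using bdd by (rule cInf_lower)
    with that show False by (simp add: next_exit_def)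
  qed
qed

lemma next_exit_eqI:
  assumes "0 \<le> s" "\<delta> \<le> dist (\<sigma> (t + \<epsilon> * s)) (\<sigma> t)"
    "\<And>s'. 0 \<le> s' \<Longrightarrow> s' < s \<Longrightarrow> dist (\<sigma> (t + \<epsilon> * s')) (\<sigma> t) < \<delta>"
  shows "next_exit \<delta> t \<epsilon> = s"
  unfolding next_exit_def
proof (rule cInf_eq_minimum)
  show "s \<in> {s. 0 \<le> s \<and> \<delta> \<le> dist (\<sigma> (t + \<epsilon> * s)) (\<sigma> t)}" using assms by simp
  show "s \<le> s'" if "s' \<in> {s. 0 \<le> s \<and> \<delta> \<le> dist (\<sigma> (t + \<epsilon> * s)) (\<sigma> t)}" for s'
    using that assms(3)[of s'] by (metis (mono_tags, lifting) linorder_not_le mem_Collect_eq)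
qed

lemma \<sigma>_uniformly_continuous:
  assumes "0 < \<delta>"
  obtains \<eta> where "0 < \<eta>" "\<And>s t. \<bar>s - t\<bar> < \<eta> \<Longrightarrow> dist (\<sigma> s) (\<sigma> t) < \<delta>"
proof -
  have "uniformly_continuous_on {-1..2 * pi + 1} \<sigma>"
    by (intro compact_uniformly_continuous \<sigma>_cont) simp
  then obtain d where d: "0 < d" "\<And>s t. s \<in> {-1..2 * pi + 1} \<Longrightarrow> t \<in> {-1..2 * pi + 1} \<Longrightarrow> dist s t < d \<Longrightarrow> dist (\<sigma> s) (\<sigma> t) < \<delta>"
    using assms unfolding uniformly_continuous_on_def by metis
  show thesis
  proof (rule that[of "min d 1"])
    show "0 < min d 1" using d(1) by simp
    fix s t :: real assume st: "\<bar>s - t\<bar> < min d 1"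
    define j where "j = - \<lfloor>t / (2 * pi)\<rfloor>"
    have "0 \<le> t / (2 * pi) + real_of_int j" "t / (2 * pi) + real_of_int j < 1"
      unfolding j_def by linarith+
    then have "0 \<le> (t / (2 * pi) + real_of_int j) * (2 * pi)" "(t / (2 * pi) + real_of_int j) * (2 * pi) < 1 * (2 * pi)"
      by (intro mult_nonneg_nonneg mult_strict_right_mono; simp)+
    moreover have "(t / (2 * pi) + real_of_int j) * (2 * pi) = t + 2 * pi * real_of_int j"
      by (simp add: field_simps)
    ultimately have t: "0 \<le> t + 2 * pi * real_of_int j" "t + 2 * pi * real_of_int j < 2 * pi" by auto
    have "dist (\<sigma> (s + 2 * pi * real_of_int j)) (\<sigma> (t + 2 * pi * real_of_int j)) < \<delta>"
      by (rule d(2)) (use t st in \<open>auto simp: dist_real_def\<close>)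
    then show "dist (\<sigma> s) (\<sigma> t) < \<delta>" by (simp add: \<sigma>_periodic)
  qed
qed

text \<open>Motions preserve distances, and \<open>\<theta>\<close> preserves the order along the rays, so successive first exits
  correspond under \<open>\<theta>\<close>.\<close>

lemma exit_time_transfer:
  assumes wide: "\<And>x. \<exists>t. \<delta> \<le> dist (\<sigma> t) x" and \<epsilon>: "\<epsilon> \<in> {1, -1}" "\<epsilon>' \<in> {1, -1}"
    and q: "rigid_motion q" and u: "0 \<le> u" and \<theta>0: "\<theta> 0 = 0" and c\<theta>: "continuous_on {0..u} \<theta>"
    and mono: "\<And>s t. 0 \<le> s \<Longrightarrow> s < t \<Longrightarrow> t \<le> u \<Longrightarrow> \<theta> s < \<theta> t"
    and carry: "\<And>s. 0 \<le> s \<Longrightarrow> s \<le> u \<Longrightarrow> \<sigma> (t' + \<epsilon>' * \<theta> s) = q (\<sigma> (t + \<epsilon> * s))"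
    and j: "exit_time \<delta> t \<epsilon> j \<le> u"
  shows "exit_time \<delta> t' \<epsilon>' j = \<theta> (exit_time \<delta> t \<epsilon> j)"
  using j
proof (induction j)
  case 0
  then show ?case by (simp add: \<theta>0)
next
  case (Suc j)
  let ?P = "exit_time \<delta> t \<epsilon>"
  let ?x = "next_exit \<delta> (t + \<epsilon> * ?P j) \<epsilon>"
  have nonneg: "0 \<le> ?P i" for i
    by (induction i) (use next_exit(1)[OF wide \<epsilon>(1)] in \<open>auto intro!: add_nonneg_nonneg\<close>)
  have x: "0 \<le> ?x" by (rule next_exit(1)[OF wide \<epsilon>(1)])
  have le: "?P j \<le> u" "?P j + ?x \<le> u" using Suc.prems x by auto
  have IH: "exit_time \<delta> t' \<epsilon>' j = \<theta> (?P j)" by (rule Suc.IH[OF le(1)])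
  have mono': "\<theta> a \<le> \<theta> b" if "0 \<le> a" "a \<le> b" "b \<le> u" for a b
    using mono[of a b] that by (cases "a = b") auto
  have dist: "dist (\<sigma> (t' + \<epsilon>' * \<theta> (?P j + s))) (\<sigma> (t' + \<epsilon>' * \<theta> (?P j))) =
      dist (\<sigma> (t + \<epsilon> * ?P j + \<epsilon> * s)) (\<sigma> (t + \<epsilon> * ?P j))" if "0 \<le> s" "s \<le> ?x" for s
    using carry[of "?P j + s"] carry[of "?P j"] nonneg[of j] le that
    by (simp add: dist_rigid_motion[OF q] algebra_simps)
  have "next_exit \<delta> (t' + \<epsilon>' * \<theta> (?P j)) \<epsilon>' = \<theta> (?P j + ?x) - \<theta> (?P j)"
  proof (rule next_exit_eqI)
    show "0 \<le> \<theta> (?P j + ?x) - \<theta> (?P j)" using mono'[of "?P j" "?P j + ?x"] nonneg[of j] x le by simp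
    have e1: "t' + \<epsilon>' * \<theta> (?P j) + \<epsilon>' * (\<theta> (?P j + ?x) - \<theta> (?P j)) = t' + \<epsilon>' * \<theta> (?P j + ?x)"
      by (simp add: algebra_simps)
    show "\<delta> \<le> dist (\<sigma> (t' + \<epsilon>' * \<theta> (?P j) + \<epsilon>' * (\<theta> (?P j + ?x) - \<theta> (?P j)))) (\<sigma> (t' + \<epsilon>' * \<theta> (?P j)))"
      unfolding e1 dist[OF x order_refl] by (rule next_exit(2)[OF wide \<epsilon>(1)])
    fix s' assume s': "0 \<le> s'" "s' < \<theta> (?P j + ?x) - \<theta> (?P j)"
    have "\<exists>y\<ge>?P j. y \<le> ?P j + ?x \<and> \<theta> y = \<theta> (?P j) + s'"
      by (rule IVT') (use s' x nonneg[of j] le c\<theta> in \<open>auto intro: continuous_on_subset\<close>)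
    then obtain y where y: "?P j \<le> y" "y \<le> ?P j + ?x" "\<theta> y = \<theta> (?P j) + s'" by blast
    have "y \<noteq> ?P j + ?x" using y(3) s'(2) by auto
    then have lt: "0 \<le> y - ?P j" "y - ?P j < ?x" using y by auto
    have e2: "t' + \<epsilon>' * \<theta> (?P j) + \<epsilon>' * s' = t' + \<epsilon>' * \<theta> (?P j + (y - ?P j))"
      using y(3) by (simp add: algebra_simps)
    show "dist (\<sigma> (t' + \<epsilon>' * \<theta> (?P j) + \<epsilon>' * s')) (\<sigma> (t' + \<epsilon>' * \<theta> (?P j))) < \<delta>"
      unfolding e2 dist[OF lt(1) less_imp_le[OF lt(2)]] by (rule next_exit(3)[OF wide \<epsilon>(1) lt])
  qed
  then show ?case using IH by simp
qed

lemma area_nonneg: "0 \<le> area x"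
  by (simp add: area_def)

text \<open>Let \<open>f\<close> be the motion placing \<open>A\<close>. The motion \<open>q = f\<^sup>-\<^sup>1 \<circ> g\<close> takes the boundary circle of \<open>T\<close> to that of \<open>B0\<close>,
  which is the same circle, and then, as long as the point stays in the arc \<open>E\<close> shared with \<open>A\<close>, back
  to the boundary of \<open>T\<close>. It compares the volume of \<open>B0\<close> to that of \<open>A\<close> at the same point of \<open>E\<close>. The
  direction \<open>\<epsilon>'\<close> of the new ray is whatever it turns out to be, so both directions have to be admitted.\<close>

lemma ray_step:
  assumes A: "A \<in> \<C>" "A \<noteq> T" and E: "E \<in> components (T \<inter> A)" "E \<noteq> c"
    and x: "g (\<sigma> t) \<in> E" and \<epsilon>: "\<epsilon> \<in> {1, -1}"
  obtains q u \<theta> t' \<epsilon>' where "rigid_motion q" "\<epsilon>' \<in> {1, -1}" "0 \<le> u" "u < 2 * pi" "\<theta> 0 = 0" "continuous_on {0..u} \<theta>"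
    "\<And>s t. 0 \<le> s \<Longrightarrow> s < t \<Longrightarrow> t \<le> u \<Longrightarrow> \<theta> s < \<theta> t"
    "\<And>s. 0 \<le> s \<Longrightarrow> s \<le> u \<Longrightarrow> \<sigma> (t' + \<epsilon>' * \<theta> s) = q (\<sigma> (t + \<epsilon> * s))"
    "\<And>s. 0 \<le> s \<Longrightarrow> s \<le> u \<Longrightarrow> g (\<sigma> (t + \<epsilon> * s)) \<in> E"
    "g (\<sigma> (t + \<epsilon> * u)) \<in> ends E"
    "\<And>s. 0 \<le> s \<Longrightarrow> s \<le> u \<Longrightarrow>
       area (q (\<sigma> (t + \<epsilon> * s))) = measure lebesgue (shadow r A (g (\<sigma> (t + \<epsilon> * s))) (n (g (\<sigma> (t + \<epsilon> * s)))))"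
proof -
  obtain f where f: "rigid_motion f" "f ` T = A" "\<And>x. x \<in> T \<Longrightarrow> linear_part f (n x) = N (f x)"
    using other.tile_motion[OF A(1)] by metis
  let ?f' = "motion_inv f" and ?g' = "motion_inv g"
  note f' = rigid_motion_inv[OF f(1)] and g' = rigid_motion_inv[OF g(1)]
  have TA: "T \<inter> A \<subseteq> c \<inter> disc_boundary A" using other.overlap[OF T1(1) A(1)] A(2) by blast
  have bA: "disc_boundary A = f ` c" using disc_boundary_rigid_image[OF two.prototile f(1)] f(2) by simp
  have ETA: "E \<subseteq> T \<inter> A" using E(1) by (rule in_components_subset)
  have Ec: "E \<subseteq> c" "E \<subseteq> f ` c" using ETA TA bA by auto
  have cE: "compact E"
    using E(1) compact other.tile_facts(2)[OF A(1)] closed_components[of "T \<inter> A" E] closed Ec(1) compact_boundary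
    by (metis closed_Int compact_Int_closed inf.absorb2)
  have connE: "connected E" "E \<noteq> {}" using E(1) in_components_connected in_components_nonempty by blast+
  have inv_f: "?f' x \<in> c" "f (?f' x) = x" if "x \<in> E" for x using Ec(2) that f'(2,3) by auto
  have inv_g: "?g' x \<in> c" "g (?g' x) = x" if "x \<in> c" for x using g_boundary that g'(2,3) by (metis imageE, simp)
  \<comment> \<open>The arc in the boundary that \<open>g\<close> carries to \<open>E\<close>, in a parameter interval containing \<open>t\<close>.\<close>
  define M where "M = ?g' ` E"
  have gM: "g ` M = E" using g'(3) by (simp add: M_def image_image)
  have Mc: "M \<subseteq> c" using inv_g(1) Ec(1) by (auto simp: M_def)
  have "M \<noteq> c" using gM g_boundary E(2) by metis
  moreover have "compact M" "connected M" "M \<noteq> {}"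
    unfolding M_def using cE connE
    by (auto intro!: compact_continuous_image connected_continuous_image continuous_on_rigid_motion[OF g'(1)])
  ultimately obtain a b where ab: "a \<le> b" "b < a + 2 * pi" "M = \<sigma> ` {a..b}"
    using connected_subset_arc Mc by metis
  have tM: "\<sigma> t \<in> M" using x g'(2) unfolding M_def by (metis imageI)
  then obtain t0 where t0: "t0 \<in> {a..b}" "\<sigma> t = \<sigma> t0" using ab(3) by blast
  obtain j :: int where j: "t = t0 + 2 * pi * j"
  proof -
    have "cis t = cis t0" using t0(2) inj by (auto simp: \<sigma>_def dest: inj_onD)
    then have "sin t = sin t0 \<and> cos t = cos t0" by (simp add: complex_eq_iff)
    then show thesis using that sin_cos_eq_iff by blast
  qed
  have shift: "\<sigma> (t + y) = \<sigma> (t0 + y)" for y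
    using \<sigma>_periodic[of "t0 + y" j] by (simp add: j algebra_simps)
  define u where "u = (if \<epsilon> = 1 then b - t0 else t0 - a)"
  have u: "0 \<le> u" "u < 2 * pi" using t0(1) ab by (auto simp: u_def)
  have inM: "\<sigma> (t + \<epsilon> * s) \<in> M" if "0 \<le> s" "s \<le> u" for s
    unfolding shift ab(3) using that t0(1) \<epsilon> by (intro imageI) (auto simp: u_def)
  have endM: "\<sigma> (t + \<epsilon> * u) \<in> ends M"
    unfolding shift using arc_end_in_ends[OF ab(1,2)] \<epsilon> ab(3) by (auto simp: u_def)
  have gE: "g (\<sigma> (t + \<epsilon> * s)) \<in> E" if "0 \<le> s" "s \<le> u" for s using inM[OF that] gM by blast
  have gend: "g (\<sigma> (t + \<epsilon> * u)) \<in> ends E"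
  proof (rule ccontr)
    assume "g (\<sigma> (t + \<epsilon> * u)) \<notin> ends E"
    then obtain U where U: "open U" "g (\<sigma> (t + \<epsilon> * u)) \<in> U" "c \<inter> U \<subseteq> E"
      using gE[OF u(1) order_refl] by (auto simp: ends_def)
    have "open (g -` U)" using continuous_on_rigid_motion[OF g(1)] U(1) by (rule open_vimage[rotated])
    moreover have "c \<inter> g -` U \<subseteq> M"
    proof
      fix y assume y: "y \<in> c \<inter> g -` U"
      then have "g y \<in> E" using g_boundary U(3) by blast
      then show "y \<in> M" using g'(2) unfolding M_def by (metis imageI)
    qed
    ultimately show False using endM U(2) unfolding ends_def by blast
  qed
  \<comment> \<open>The arc in the boundary that \<open>f\<close> carries to \<open>E\<close>.\<close>
  define M' where "M' = ?f' ` E"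
  have fM': "f ` M' = E" using f'(3) by (simp add: M'_def image_image)
  have M'c: "M' \<subseteq> c" using inv_f(1) by (auto simp: M'_def)
  have "M' \<noteq> c"
  proof
    assume "M' = c"
    then have "disc_boundary A \<subseteq> c" using bA fM' Ec(1) by simp
    moreover obtain k k' where "disc A k k'" using other.tile_disc[OF A(1)] .
    ultimately have "disc_boundary A = c" using disc_boundary_subset_imp_eq disc_axioms by blast
    then show False using bA fM' \<open>M' = c\<close> E(2) by simp
  qed
  moreover have "compact M'" "connected M'" "M' \<noteq> {}"
    unfolding M'_def using cE connE
    by (auto intro!: compact_continuous_image connected_continuous_image continuous_on_rigid_motion[OF f'(1)])
  ultimately obtain a' b' where ab': "a' \<le> b'" "b' < a' + 2 * pi" "M' = \<sigma> ` {a'..b'}"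
    using connected_subset_arc M'c by metis
  have inj': "inj_on \<sigma> {a'..b'}"
    by (rule inj_onI, rule \<sigma>_inj) (use ab'(2) in auto)
  obtain \<tau> where \<tau>: "homeomorphism {a'..b'} M' \<sigma> \<tau>"
    using homeomorphism_compact[OF compact_Icc \<sigma>_cont ab'(3)[symmetric] inj'] by blast
  define q where "q = ?f' \<circ> g"
  have q: "rigid_motion q" unfolding q_def by (rule rigid_motion_comp(1)[OF f'(1) g(1)])
  have qM: "q (\<sigma> (t + \<epsilon> * s)) \<in> M'" if "0 \<le> s" "s \<le> u" for s
    using gE[OF that] by (simp add: q_def M'_def)
  define \<theta>1 where "\<theta>1 s = \<tau> (q (\<sigma> (t + \<epsilon> * s)))" for s
  have \<sigma>\<theta>1: "\<sigma> (\<theta>1 s) = q (\<sigma> (t + \<epsilon> * s))" if "0 \<le> s" "s \<le> u" for s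
    unfolding \<theta>1_def by (rule homeomorphism_apply2[OF \<tau> qM[OF that]])
  have c\<theta>1: "continuous_on {0..u} \<theta>1"
    unfolding \<theta>1_def
  proof (rule continuous_on_compose2[OF homeomorphism_cont2[OF \<tau>]])
    show "continuous_on {0..u} (\<lambda>s. q (\<sigma> (t + \<epsilon> * s)))"
      by (intro continuous_on_compose2[OF continuous_on_rigid_motion[OF q]]
          continuous_on_compose2[OF \<sigma>_cont] continuous_intros) auto
  qed (use qM in auto)
  have i\<theta>1: "inj_on \<theta>1 {0..u}"
  proof (rule inj_onI)
    fix s s' assume s: "s \<in> {0..u}" "s' \<in> {0..u}" "\<theta>1 s = \<theta>1 s'"
    then have "q (\<sigma> (t + \<epsilon> * s)) = q (\<sigma> (t + \<epsilon> * s'))" using \<sigma>\<theta>1 by (metis atLeastAtMost_iff)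
    then have "\<sigma> (t + \<epsilon> * s) = \<sigma> (t + \<epsilon> * s')" using inj_rigid_motion[OF q] by (simp add: inj_eq)
    then have "t + \<epsilon> * s = t + \<epsilon> * s'" by (rule \<sigma>_inj) (use s(1,2) u \<epsilon> in auto)
    then show "s = s'" using \<epsilon> by auto
  qed
  obtain \<epsilon>' where \<epsilon>': "\<epsilon>' \<in> {1, -1}" "\<And>s t. 0 \<le> s \<Longrightarrow> s < t \<Longrightarrow> t \<le> u \<Longrightarrow> \<epsilon>' * \<theta>1 s < \<epsilon>' * \<theta>1 t"
    using continuous_injective_direction[OF u(1) c\<theta>1 i\<theta>1] by metis
  define \<theta> where "\<theta> s = \<epsilon>' * (\<theta>1 s - \<theta>1 0)" for s
  have sq: "\<epsilon>' * (\<epsilon>' * y) = y" for y using \<epsilon>'(1) by auto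
  show thesis
  proof (rule that[of q \<epsilon>' u \<theta> "\<theta>1 0"])
    show "continuous_on {0..u} \<theta>" unfolding \<theta>_def by (intro continuous_intros c\<theta>1)
    show "\<theta> s < \<theta> s'" if "0 \<le> s" "s < s'" "s' \<le> u" for s s'
      using \<epsilon>'(2)[OF that] by (simp add: \<theta>_def right_diff_distrib)
    show "\<sigma> (\<theta>1 0 + \<epsilon>' * \<theta> s) = q (\<sigma> (t + \<epsilon> * s))" if "0 \<le> s" "s \<le> u" for s
      unfolding \<theta>_def sq using \<sigma>\<theta>1[OF that] by simp
    show "area (q (\<sigma> (t + \<epsilon> * s))) = measure lebesgue (shadow r A (g (\<sigma> (t + \<epsilon> * s))) (n (g (\<sigma> (t + \<epsilon> * s)))))"
      if s: "0 \<le> s" "s \<le> u" for s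
    proof -
      let ?p = "g (\<sigma> (t + \<epsilon> * s))" and ?y = "q (\<sigma> (t + \<epsilon> * s))"
      have pE: "?p \<in> E" by (rule gE[OF s])
      have y: "?y \<in> T" "f ?y = ?p" using inv_f[OF pE] boundary_subset by (auto simp: q_def)
      have "?p \<in> T" using pE ETA by blast
      then have nn: "linear_part f (n ?y) = n ?p" using f(3)[OF y(1)] y(2) N1 by simp
      have "area ?y = measure lebesgue (f ` shadow r T ?y (n ?y))"
        unfolding area_def by (rule measure_rigid_image[symmetric, OF f(1) compact_shadow[OF compact]])
      also have "\<dots> = measure lebesgue (shadow r A ?p (n ?p))"
        by (simp only: shadow_rigid_image[OF f(1), symmetric] f(2) y(2) nn)
      finally show ?thesis .
    qed
  qed (use q \<epsilon>'(1) u gE gend in \<open>auto simp: \<theta>_def\<close>)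
qed

lemma area_mono:
  assumes "A \<in> \<C>" "A \<noteq> T" "p \<in> c"
  shows "measure lebesgue (shadow r A p (n p)) \<le> measure lebesgue (shadow r B0 p (n p))"
proof (rule measure_mono_fmeasurable[OF shadow_mono[OF assms]])
  have "B0 \<in> \<C>0" using T0(2) by blast
  then show "shadow r B0 p (n p) \<in> lmeasurable" by (intro lmeasurable_compact compact_shadow two.tile_facts(1))
  show "shadow r A p (n p) \<in> sets lebesgue"
    by (intro fmeasurableD lmeasurable_compact compact_shadow other.tile_facts(1) assms(1))
qed

text \<open>To a ray along the boundary, given by its start and direction, the list of rounded volumes at its successive
  exits is assigned; \<open>J\<close> exits always suffice to go around once. \<open>ray_step\<close> produces another ray. Up
  to the last exit before the end of the arc the volumes do not increase, and at that exit,
  which is within \<open>\<delta>\<close> of the end, the volume drops by at least the unit \<open>\<kappa>\<close> of rounding. So the list decreases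
  in the well-founded lexicographic order on lists of fixed length, for every ray.\<close>

theorem no_other_corona:
  assumes fin: "finite \<E>" and cover: "c \<subseteq> \<Union>\<E>"
    and nb: "\<And>E. E \<in> \<E> \<Longrightarrow> \<exists>A\<in>\<C>. A \<noteq> T \<and> E \<in> components (T \<inter> A)" and proper: "\<And>E. E \<in> \<E> \<Longrightarrow> E \<noteq> c"
  shows False
proof -
  obtain nbr where nbr: "\<And>E. E \<in> \<E> \<Longrightarrow> nbr E \<in> \<C> \<and> nbr E \<noteq> T \<and> E \<in> components (T \<inter> nbr E)"
    using nb by metis
  have Ec: "E \<subseteq> c" if "E \<in> \<E>" for E
    using nbr[OF that] in_components_subset[of E "T \<inter> nbr E"] other.overlap[OF T1(1), of "nbr E"] by blast
  have fe: "finite (ends E)" if E: "E \<in> \<E>" for E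
  proof -
    have "closed (T \<inter> nbr E)" using closed other.tile_facts(2) nbr[OF E] by blast
    then have "closed E" using closed_components nbr[OF E] by blast
    then have "compact E" using Ec[OF E] compact_boundary by (metis compact_Int_closed inf.absorb2)
    then show ?thesis
      using connected_subset_arc[of E] nbr[OF E] in_components_connected in_components_nonempty Ec[OF E]
        proper[OF E] finite_ends by metis
  qed
  \<comment> \<open>There are finitely many ends, so the drop of area is uniform.\<close>
  define X where "X = (SIGMA E:\<E>. ends E)"
  have finX: "finite X" unfolding X_def using fin fe by simp
  have "\<exists>\<delta> \<kappa>. 0 < \<delta> \<and> 0 < \<kappa> \<and> (\<forall>p\<in>fst z. dist p (snd z) \<le> \<delta> \<longrightarrow>
      measure lebesgue (shadow r (nbr (fst z)) p (n p)) + \<kappa> \<le> measure lebesgue (shadow r B0 p (n p)))" if "z \<in> X" for z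
  proof -
    have z: "fst z \<in> \<E>" "snd z \<in> ends (fst z)" using that by (auto simp: X_def)
    show ?thesis using area_drop_at_end[of "nbr (fst z)" "fst z" "snd z"] nbr[OF z(1)] z(2) by metis
  qed
  then obtain \<delta>1 \<kappa>1 where dk: "\<And>z. z \<in> X \<Longrightarrow> 0 < \<delta>1 z \<and> 0 < \<kappa>1 z \<and> (\<forall>p\<in>fst z. dist p (snd z) \<le> \<delta>1 z \<longrightarrow>
      measure lebesgue (shadow r (nbr (fst z)) p (n p)) + \<kappa>1 z \<le> measure lebesgue (shadow r B0 p (n p)))"
    by metis
  have lower: "\<exists>m>0. \<forall>z\<in>X. m \<le> v z" if "\<And>z. z \<in> X \<Longrightarrow> 0 < v z" for v :: "_ \<Rightarrow> real"
  proof (cases "X = {}")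
    case True
    then show ?thesis by (intro exI[of _ 1]) simp
  next
    case False
    then show ?thesis using finX that by (intro exI[of _ "Min (v ` X)"]) (auto simp: Min_gr_iff)
  qed
  obtain \<kappa> where \<kappa>: "0 < \<kappa>" "\<And>z. z \<in> X \<Longrightarrow> \<kappa> \<le> \<kappa>1 z" using lower[of \<kappa>1] dk by metis
  obtain \<delta>2 where \<delta>2: "0 < \<delta>2" "\<And>z. z \<in> X \<Longrightarrow> \<delta>2 \<le> \<delta>1 z" using lower[of \<delta>1] dk by metis
  have "\<sigma> 0 \<noteq> \<sigma> 1" using \<sigma>_inj[of 0 1] pi_gt3 by auto
  define \<delta> where "\<delta> = min \<delta>2 (dist (\<sigma> 0) (\<sigma> 1) / 2)"
  have \<delta>: "0 < \<delta>" "\<delta> \<le> \<delta>2" "2 * \<delta> \<le> dist (\<sigma> 0) (\<sigma> 1)" using \<delta>2(1) \<open>\<sigma> 0 \<noteq> \<sigma> 1\<close> by (auto simp: \<delta>_def)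
  have wide: "\<exists>t. \<delta> \<le> dist (\<sigma> t) x" for x
    using dist_triangle2[of "\<sigma> 0" "\<sigma> 1" x] \<delta>(3) by (metis add_le_cancel_right linorder_not_le mult_2 add_strict_mono order_less_le_trans order_less_irrefl)
  obtain \<eta> where \<eta>: "0 < \<eta>" "\<And>s t. \<bar>s - t\<bar> < \<eta> \<Longrightarrow> dist (\<sigma> s) (\<sigma> t) < \<delta>"
    by (rule \<sigma>_uniformly_continuous[OF \<delta>(1)]) (rule that)
  have step: "\<eta> \<le> next_exit \<delta> t \<epsilon>" if \<epsilon>: "\<epsilon> \<in> {1, -1}" for t \<epsilon>
  proof (rule ccontr)
    assume "\<not> \<eta> \<le> next_exit \<delta> t \<epsilon>"
    then have "\<bar>t + \<epsilon> * next_exit \<delta> t \<epsilon> - t\<bar> < \<eta>" using next_exit(1)[OF wide \<epsilon>, of t] \<epsilon> by auto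
    then show False using \<eta>(2) next_exit(2)[OF wide \<epsilon>, of t] by fastforce
  qed
  have exit_ge: "real j * \<eta> \<le> exit_time \<delta> t \<epsilon> j" if \<epsilon>: "\<epsilon> \<in> {1, -1}" for t \<epsilon> j
  proof (induction j)
    case (Suc j)
    then show ?case using step[OF \<epsilon>, of "t + \<epsilon> * exit_time \<delta> t \<epsilon> j"] by (simp add: algebra_simps)
  qed simp
  obtain J :: nat where J: "2 * pi < real J * \<eta>" using reals_Archimedean3[OF \<eta>(1)] by blast
  define F where "F = (\<lambda>(t, \<epsilon>). map (\<lambda>j. nat \<lfloor>area (\<sigma> (t + \<epsilon> * exit_time \<delta> t \<epsilon> j)) / \<kappa>\<rfloor>) [0..<J])"
  have decrease: "\<exists>t' \<epsilon>'. \<epsilon>' \<in> {1, -1} \<and> (F (t', \<epsilon>'), F (t, \<epsilon>)) \<in> lex less_than" if \<epsilon>: "\<epsilon> \<in> {1, -1}" for t \<epsilon>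
  proof -
    have "g (\<sigma> t) \<in> c" using g_boundary \<sigma>_in by blast
    then obtain E where E: "E \<in> \<E>" "g (\<sigma> t) \<in> E" using cover by blast
    let ?A = "nbr E"
    have A: "?A \<in> \<C>" "?A \<noteq> T" "E \<in> components (T \<inter> ?A)" using nbr[OF E(1)] by auto
    obtain q u \<theta> t' \<epsilon>' where q: "rigid_motion q" "\<epsilon>' \<in> {1, -1}" "0 \<le> u" "u < 2 * pi" "\<theta> 0 = 0" "continuous_on {0..u} \<theta>"
      "\<And>s t. 0 \<le> s \<Longrightarrow> s < t \<Longrightarrow> t \<le> u \<Longrightarrow> \<theta> s < \<theta> t"
      "\<And>s. 0 \<le> s \<Longrightarrow> s \<le> u \<Longrightarrow> \<sigma> (t' + \<epsilon>' * \<theta> s) = q (\<sigma> (t + \<epsilon> * s))"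
      "\<And>s. 0 \<le> s \<Longrightarrow> s \<le> u \<Longrightarrow> g (\<sigma> (t + \<epsilon> * s)) \<in> E"
      "g (\<sigma> (t + \<epsilon> * u)) \<in> ends E"
      "\<And>s. 0 \<le> s \<Longrightarrow> s \<le> u \<Longrightarrow>
       area (q (\<sigma> (t + \<epsilon> * s))) = measure lebesgue (shadow r ?A (g (\<sigma> (t + \<epsilon> * s))) (n (g (\<sigma> (t + \<epsilon> * s)))))"
      by (rule ray_step[OF A(1,2,3) proper[OF E(1)] E(2) \<epsilon>]) (rule that)
    let ?P = "exit_time \<delta> t \<epsilon>" and ?P' = "exit_time \<delta> t' \<epsilon>'"
    have P0: "0 \<le> ?P i" for i using exit_ge[OF \<epsilon>, of i t] \<eta>(1) by (meson mult_nonneg_nonneg of_nat_0_le_iff order_less_imp_le order_trans)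
    \<comment> \<open>The last exit before the end of the arc.\<close>
    have "\<exists>m. u < ?P m" using exit_ge[OF \<epsilon>, of J t] J q(4) by (intro exI[of _ J]) linarith
    define m where "m = (LEAST m. u < ?P m)"
    have m: "u < ?P m" unfolding m_def using \<open>\<exists>m. u < ?P m\<close> by (rule LeastI_ex)
    have mJ: "m \<le> J" unfolding m_def by (rule Least_le) (use exit_ge[OF \<epsilon>, of J t] J q(4) in linarith)
    have before: "?P i \<le> u" if "i < m" for i using not_less_Least[of i "\<lambda>m. u < ?P m"] that by (simp add: m_def)
    have "m \<noteq> 0" using m q(3) by (metis exit_time.simps(1) linorder_not_le)
    then obtain j where j: "m = Suc j" by (cases m) auto
    have le_area: "area (\<sigma> (t' + \<epsilon>' * ?P' i)) \<le> area (\<sigma> (t + \<epsilon> * ?P i)) \<and>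
        (i = j \<longrightarrow> area (\<sigma> (t' + \<epsilon>' * ?P' i)) + \<kappa> \<le> area (\<sigma> (t + \<epsilon> * ?P i)))" if i: "i \<le> j" for i
    proof -
      have Pi: "?P i \<le> u" using before i j by simp
      have "?P' i = \<theta> (?P i)"
        by (rule exit_time_transfer[OF wide \<epsilon> q(2,1,3,5,6,7,8) Pi])
      then have eq: "\<sigma> (t' + \<epsilon>' * ?P' i) = q (\<sigma> (t + \<epsilon> * ?P i))" using q(8)[OF P0 Pi] by simp
      let ?p = "g (\<sigma> (t + \<epsilon> * ?P i))"
      have pE: "?p \<in> E" by (rule q(9)[OF P0 Pi])
      have pc: "?p \<in> c" using pE Ec[OF E(1)] by blast
      have a1: "area (\<sigma> (t' + \<epsilon>' * ?P' i)) = measure lebesgue (shadow r ?A ?p (n ?p))"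
        unfolding eq by (rule q(11)[OF P0 Pi])
      have a2: "area (\<sigma> (t + \<epsilon> * ?P i)) = measure lebesgue (shadow r B0 ?p (n ?p))"
        by (rule area_two[OF \<sigma>_in])
      have "measure lebesgue (shadow r ?A ?p (n ?p)) + \<kappa> \<le> measure lebesgue (shadow r B0 ?p (n ?p))" if ij: "i = j"
      proof -
        let ?e = "g (\<sigma> (t + \<epsilon> * u))"
        have z: "(E, ?e) \<in> X" using E(1) q(10) by (simp add: X_def)
        have "u - ?P j < next_exit \<delta> (t + \<epsilon> * ?P j) \<epsilon>" using m j by simp
        then have "dist (\<sigma> (t + \<epsilon> * ?P j + \<epsilon> * (u - ?P j))) (\<sigma> (t + \<epsilon> * ?P j)) < \<delta>"
          by (intro next_exit(3)[OF wide \<epsilon>]) (use Pi ij in auto)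
        then have "dist (\<sigma> (t + \<epsilon> * u)) (\<sigma> (t + \<epsilon> * ?P j)) < \<delta>" by (simp add: algebra_simps)
        then have "dist ?p ?e \<le> \<delta>1 (E, ?e)"
          using \<delta>(2) \<delta>2(2)[OF z] ij by (simp add: dist_rigid_motion[OF g(1)] dist_commute)
        then have "measure lebesgue (shadow r ?A ?p (n ?p)) + \<kappa>1 (E, ?e) \<le> measure lebesgue (shadow r B0 ?p (n ?p))"
          using dk[OF z] pE by simp
        then show ?thesis using \<kappa>(2)[OF z] by linarith
      qed
      then show ?thesis unfolding a1 a2 using area_mono[OF A(1,2) pc] by blast
    qed
    have "(F (t', \<epsilon>'), F (t, \<epsilon>)) \<in> lex less_than"
    proof (rule lex_decrease[where j=j])
      show "length (F (t', \<epsilon>')) = length (F (t, \<epsilon>))" by (simp add: F_def)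
      show jJ: "j < length (F (t', \<epsilon>'))" using mJ j by (simp add: F_def)
      have nth: "F (a, b) ! i = nat \<lfloor>area (\<sigma> (a + b * exit_time \<delta> a b i)) / \<kappa>\<rfloor>" if "i \<le> j" for a b i
        using that mJ j by (simp add: F_def)
      show "F (t', \<epsilon>') ! i \<le> F (t, \<epsilon>) ! i" if "i < j" for i
      proof -
        have "area (\<sigma> (t' + \<epsilon>' * ?P' i)) / \<kappa> \<le> area (\<sigma> (t + \<epsilon> * ?P i)) / \<kappa>"
          using le_area[of i] that \<kappa>(1) by (intro divide_right_mono) auto
        then show ?thesis using that by (simp add: nth nat_mono floor_mono)
      qed
      have "(area (\<sigma> (t' + \<epsilon>' * ?P' j)) + \<kappa>) / \<kappa> \<le> area (\<sigma> (t + \<epsilon> * ?P j)) / \<kappa>"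
        using le_area[of j] \<kappa>(1) by (intro divide_right_mono) auto
      then have "area (\<sigma> (t' + \<epsilon>' * ?P' j)) / \<kappa> + 1 \<le> area (\<sigma> (t + \<epsilon> * ?P j)) / \<kappa>"
        using \<kappa>(1) by (simp add: add_divide_distrib)
      moreover have "0 \<le> area (\<sigma> (t' + \<epsilon>' * ?P' j)) / \<kappa>" using area_nonneg \<kappa>(1) by simp
      ultimately have "nat \<lfloor>area (\<sigma> (t' + \<epsilon>' * ?P' j)) / \<kappa>\<rfloor> < nat \<lfloor>area (\<sigma> (t + \<epsilon> * ?P j)) / \<kappa>\<rfloor>"
        by linarith
      then show "F (t', \<epsilon>') ! j < F (t, \<epsilon>) ! j" by (simp add: nth)
    qed
    then show ?thesis using q(2) by blast
  qed
  have "wf (lex less_than)" by (rule wf_lex[OF wf_less_than])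
  moreover have "F (0, 1) \<in> F ` (UNIV \<times> {1, -1})" by simp
  ultimately obtain z where z: "z \<in> F ` (UNIV \<times> {1, -1})" "\<And>y. (y, z) \<in> lex less_than \<Longrightarrow> y \<notin> F ` (UNIV \<times> {1, -1})"
    by (rule wfE_min) (rule that)
  obtain t \<epsilon> where "\<epsilon> \<in> {1, -1}" "z = F (t, \<epsilon>)" using z(1) by blast
  then obtain t' \<epsilon>' where "\<epsilon>' \<in> {1, -1}" "(F (t', \<epsilon>'), z) \<in> lex less_than" using decrease by metis
  then show False using z(2) by blast
qed

end

section \<open>Tilings by tiles of type 4\<close>

lemma edge_congruent_sym:
  assumes "edge_congruent n e1 e2"
  shows "edge_congruent n e2 e1"
proof -
  obtain g where "rigid_motion g" "maps_edge n g e1 e2" using assms by (auto simp: edge_congruent_def)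
  then show ?thesis using maps_edge_inv rigid_motion_inv(1) unfolding edge_congruent_def by blast
qed

text \<open>The concatenation of the three arcs is a simple closed path around the boundary.\<close>

lemma boundary_three_arcs:
  assumes a: "anticlockwise_boundary T n (\<alpha> +++ \<beta> +++ \<gamma>)"
    and ends: "pathfinish \<alpha> = pathstart \<beta>" "pathfinish \<beta> = pathstart \<gamma>" "pathfinish \<gamma> = pathstart \<alpha>"
    and arcs: "arc \<alpha>" "arc \<beta>" "arc \<gamma>"
  shows "disc_boundary T = path_image \<alpha> \<union> path_image \<beta> \<union> path_image \<gamma>"
    "path_image \<alpha> \<inter> path_image \<beta> \<subseteq> {pathstart \<beta>}"
    "path_image \<beta> \<inter> path_image \<gamma> \<subseteq> {pathstart \<gamma>}"
    "path_image \<gamma> \<inter> path_image \<alpha> \<subseteq> {pathstart \<alpha>}"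
proof -
  obtain h h' where h: "homeomorphism (cball (0::complex) 1) T h h'"
    and c: "\<And>t. t \<in> {0..1} \<Longrightarrow> (\<alpha> +++ \<beta> +++ \<gamma>) t = h (circlepath 0 1 t)"
    using a unfolding anticlockwise_boundary_def by blast
  interpret disc T h h' by unfold_locales (rule h)
  let ?c = "\<alpha> +++ \<beta> +++ \<gamma>"
  have circ: "path_image (circlepath 0 1) = sphere (0::complex) 1" by simp
  have sc: "sphere 0 1 \<subseteq> cball (0::complex) 1" by (rule sphere_cball)
  have sp0: "simple_path (h \<circ> circlepath 0 1)"
    by (rule simple_path_continuous_image)
      (use simple_path_circlepath circ continuous_on_subset[OF cont sc] inj_on_subset[OF inj sc] in auto)
  have "path ?c" by (rule path_eq[OF simple_path_imp_path[OF sp0]]) (use c in auto)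
  moreover have "loop_free ?c"
    using sp0 c unfolding simple_path_def loop_free_def by (simp only: comp_apply) metis
  ultimately have sp: "simple_path ?c" by (simp add: simple_path_def)
  have "path_image ?c = path_image (h \<circ> circlepath 0 1)"
    unfolding path_image_def using c by (intro image_cong) auto
  also have "\<dots> = disc_boundary T" by (simp add: path_image_compose circ boundary)
  finally show "disc_boundary T = path_image \<alpha> \<union> path_image \<beta> \<union> path_image \<gamma>"
    using ends by (simp add: path_image_join Un_assoc)
  have j: "arc (\<beta> +++ \<gamma>)" "path_image \<alpha> \<inter> path_image (\<beta> +++ \<gamma>) \<subseteq> {pathstart \<alpha>, pathstart \<beta>}"
    using simple_path_joinE[OF sp] ends by auto
  show bg: "path_image \<beta> \<inter> path_image \<gamma> \<subseteq> {pathstart \<gamma>}"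
    using j(1) arc_join_eq[OF ends(2)] by blast
  have j2: "path_image \<alpha> \<inter> (path_image \<beta> \<union> path_image \<gamma>) \<subseteq> {pathstart \<alpha>, pathstart \<beta>}"
    using j(2) by (simp add: path_image_join ends)
  have d: "pathstart \<alpha> \<noteq> pathstart \<beta>" "pathstart \<beta> \<noteq> pathstart \<gamma>" "pathstart \<gamma> \<noteq> pathstart \<alpha>"
    using arcs ends arc_distinct_ends by metis+
  have i: "pathstart \<alpha> \<in> path_image \<gamma>" "pathstart \<beta> \<in> path_image \<beta>"
    using pathfinish_in_path_image[of \<gamma>] pathstart_in_path_image[of \<beta>] by (simp_all only: ends)
  have "pathstart \<alpha> \<notin> path_image \<beta>" "pathstart \<beta> \<notin> path_image \<gamma>" using bg i d by auto
  then show "path_image \<alpha> \<inter> path_image \<beta> \<subseteq> {pathstart \<beta>}" "path_image \<gamma> \<inter> path_image \<alpha> \<subseteq> {pathstart \<alpha>}"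
    using j2 by auto
qed

locale type4_tiling = complete_tiled_surface k S N \<T> T n for k S N \<T> T n +
  fixes \<alpha> \<beta> \<gamma> :: "real \<Rightarrow> real^3"
  assumes T_in: "T \<in> \<T>" and N_T: "\<And>x. x \<in> T \<Longrightarrow> N x = n x"
    and type4: "three_edge_tile_type4 k T n \<alpha> \<beta> \<gamma>"
begin

abbreviation "edges \<equiv> {\<alpha>, \<beta>, \<gamma>}"

lemma arcs: "e \<in> edges \<Longrightarrow> arc e" and self_congruent: "e \<in> edges \<Longrightarrow> self_congruent n e"
  and tile_edges_eq: "tile_edges k T n = path_image ` edges"
  using type4 by (auto simp: three_edge_tile_type4_def)

lemma ends_match: "pathfinish \<alpha> = pathstart \<beta>" "pathfinish \<beta> = pathstart \<gamma>" "pathfinish \<gamma> = pathstart \<alpha>"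
  using type4 by (auto simp: three_edge_tile_type4_def)

lemma three_arcs:
  "disc_boundary T = path_image \<alpha> \<union> path_image \<beta> \<union> path_image \<gamma>"
  "path_image \<alpha> \<inter> path_image \<beta> \<subseteq> {pathstart \<beta>}"
  "path_image \<beta> \<inter> path_image \<gamma> \<subseteq> {pathstart \<gamma>}"
  "path_image \<gamma> \<inter> path_image \<alpha> \<subseteq> {pathstart \<alpha>}"
proof -
  have "anticlockwise_boundary T n (\<alpha> +++ \<beta> +++ \<gamma>)" using type4 by (simp add: three_edge_tile_type4_def)
  note * = boundary_three_arcs[OF this ends_match arcs[of \<alpha>] arcs[of \<beta>] arcs[of \<gamma>]]
  show "disc_boundary T = path_image \<alpha> \<union> path_image \<beta> \<union> path_image \<gamma>"
    "path_image \<alpha> \<inter> path_image \<beta> \<subseteq> {pathstart \<beta>}"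
    "path_image \<beta> \<inter> path_image \<gamma> \<subseteq> {pathstart \<gamma>}"
    "path_image \<gamma> \<inter> path_image \<alpha> \<subseteq> {pathstart \<alpha>}"
    using * by simp_all
qed

text \<open>Congruence of edges is symmetric, and type 4 excludes it for one order of each pair of edges.\<close>

lemma edges_eq_of_congruent:
  assumes "e \<in> edges" "f \<in> edges" "edge_congruent n e f"
  shows "e = f"
proof -
  have "\<not> edge_congruent n \<alpha> \<beta>" "\<not> edge_congruent n \<beta> \<gamma>" "\<not> edge_congruent n \<gamma> \<alpha>"
    using type4 by (simp_all add: three_edge_tile_type4_def)
  then show ?thesis using assms edge_congruent_sym by blast
qed

lemma boundary_subset: "disc_boundary T \<subseteq> T"
  by (rule tile_facts(4)[OF T_in])

lemma edge_subset: "e \<in> edges \<Longrightarrow> path_image e \<subseteq> disc_boundary T"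
  using three_arcs(1) by auto

lemma edge_open_part:
  assumes "e \<in> edges"
  obtains X where "openin (top_of_set (disc_boundary T)) X" "X \<noteq> {}" "X \<subseteq> path_image e"
    "\<And>f. f \<in> edges \<Longrightarrow> f \<noteq> e \<Longrightarrow> X \<inter> path_image f = {}"
    "path_image e - X \<subseteq> {pathstart e, pathfinish e}"
proof -
  define X where "X = disc_boundary T - \<Union>(path_image ` (edges - {e}))"
  have "closed (\<Union>(path_image ` (edges - {e})))"
    using arcs by (intro closed_UN) (auto simp: closed_arc_image)
  then have "openin (top_of_set (disc_boundary T)) X"
    unfolding X_def Diff_eq by (intro openin_open_Int open_Compl)
  moreover have sub: "X \<subseteq> path_image e" using three_arcs(1) assms by (auto simp: X_def)
  moreover have "X \<inter> path_image f = {}" if "f \<in> edges" "f \<noteq> e" for f using that by (auto simp: X_def)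
  moreover have rest: "path_image e - X \<subseteq> {pathstart e, pathfinish e}"
  proof
    fix x assume x: "x \<in> path_image e - X"
    then obtain f where "f \<in> edges" "f \<noteq> e" "x \<in> path_image f"
      using edge_subset[OF assms] by (auto simp: X_def)
    then show "x \<in> {pathstart e, pathfinish e}"
      using assms three_arcs(2-4) ends_match x by auto
  qed
  moreover have "X \<noteq> {}"
  proof
    assume "X = {}"
    then have "path_image e \<subseteq> {pathstart e, pathfinish e}" using rest by simp
    moreover have "e (1/2) \<in> path_image e" by (auto simp: path_image_def)
    moreover have "inj_on e {0..1}" using arcs[OF assms] by (simp add: arc_def)
    from inj_on_eq_iff[OF this, of "1/2" 0] inj_on_eq_iff[OF this, of "1/2" 1]
    have "e (1/2) \<noteq> e 0" "e (1/2) \<noteq> e 1" by auto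
    ultimately show False by (auto simp: pathstart_def pathfinish_def)
  qed
  ultimately show thesis using that by blast
qed

lemma edge_tangential:
  assumes e: "e \<in> edges"
  shows "tangential_start n e"
proof -
  have pT: "pathstart e \<in> T" and eT: "path_image e \<subseteq> T"
    using edge_subset[OF e] boundary_subset by auto
  have pS: "pathstart e \<in> S" and eS: "path_image e \<subseteq> S" using pT eT tile_subset[OF T_in] by auto
  obtain \<rho> where \<rho>: "0 < \<rho>" "\<And>y z. y \<in> S \<inter> ball (pathstart e) \<rho> \<Longrightarrow> z \<in> S \<inter> ball (pathstart e) \<rho> \<Longrightarrow>
      \<bar>(y - z) \<bullet> N (pathstart e)\<bar> \<le> 1/2 * norm (y - z)"
    using surface_secant_angle[OF k normal, of "pathstart e" "1/2"] pS interior_eq by auto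
  have "\<bar>(z - pathstart e) \<bullet> n (pathstart e)\<bar> \<le> norm (z - pathstart e) / 2"
    if "z \<in> path_image e \<inter> ball (pathstart e) \<rho>" for z
    using \<rho>(2)[of z "pathstart e"] \<rho>(1) that eS pS N_T[OF pT] by auto
  moreover have "\<forall>p\<in>S. norm (N p) = 1" using normal unfolding unit_normal_def by (elim conjE)
  then have "norm (n (pathstart e)) = 1" using pS N_T[OF pT] by metis
  ultimately show ?thesis unfolding tangential_start_def using arcs[OF e] \<rho>(1) by blast
qed

abbreviation "R e \<equiv> edge_rotation n e"

lemma R_rigid: "e \<in> edges \<Longrightarrow> rigid_motion (R e)"
  and R_maps: "e \<in> edges \<Longrightarrow> maps_edge n (R e) e (reversepath e)"
  and R_involution: "e \<in> edges \<Longrightarrow> R e \<circ> R e = id"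
  using edge_rotation[OF edge_tangential self_congruent] by blast+

text \<open>The image edge is congruent to \<open>e\<close>, hence equal to it. So the motion fixes or exchanges the ends of \<open>e\<close>,
  and it is determined by that.\<close>

lemma edge_to_edge_motion:
  assumes e: "e \<in> edges" and f: "rigid_motion f" "f ` path_image e \<in> tile_edges k T n"
    and n: "\<And>x. x \<in> path_image e \<Longrightarrow> linear_part f (n x) = n (f x)"
  shows "f = id \<or> f = R e"
proof -
  obtain e' where e': "e' \<in> edges" "f ` path_image e = path_image e'" using f(2) tile_edges_eq by auto
  have "edge_congruent n e e'"
    using unoriented_edge_congruence[OF arcs[OF e] arcs[OF e'(1)] f(1) e'(2) n self_congruent[OF e'(1)]] by blast
  then have "e' = e" using edges_eq_of_congruent[OF e e'(1)] by simp
  then have "maps_edge n f e e \<or> maps_edge n f e (reversepath e)"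
    using unoriented_edge_motion[OF arcs[OF e] arcs[OF e] f(1), of n] n e'(2) by blast
  then show ?thesis
    using edge_motion_fixing_ends[OF edge_tangential[OF e] f(1)]
      edge_motions_eq[OF edge_tangential[OF e] f(1) _ R_rigid[OF e] R_maps[OF e]] by blast
qed

lemma neighbours_corona: "corona k T n {B \<in> \<T>. B \<inter> T \<noteq> {}}"
  by (rule corona_of_neighbours[OF T_in N_T])

text \<open>\<open>T\<close> has a proper arc as edge in some corona. That corona is not a sphere of two tiles, so no tile in it
  shares the whole boundary with \<open>T\<close>, and all three edges are arcs shared with tiles of it.
  This is the situation excluded by \<open>no_other_corona\<close>.\<close>

lemma no_circle_neighbour:
  assumes B: "B \<in> \<T>" "B \<noteq> T"
  shows "T \<inter> B \<noteq> disc_boundary T"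
proof
  assume circ: "T \<inter> B = disc_boundary T"
  obtain h h' where "disc T h h'" using tile_disc[OF T_in] .
  then interpret T: disc T h h' .
  have bne: "disc_boundary T \<noteq> {}" using edge_subset[of \<alpha>] pathstart_in_path_image[of \<alpha>] by blast
  let ?C0 = "{B \<in> \<T>. B \<inter> T \<noteq> {}}"
  obtain N0 where N0: "tiled_surface k (\<Union>?C0) N0 ?C0 T n" "T \<in> ?C0" "\<And>x. x \<in> T \<Longrightarrow> N0 x = n x"
    "T \<subseteq> surface_interior k (\<Union>?C0)"
    by (rule corona_tiled_surface[OF k neighbours_corona]) (rule that)
  interpret two: tiled_surface k "\<Union>?C0" N0 ?C0 T n by (rule N0(1))
  have B0: "B \<in> ?C0" using B(1) circ bne by blast
  note two_tiles = two.circle_neighbour_unique[OF N0(2,4) B0 B(2) circ]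
  \<comment> \<open>A corona in which \<open>\<alpha>\<close> is an edge.\<close>
  have "path_image \<alpha> \<in> tile_edges k T n" using tile_edges_eq by simp
  then obtain \<C> A A' where C: "corona k T n \<C>" "A \<in> \<C>" "A' \<in> \<C>" "A \<noteq> A'" "path_image \<alpha> \<in> components (A \<inter> A')"
    unfolding tile_edges_def by blast
  obtain N1 where N1: "tiled_surface k (\<Union>\<C>) N1 \<C> T n" "T \<in> \<C>" "\<And>x. x \<in> T \<Longrightarrow> N1 x = n x"
    "T \<subseteq> surface_interior k (\<Union>\<C>)" "finite \<C>"
    using corona_tiled_surface[OF k C(1)] by metis
  interpret other: tiled_surface k "\<Union>\<C>" N1 \<C> T n by (rule N1(1))
  have proper: "path_image e \<noteq> disc_boundary T" if e: "e \<in> edges" for e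
  proof
    assume eq: "path_image e = disc_boundary T"
    have "\<alpha> \<noteq> \<beta>" using arcs[of \<alpha>] ends_match(1) arc_distinct_ends by (metis insertI1)
    then obtain f where f: "f \<in> edges" "f \<noteq> e" by blast
    obtain X where "X \<noteq> {}" "X \<subseteq> path_image f" "\<And>g. g \<in> edges \<Longrightarrow> g \<noteq> f \<Longrightarrow> X \<inter> path_image g = {}"
      using edge_open_part[OF f(1)] by metis
    then show False using eq e f edge_subset[OF f(1)] by blast
  qed
  have nocircle: "T \<inter> B1 \<noteq> disc_boundary T" if B1: "B1 \<in> \<C>" "B1 \<noteq> T" for B1
  proof
    assume c: "T \<inter> B1 = disc_boundary T"
    have "\<C> = {T, B1}" by (rule other.circle_neighbour_unique(1)[OF N1(2,4) B1 c])
    then have "A \<inter> A' = disc_boundary T" using C(2-4) c by blast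
    then have comp: "path_image \<alpha> \<in> components (disc_boundary T)" using C(5) by simp
    have "connected (disc_boundary T)"
      unfolding T.boundary
      by (intro connected_continuous_image continuous_on_subset[OF T.cont sphere_cball] connected_sphere) simp
    then have "components (disc_boundary T) = {disc_boundary T}" using bne by (simp add: components_eq_sing_iff)
    then show False using comp proper[of \<alpha>] by simp
  qed
  obtain g where g: "rigid_motion g" "g ` T = B" "\<And>x. x \<in> T \<Longrightarrow> linear_part g (n x) = N0 (g x)"
    using two.tile_motion[OF B0] by metis
  have cpt: "compact (disc_boundary T)" by (rule T.compact_boundary)
  obtain \<rho>0 where \<rho>0: "0 < \<rho>0" "\<And>p y z. p \<in> disc_boundary T \<Longrightarrow> y \<in> \<Union>?C0 \<inter> ball p \<rho>0 \<Longrightarrow> z \<in> \<Union>?C0 \<inter> ball p \<rho>0 \<Longrightarrow>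
      \<bar>(y - z) \<bullet> N0 p\<bar> \<le> norm (y - z) / 2"
    by (rule surface_secant_angle_uniform[OF k two.normal cpt order_trans[OF boundary_subset N0(4)]]) (rule that)
  obtain \<rho>1 where \<rho>1: "0 < \<rho>1" "\<And>p y z. p \<in> disc_boundary T \<Longrightarrow> y \<in> \<Union>\<C> \<inter> ball p \<rho>1 \<Longrightarrow> z \<in> \<Union>\<C> \<inter> ball p \<rho>1 \<Longrightarrow>
      \<bar>(y - z) \<bullet> N1 p\<bar> \<le> norm (y - z) / 2"
    by (rule surface_secant_angle_uniform[OF k other.normal cpt order_trans[OF boundary_subset N1(4)]]) (rule that)
  define r where "r = min \<rho>0 \<rho>1 / 5"
  have r: "0 < r" "4 * r < \<rho>0" "4 * r < \<rho>1" using \<rho>0(1) \<rho>1(1) by (auto simp: r_def)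
  interpret circle_corona k "\<Union>?C0" N0 ?C0 T n "\<Union>\<C>" N1 \<C> h h' B g r
  proof unfold_locales
    show "\<bar>(y - z) \<bullet> n p\<bar> \<le> norm (y - z) / 2"
      if p: "p \<in> disc_boundary T" and yz: "y \<in> \<Union>?C0 \<inter> cball p (4 * r)" "z \<in> \<Union>?C0 \<inter> cball p (4 * r)" for p y z
    proof -
      have "N0 p = n p" using p boundary_subset N0(3) by blast
      moreover have "cball p (4 * r) \<subseteq> ball p \<rho>0" using r by auto
      then have "\<bar>(y - z) \<bullet> N0 p\<bar> \<le> norm (y - z) / 2"
        by (intro \<rho>0(2)[OF p]) (use yz in blast)+
      ultimately show ?thesis by simp
    qed
    show "\<bar>(y - z) \<bullet> n p\<bar> \<le> norm (y - z) / 2"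
      if p: "p \<in> disc_boundary T" and yz: "y \<in> \<Union>\<C> \<inter> cball p (4 * r)" "z \<in> \<Union>\<C> \<inter> cball p (4 * r)" for p y z
    proof -
      have "N1 p = n p" using p boundary_subset N1(3) by blast
      moreover have "cball p (4 * r) \<subseteq> ball p \<rho>1" using r by auto
      then have "\<bar>(y - z) \<bullet> N1 p\<bar> \<le> norm (y - z) / 2"
        by (intro \<rho>1(2)[OF p]) (use yz in blast)+
      ultimately show ?thesis by simp
    qed
  qed (fact N0(2) two_tiles B(2) N0(3) N1(2-5) g r(1))+
  show False
  proof (rule no_other_corona[of "path_image ` edges"])
    show "finite (path_image ` edges)" by simp
    show "disc_boundary T \<subseteq> \<Union>(path_image ` edges)" using three_arcs(1) by auto
    show "E \<noteq> disc_boundary T" if "E \<in> path_image ` edges" for E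
      using that by (rule imageE) (simp only: proper not_False_eq_True)
    show "\<exists>A\<in>\<C>. A \<noteq> T \<and> E \<in> components (T \<inter> A)" if "E \<in> path_image ` edges" for E
    proof -
      from that obtain e where e: "E = path_image e" "e \<in> edges" by (rule imageE)
      obtain X where X: "openin (top_of_set (disc_boundary T)) X" "X \<noteq> {}" "X \<subseteq> path_image e"
        "\<And>f. f \<in> edges \<Longrightarrow> f \<noteq> e \<Longrightarrow> X \<inter> path_image f = {}"
        by (rule edge_open_part[OF e(2)]) (rule that)
      have disj: "X \<inter> F = {}" if "F \<in> tile_edges k T n" "F \<noteq> path_image e" for F
      proof -
        from that(1) obtain f where "F = path_image f" "f \<in> edges" unfolding tile_edges_eq by (rule imageE)
        then show ?thesis using X(4)[of f] that(2) by blast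
      qed
      obtain A where "A \<in> \<C>" "A \<noteq> T" "path_image e \<in> components (T \<inter> A)"
        by (rule corona_edge_neighbour[OF k C(1) X(1-3) disj nocircle])
      then show ?thesis unfolding e(1) by blast
    qed
  qed
qed

text \<open>The tiling seen from the tile \<open>g ` T\<close>.\<close>

lemma image_under_motion_of_tile:
  assumes g: "rigid_motion g" "g ` T \<in> \<T>" "\<And>x. x \<in> T \<Longrightarrow> linear_part g (n x) = N (g x)"
  shows "type4_tiling k (motion_inv g ` S) (\<lambda>x. linear_part (motion_inv g) (N (g x))) ((`) (motion_inv g) ` \<T>) T n \<alpha> \<beta> \<gamma>"
proof -
  note g' = rigid_motion_inv[OF g(1)]
  have "motion_inv (motion_inv g) = g" using bij_rigid_motion[OF g(1)] by (rule inv_inv_eq)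
  then interpret image: complete_tiled_surface k "motion_inv g ` S" "\<lambda>x. linear_part (motion_inv g) (N (g x))" "(`) (motion_inv g) ` \<T>" T n
    using complete_tiled_surface_rigid_image[OF complete_tiled_surface_axioms g'(1)] by simp
  have "motion_inv g ` g ` T = T" using g'(2) by (simp add: image_image)
  then have "T \<in> (`) (motion_inv g) ` \<T>" using g(2) by (metis imageI)
  moreover have "linear_part (motion_inv g) (N (g x)) = n x" if "x \<in> T" for x
    using g(3)[OF that] g'(4) by metis
  ultimately show ?thesis by unfold_locales (use type4 in auto)
qed

lemma edge_of_neighbour:
  assumes B: "B \<in> \<T>" "B \<noteq> T" and f: "rigid_motion f" "e \<in> edges" "f ` path_image e \<in> components (T \<inter> B)"
  shows "f ` path_image e \<in> tile_edges k T n"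
proof -
  have sub: "f ` path_image e \<subseteq> T \<inter> B" using f(3) by (rule in_components_subset)
  have b: "f ` path_image e \<subseteq> disc_boundary T" using sub overlap[OF T_in B(1)] B(2) by blast
  have "arc (f \<circ> e)"
    using arcs[OF f(2)] continuous_on_rigid_motion[OF f(1)] inj_rigid_motion[OF f(1)]
    by (auto simp: arc_def intro!: path_continuous_image comp_inj_on intro: inj_on_subset)
  moreover have "path_image (f \<circ> e) = f ` path_image e" by (rule path_image_compose)
  moreover have "B \<in> {B \<in> \<T>. B \<inter> T \<noteq> {}}" using B(1) sub f(3) in_components_nonempty by blast
  moreover have "T \<in> {B \<in> \<T>. B \<inter> T \<noteq> {}}" using T_in tile_facts(9)[OF T_in] by blast
  ultimately show ?thesis
    unfolding tile_edges_def using neighbours_corona b f(3) B(2) by blast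
qed

text \<open>Let \<open>B\<close> be the neighbour and \<open>f\<close> the motion placing it back onto \<open>T\<close>. In the tiling moved by \<open>f\<close>, \<open>T\<close> is
  again a tile, and it shares the image of \<open>e\<close> with the tile \<open>f ` T\<close>. So \<open>f\<close> maps an edge of \<open>T\<close> to an
  edge of \<open>T\<close>, and \<open>f\<close> is not the identity, which leaves the half-turn.\<close>

lemma neighbour_across_edge:
  assumes e: "e \<in> edges"
  shows "R e ` T \<in> \<T>" "R e ` T \<noteq> T" "path_image e \<in> components (T \<inter> R e ` T)"
    "\<And>x. x \<in> T \<Longrightarrow> linear_part (R e) (n x) = N (R e x)"
proof -
  obtain X where X: "openin (top_of_set (disc_boundary T)) X" "X \<noteq> {}" "X \<subseteq> path_image e"
    "\<And>f. f \<in> edges \<Longrightarrow> f \<noteq> e \<Longrightarrow> X \<inter> path_image f = {}"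
    using edge_open_part[OF e] by metis
  have disj: "X \<inter> F = {}" if "F \<in> tile_edges k T n" "F \<noteq> path_image e" for F
  proof -
    from that(1) obtain f where "F = path_image f" "f \<in> edges" unfolding tile_edges_eq by (rule imageE)
    then show ?thesis using X(4)[of f] that(2) by blast
  qed
  obtain B where B: "B \<in> \<T>" "B \<noteq> T" "path_image e \<in> components (T \<inter> B)"
  proof -
    have nocirc: "T \<inter> A \<noteq> disc_boundary T" if "A \<in> {B \<in> \<T>. B \<inter> T \<noteq> {}}" "A \<noteq> T" for A
      by (rule no_circle_neighbour) (use that in auto)
    obtain A where A: "A \<in> {B \<in> \<T>. B \<inter> T \<noteq> {}}" "A \<noteq> T" "path_image e \<in> components (T \<inter> A)"
      by (rule corona_edge_neighbour[OF k neighbours_corona X(1-3) disj nocirc])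
    show ?thesis by (rule that[of A]) (use A in simp_all)
  qed
  obtain h where h: "rigid_motion h" "h ` T = B" "\<And>x. x \<in> T \<Longrightarrow> linear_part h (n x) = N (h x)"
    using tile_motion[OF B(1)] by metis
  define f where "f = motion_inv h"
  note f = rigid_motion_inv[OF h(1), folded f_def]
  have fB: "f ` B = T" using h(2) f(2) by (auto simp: image_image)
  have eTB: "path_image e \<subseteq> T \<inter> B" using B(3) by (rule in_components_subset)
  interpret image: type4_tiling k "f ` S" "\<lambda>x. linear_part f (N (h x))" "(`) f ` \<T>" T n \<alpha> \<beta> \<gamma>
    unfolding f_def by (rule image_under_motion_of_tile[OF h(1) _ h(3)]) (use h(2) B(1) in simp)
  have fT: "f ` T \<in> (`) f ` \<T>" "f ` T \<noteq> T"
    using T_in B(2) fB inj_image_eq_iff[OF inj_rigid_motion[OF f(1)], of T B] by auto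
  have "f ` path_image e \<in> components (f ` (T \<inter> B))"
    by (rule homeomorphism_components[OF homeomorphism_rigid_motion[OF f(1)] B(3)])
  moreover have "f ` (T \<inter> B) = T \<inter> f ` T" using image_Int[OF inj_rigid_motion[OF f(1)], of T B] fB by auto
  ultimately have "f ` path_image e \<in> tile_edges k T n"
    using image.edge_of_neighbour[OF fT f(1) e] by simp
  moreover have "linear_part f (n x) = n (f x)" if x: "x \<in> path_image e" for x
  proof -
    have "x \<in> T" "x \<in> B" using x eTB by auto
    have "f x \<in> T" using fB \<open>x \<in> B\<close> by blast
    then have "linear_part h (n (f x)) = n x" using h(3) f(3) N_T[OF \<open>x \<in> T\<close>] by simp
    then show ?thesis using f(4) by metis
  qed
  ultimately have "f = id \<or> f = R e" by (rule edge_to_edge_motion[OF e f(1)])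
  moreover have "f \<noteq> id" using fB B(2) by auto
  ultimately have "f = R e" by blast
  moreover have "h = R e"
  proof
    fix x
    have "h x = f (f (h x))" using R_involution[OF e] f(2) \<open>f = R e\<close> by (metis comp_apply id_apply f(3))
    then show "h x = R e x" using f(2) \<open>f = R e\<close> by simp
  qed
  ultimately show "R e ` T \<in> \<T>" "R e ` T \<noteq> T" "path_image e \<in> components (T \<inter> R e ` T)"
    "\<And>x. x \<in> T \<Longrightarrow> linear_part (R e) (n x) = N (R e x)"
    using B h by auto
qed

definition placed :: "(real^3 \<Rightarrow> real^3) \<Rightarrow> bool" where
  "placed g \<longleftrightarrow> rigid_motion g \<and> g ` T \<in> \<T> \<and> (\<forall>x\<in>T. linear_part g (n x) = N (g x))"

lemma placed_id: "placed id"
  unfolding placed_def using T_in N_T rigid_motion_id by (simp add: linear_part_def)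

text \<open>In the tiling moved back by \<open>g\<close> the neighbours of \<open>T\<close> are the tiles \<open>R e ` T\<close>. This is why the
  group acts by composition on the right.\<close>

lemma placed_neighbour:
  assumes g: "placed g" and e: "e \<in> edges"
  shows "placed (g \<circ> R e)" "g ` R e ` T \<noteq> g ` T" "path_image e \<subseteq> T \<inter> R e ` T"
proof -
  have gr: "rigid_motion g" and gT: "g ` T \<in> \<T>" and gn: "\<And>x. x \<in> T \<Longrightarrow> linear_part g (n x) = N (g x)"
    using g by (auto simp: placed_def)
  note g' = rigid_motion_inv[OF gr]
  interpret image: type4_tiling k "motion_inv g ` S" "\<lambda>x. linear_part (motion_inv g) (N (g x))" "(`) (motion_inv g) ` \<T>" T n \<alpha> \<beta> \<gamma>
    by (rule image_under_motion_of_tile[OF gr gT gn])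
  note nb = image.neighbour_across_edge[OF e]
  obtain A where A: "A \<in> \<T>" "R e ` T = motion_inv g ` A" using nb(1) by blast
  have "g ` R e ` T = A" using A(2) g'(3) by (simp add: image_image)
  moreover have "linear_part (g \<circ> R e) (n x) = N ((g \<circ> R e) x)" if "x \<in> T" for x
    using nb(4)[OF that] g'(5) by (simp add: rigid_motion_comp(2)[OF gr R_rigid[OF e]])
  ultimately show "placed (g \<circ> R e)"
    using A(1) rigid_motion_comp(1)[OF gr R_rigid[OF e]] by (simp add: placed_def image_comp)
  show "g ` R e ` T \<noteq> g ` T" using nb(2) inj_image_eq_iff[OF inj_rigid_motion[OF gr]] by simp
  show "path_image e \<subseteq> T \<inter> R e ` T" using nb(3) by (rule in_components_subset)
qed

text \<open>The quotient of the two motions takes \<open>T\<close> to itself, hence an edge of \<open>T\<close> to an edge of \<open>T\<close>. If it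
  were the half-turn about that edge, \<open>T\<close> would be its own neighbour.\<close>

lemma placed_unique:
  assumes f: "placed f" and g: "placed g" and eq: "f ` T = g ` T"
  shows "f = g"
proof -
  have fr: "rigid_motion f" and gr: "rigid_motion g" using f g by (auto simp: placed_def)
  note g' = rigid_motion_inv[OF gr]
  define u where "u = motion_inv g \<circ> f"
  have u: "rigid_motion u" unfolding u_def by (rule rigid_motion_comp(1)[OF g'(1) fr])
  have uT: "u ` T = T"
  proof -
    have "u ` T = motion_inv g ` g ` T" unfolding u_def image_comp[symmetric] eq ..
    then show ?thesis using g'(2) by (simp add: image_image)
  qed
  have gu: "g (u x) = f x" for x using g'(3) by (simp add: u_def)
  have un: "linear_part u (n x) = n (u x)" if "x \<in> T" for x
  proof -
    have "u x \<in> T" using uT that by blast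
    then have "linear_part g (n (u x)) = linear_part f (n x)" using f g gu that by (simp add: placed_def)
    then show ?thesis using g'(4) by (metis comp_apply rigid_motion_comp(2)[OF g'(1) fr] u_def)
  qed
  have e: "\<alpha> \<in> edges" by simp
  note nb = neighbour_across_edge[OF e]
  \<comment> \<open>The tiling moved by \<open>u\<close> is again a tiling by the same tile.\<close>
  note u' = rigid_motion_inv[OF u]
  have u'T: "motion_inv u ` T = T" using uT u'(2) by (metis (no_types, lifting) image_cong image_ident image_image)
  have "linear_part (motion_inv u) (n x) = N (motion_inv u x)" if "x \<in> T" for x
  proof -
    have y: "motion_inv u x \<in> T" using u'T that by blast
    have "linear_part u (n (motion_inv u x)) = n x" using un[OF y] u'(3) by simp
    then show ?thesis using u'(4) N_T[OF y] by metis
  qed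
  moreover have "motion_inv (motion_inv u) = u" using bij_rigid_motion[OF u] by (rule inv_inv_eq)
  ultimately interpret image: type4_tiling k "u ` S" "\<lambda>x. linear_part u (N (motion_inv u x))" "(`) u ` \<T>" T n \<alpha> \<beta> \<gamma>
    using image_under_motion_of_tile[OF u'(1)] u'T T_in by simp
  have "u ` path_image \<alpha> \<in> components (u ` (T \<inter> R \<alpha> ` T))"
    by (rule homeomorphism_components[OF homeomorphism_rigid_motion[OF u] nb(3)])
  moreover have "u ` (T \<inter> R \<alpha> ` T) = T \<inter> u ` R \<alpha> ` T"
    using image_Int[OF inj_rigid_motion[OF u]] uT by simp
  moreover have "u ` R \<alpha> ` T \<in> (`) u ` \<T>" using nb(1) by blast
  moreover have "u ` R \<alpha> ` T \<noteq> T" using nb(2) uT inj_image_eq_iff[OF inj_rigid_motion[OF u]] by metis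
  ultimately have "u ` path_image \<alpha> \<in> tile_edges k T n"
    using image.edge_of_neighbour[OF _ _ u e] by simp
  then have "u = id \<or> u = R \<alpha>"
    using edge_to_edge_motion[OF e u] un edge_subset[OF e] boundary_subset by blast
  then have "u = id" using uT nb(2) by auto
  then show ?thesis using gu by (auto simp: fun_eq_iff)
qed

abbreviation "rotations \<equiv> generate (BijGroup UNIV) (R ` edges)"

lemma R_Bij: "e \<in> edges \<Longrightarrow> R e \<in> Bij UNIV"
  using bij_rigid_motion[OF R_rigid] by (simp add: Bij_def)

lemma R_subset_BijGroup: "R ` edges \<subseteq> carrier (BijGroup UNIV)"
  using R_Bij by (auto simp: BijGroup_def)

lemma rotations_subgroup: "subgroup rotations (BijGroup UNIV)"
  by (rule group.generate_is_subgroup[OF group_BijGroup R_subset_BijGroup])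

lemma rotations_Bij:
  assumes "g \<in> rotations"
  shows "g \<in> Bij UNIV"
proof -
  have "g \<in> carrier (BijGroup UNIV)" by (rule subsetD[OF subgroup.subset[OF rotations_subgroup] assms])
  then show ?thesis by (simp only: BijGroup_def partial_object.simps)
qed

lemma rotations_mult:
  assumes "f \<in> rotations" "g \<in> rotations"
  shows "f \<otimes>\<^bsub>BijGroup UNIV\<^esub> g = f \<circ> g"
  using rotations_Bij[OF assms(1)] rotations_Bij[OF assms(2)]
  by (simp add: BijGroup_def compose_def comp_def restrict_UNIV)

lemma rotations_comp: "f \<in> rotations \<Longrightarrow> g \<in> rotations \<Longrightarrow> f \<circ> g \<in> rotations"
  by (metis generate.eng rotations_mult)

lemma placed_rotations:
  assumes "r \<in> rotations" "placed g"
  shows "placed (g \<circ> r)"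
  using assms
proof (induction r arbitrary: g rule: generate.induct)
  case one
  have "\<one>\<^bsub>BijGroup UNIV\<^esub> = (id :: real^3 \<Rightarrow> real^3)" by (auto simp: BijGroup_def)
  then show ?case using one by simp
next
  case (incl h)
  then show ?case using placed_neighbour(1) by blast
next
  case (inv h)
  then obtain e where e: "e \<in> edges" "h = R e" by blast
  have "inv_into UNIV (R e) = R e" by (rule inv_unique_comp[OF R_involution[OF e(1)] R_involution[OF e(1)]])
  then have "m_inv (BijGroup UNIV) h = R e" unfolding e(2) inv_BijGroup[OF R_Bij[OF e(1)]] by (simp add: restrict_UNIV)
  then show ?case using placed_neighbour(1)[OF inv.prems e(1)] by (simp only:)
next
  case (eng r1 r2)
  have "placed ((g \<circ> r1) \<circ> r2)" by (rule eng.IH(2)[OF eng.IH(1)[OF eng.prems]])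
  then show ?case unfolding rotations_mult[OF eng.hyps] by (simp only: comp_assoc)
qed

lemma rotations_placed: "r \<in> rotations \<Longrightarrow> placed r"
  using placed_rotations[OF _ placed_id] by simp

text \<open>At a point of an edge other than its ends a tile of the orbit meets only its neighbour across the edge,
  which is also in the orbit.\<close>

lemma orbit_meets_rest_in_vertices:
  assumes g: "g \<in> rotations" and B: "B \<in> \<T>" "\<And>r. r \<in> rotations \<Longrightarrow> B \<noteq> r ` T"
  shows "g ` T \<inter> B \<subseteq> g ` (pathstart ` edges)"
proof
  fix p assume p: "p \<in> g ` T \<inter> B"
  have pg: "placed g" by (rule rotations_placed[OF g])
  then have gr: "rigid_motion g" and gT: "g ` T \<in> \<T>" by (auto simp: placed_def)
  have bd: "disc_boundary (g ` T) = g ` disc_boundary T" by (rule disc_boundary_rigid_image[OF prototile gr])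
  have "p \<in> g ` disc_boundary T" using overlap[OF gT B(1)] B(2)[OF g] p bd by blast
  then obtain x e where x: "p = g x" "e \<in> edges" "x \<in> path_image e" using three_arcs(1) by auto
  obtain X where X: "openin (top_of_set (disc_boundary T)) X" "X \<subseteq> path_image e" "path_image e - X \<subseteq> {pathstart e, pathfinish e}"
    using edge_open_part[OF x(2)] by metis
  have "x \<notin> X"
  proof
    assume "x \<in> X"
    note nb = placed_neighbour[OF pg x(2)]
    have gR: "g \<circ> R e \<in> rotations" by (rule rotations_comp[OF g generate.incl]) (use x(2) in blast)
    have "(g \<circ> R e) ` T \<in> \<T>" using nb(1) by (simp add: placed_def)
    moreover have "g ` T \<noteq> (g \<circ> R e) ` T" using nb(2) by (simp add: image_comp)
    moreover have "openin (top_of_set (disc_boundary (g ` T))) (g ` X)" unfolding bd by (rule openin_rigid_image[OF gr X(1)])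
    moreover have "g ` X \<subseteq> (g \<circ> R e) ` T" using X(2) nb(3) by (auto simp: image_comp[symmetric])
    moreover have "p \<in> g ` X" unfolding x(1) using \<open>x \<in> X\<close> by (rule imageI)
    ultimately have "B = g ` T \<or> B = (g \<circ> R e) ` T"
      by (rule two_tiles_at_common_arc[OF gT _ _ B(1) IntD2[OF p]])
    then show False
    proof
      assume "B = g ` T" with B(2)[OF g] show False by (rule notE)
    next
      assume "B = (g \<circ> R e) ` T" with B(2)[OF gR] show False by (rule notE)
    qed
  qed
  then have "x \<in> {pathstart e, pathfinish e}" using x(3) X(3) by blast
  then have "x \<in> pathstart ` edges" using x(2) ends_match by auto
  then show "p \<in> g ` (pathstart ` edges)" using x(1) by blast
qed

text \<open>The union of the orbit and the union of the remaining tiles are closed, so if both are nonempty they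
  meet, and they do so in a countable set \<open>I\<close>. A small disc around a point of \<open>I\<close> stays connected
  without \<open>I\<close>, but is then split into two nonempty closed parts.\<close>

theorem rotations_transitive:
  assumes B: "B \<in> \<T>"
  obtains g where "g \<in> rotations" "B = g ` T"
proof (rule ccontr)
  assume "\<not> thesis"
  then have BO: "B \<notin> (\<lambda>g. g ` T) ` rotations" using that by blast
  define O1 where "O1 = (\<lambda>g. g ` T) ` rotations"
  define O2 where "O2 = \<T> - O1"
  have O1: "O1 \<subseteq> \<T>" using rotations_placed by (auto simp: O1_def placed_def)
  have TO1: "T \<in> O1" unfolding O1_def by (rule image_eqI[OF _ generate.one]) (auto simp: BijGroup_def)
  have BO2: "B \<in> O2" using B BO by (simp add: O1_def O2_def)
  have cl: "closed (\<Union>O1)" "closed (\<Union>O2)" using O1 by (auto intro!: closed_union_tiles simp: O2_def)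
  have cov: "S = \<Union>O1 \<union> \<Union>O2" using union O1 by (auto simp: O2_def)
  define I where "I = \<Union>O1 \<inter> \<Union>O2"
  have "I \<noteq> {}"
  proof
    assume "I = {}"
    then have "\<Union>O1 \<inter> S = {} \<or> \<Union>O2 \<inter> S = {}"
      using connected_closedD[OF connected_surface _ _ cl] cov by (auto simp: I_def)
    then show False using TO1 BO2 cov tile_facts(9)[OF T_in] tile_facts(9)[OF B] by blast
  qed
  then obtain p where p: "p \<in> I" by blast
  have "I \<subseteq> (\<Union>A\<in>O1. A \<inter> \<Union>O2)" by (auto simp: I_def)
  moreover have "countable (A \<inter> \<Union>O2)" if A: "A \<in> O1" for A
  proof -
    obtain g where g: "g \<in> rotations" "A = g ` T" using A by (auto simp: O1_def)
    have "A \<inter> \<Union>O2 \<subseteq> g ` (pathstart ` edges)"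
      using orbit_meets_rest_in_vertices[OF g(1)] g(2) unfolding O2_def O1_def by blast
    moreover have "countable (g ` (pathstart ` edges))" by simp
    ultimately show ?thesis by (rule countable_subset)
  qed
  ultimately have cI: "countable I"
    using countable_subset[OF O1 countable_tiles] by (meson countable_UN countable_subset)
  have "p \<in> surface_interior k S" using p cov interior_eq by (auto simp: I_def)
  then obtain \<phi> \<psi> V where c: "surface_param k \<phi> V" "p \<in> \<phi> ` V" "openin (top_of_set S) (\<phi> ` V)"
    "homeomorphism V (\<phi> ` V) \<phi> \<psi>" "open V"
    by (rule surface_interior_chart)
  obtain x0 where x0: "x0 \<in> V" "p = \<phi> x0" using c(2) by blast
  obtain \<epsilon> where \<epsilon>: "0 < \<epsilon>" "ball x0 \<epsilon> \<subseteq> V" using c(5) x0(1) by (meson openE)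
  have inj: "inj_on \<phi> V" by (rule inj_on_inverseI[of _ \<psi>]) (rule homeomorphism_apply1[OF c(4)])
  define Q where "Q = V \<inter> \<phi> -` I"
  have "countable (\<phi> ` Q)" by (rule countable_subset[OF _ cI]) (auto simp: Q_def)
  then have "countable Q" using countable_image_inj_on inj_on_subset[OF inj, of Q] by (auto simp: Q_def)
  then have "connected (ball x0 \<epsilon> - Q)" by (intro connected_open_diff_countable) auto
  then have conn: "connected (\<phi> ` (ball x0 \<epsilon> - Q))"
    by (rule connected_continuous_image[rotated])
      (use \<epsilon>(2) in \<open>auto intro: continuous_on_subset[OF homeomorphism_cont1[OF c(4)]]\<close>)
  have W: "openin (top_of_set S) (\<phi> ` ball x0 \<epsilon>)"
  proof -
    have "openin (top_of_set V) (ball x0 \<epsilon>)" using \<epsilon>(2) c(5) by (simp add: openin_open_eq)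
    then have "openin (top_of_set (\<phi> ` V)) (\<phi> ` ball x0 \<epsilon>)" by (rule homeomorphism_imp_open_map[OF c(4)])
    then show ?thesis using c(3) by (rule openin_trans)
  qed
  have pW: "p \<in> \<phi> ` ball x0 \<epsilon>" using x0 \<epsilon>(1) by auto
  have meets: "\<exists>y. y \<in> \<phi> ` (ball x0 \<epsilon> - Q) \<and> y \<in> A"
    if A: "A \<in> \<T>" "p \<in> A" and sep: "\<And>y. y \<in> I \<Longrightarrow> y \<in> A \<Longrightarrow> \<exists>D\<in>\<T>. D \<noteq> A \<and> y \<in> D" for A
  proof -
    obtain y where y: "y \<in> \<phi> ` ball x0 \<epsilon>" "y \<in> A - disc_boundary A"
      using interior_meets_neighbourhood[OF A W pW] by blast
    have "y \<notin> I"
    proof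
      assume "y \<in> I"
      then obtain D where "D \<in> \<T>" "D \<noteq> A" "y \<in> D" using sep[of y] y(2) by blast
      then show False using interior_unique[OF A(1) _ y(2)] by blast
    qed
    then show ?thesis using y \<epsilon>(2) by (auto simp: Q_def)
  qed
  obtain A1 where A1: "A1 \<in> O1" "p \<in> A1" using p by (auto simp: I_def)
  obtain A2 where A2: "A2 \<in> O2" "p \<in> A2" using p by (auto simp: I_def)
  obtain y1 where y1: "y1 \<in> \<phi> ` (ball x0 \<epsilon> - Q)" "y1 \<in> A1"
  proof -
    have "\<exists>y. y \<in> \<phi> ` (ball x0 \<epsilon> - Q) \<and> y \<in> A1"
    proof (rule meets)
      show "A1 \<in> \<T>" "p \<in> A1" using A1 O1 by (auto simp: O2_def)
      fix y assume "y \<in> I" "y \<in> A1"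
      then obtain D where D: "D \<in> O2" "y \<in> D" by (auto simp: I_def)
      have "D \<in> \<T>" "D \<noteq> A1" using D(1) A1(1) O1 by (auto simp: O2_def)
      then show "\<exists>D\<in>\<T>. D \<noteq> A1 \<and> y \<in> D" using D(2) by blast
    qed
    then show ?thesis using that by blast
  qed
  obtain y2 where y2: "y2 \<in> \<phi> ` (ball x0 \<epsilon> - Q)" "y2 \<in> A2"
  proof -
    have "\<exists>y. y \<in> \<phi> ` (ball x0 \<epsilon> - Q) \<and> y \<in> A2"
    proof (rule meets)
      show "A2 \<in> \<T>" "p \<in> A2" using A2 O1 by (auto simp: O2_def)
      fix y assume "y \<in> I" "y \<in> A2"
      then obtain D where D: "D \<in> O1" "y \<in> D" by (auto simp: I_def)
      have "D \<in> \<T>" "D \<noteq> A2" using D(1) A2(1) O1 by (auto simp: O2_def)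
      then show "\<exists>D\<in>\<T>. D \<noteq> A2 \<and> y \<in> D" using D(2) by blast
    qed
    then show ?thesis using that by blast
  qed
  have sub: "\<phi> ` (ball x0 \<epsilon> - Q) \<subseteq> S - I"
  proof
    fix y assume "y \<in> \<phi> ` (ball x0 \<epsilon> - Q)"
    then obtain x where x: "x \<in> V" "x \<notin> Q" "y = \<phi> x" using \<epsilon>(2) by blast
    then have "y \<notin> I" by (simp add: Q_def)
    moreover have "y \<in> S" using openin_imp_subset[OF c(3)] x(1,3) by blast
    ultimately show "y \<in> S - I" by blast
  qed
  have "\<Union>O1 \<inter> \<phi> ` (ball x0 \<epsilon> - Q) = {} \<or> \<Union>O2 \<inter> \<phi> ` (ball x0 \<epsilon> - Q) = {}"
    by (rule connected_closedD[OF conn _ _ cl]) (use sub cov in \<open>auto simp: I_def\<close>)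
  then show False using y1 y2 A1(1) A2(1) by blast
qed

text \<open>All powers of \<open>r\<close> place \<open>T\<close> onto tiles containing \<open>v\<close>. There are finitely many of these, so two powers
  place \<open>T\<close> onto the same tile and therefore agree.\<close>

lemma tile_finite_order:
  assumes r: "r \<in> rotations" and v: "v \<in> T" "r v = v"
  shows "\<exists>m>0. r ^^ m = id"
proof -
  have pow: "r ^^ m \<in> rotations" for m
  proof (induction m)
    case 0
    have "\<one>\<^bsub>BijGroup UNIV\<^esub> = (id :: real^3 \<Rightarrow> real^3)" by (auto simp: BijGroup_def)
    then show ?case using generate.one by (metis funpow_0 id_apply ext)
  next
    case (Suc m)
    show ?case unfolding funpow.simps(2) by (rule rotations_comp[OF r Suc.IH])
  qed
  have fixv: "(r ^^ m) v = v" for m by (induction m) (use v(2) in auto)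
  have "range (\<lambda>m. (r ^^ m) ` T) \<subseteq> {A \<in> \<T>. A \<inter> {v} \<noteq> {}}"
  proof
    fix A assume "A \<in> range (\<lambda>m. (r ^^ m) ` T)"
    then obtain m where m: "A = (r ^^ m) ` T" by blast
    have "v \<in> A" using fixv[of m] v(1) m by (metis imageI)
    then show "A \<in> {A \<in> \<T>. A \<inter> {v} \<noteq> {}}" using rotations_placed[OF pow[of m]] m by (auto simp: placed_def)
  qed
  then have "finite (range (\<lambda>m. (r ^^ m) ` T))" using locally_finite_tiling[of "{v}"] finite_subset by auto
  then have "\<not> inj (\<lambda>m. (r ^^ m) ` T)" using finite_imageD infinite_UNIV_nat by blast
  then obtain i j where ij: "i < j" "(r ^^ i) ` T = (r ^^ j) ` T"
    unfolding inj_def by (metis linorder_neqE_nat)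
  have "r ^^ i = r ^^ j" by (rule placed_unique[OF rotations_placed[OF pow] rotations_placed[OF pow] ij(2)])
  also have "r ^^ j = r ^^ i \<circ> r ^^ (j - i)" using ij(1) by (metis funpow_add le_add_diff_inverse less_imp_le)
  finally have eq: "r ^^ i = r ^^ i \<circ> r ^^ (j - i)" .
  have "inj (r ^^ i)" using rotations_Bij[OF pow[of i]] by (simp add: Bij_def bij_is_inj)
  then have "(r ^^ (j - i)) x = x" for x using fun_cong[OF eq, of x] by (simp add: inj_eq)
  then show ?thesis using ij(1) by (intro exI[of _ "j - i"]) auto
qed

end

theorem theorem21:
  fixes k :: enat
    and S T :: "(real^3) set"
    and N :: "real^3 \<Rightarrow> real^3"
    and \<T> :: "(real^3) set set"
    and \<alpha> \<beta> \<gamma> :: "real \<Rightarrow> real^3"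
    and R\<^sub>\<alpha> R\<^sub>\<beta> R\<^sub>\<gamma> :: "real^3 \<Rightarrow> real^3"
  assumes "1 \<le> k"
    and "complete_surface k S"
    and "oriented_monotiling k S N \<T> T N"
    and "T \<in> \<T>"
    and "three_edge_tile_type4 k T N \<alpha> \<beta> \<gamma>"
    and "R\<^sub>\<alpha> = edge_rotation N \<alpha>"
    and "R\<^sub>\<beta> = edge_rotation N \<beta>"
    and "R\<^sub>\<gamma> = edge_rotation N \<gamma>"
  shows "transitive_action (generated_group {R\<^sub>\<alpha>, R\<^sub>\<beta>, R\<^sub>\<gamma>}) \<T> (\<lambda>g. \<lambda>A\<in>\<T>. g ` A) \<and>
         (\<exists>m>0. (R\<^sub>\<beta> \<circ> R\<^sub>\<gamma> \<circ> R\<^sub>\<alpha>) ^^ m = id)"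
proof -
  interpret type4_tiling k S N \<T> T N \<alpha> \<beta> \<gamma>
    by unfold_locales (use assms in auto)
  have Rs: "R ` edges = {R\<^sub>\<alpha>, R\<^sub>\<beta>, R\<^sub>\<gamma>}" using assms(6-8) by simp
  let ?G = "generated_group {R\<^sub>\<alpha>, R\<^sub>\<beta>, R\<^sub>\<gamma>}" and ?act = "\<lambda>g. \<lambda>A\<in>\<T>. g ` A"
  have carr: "carrier ?G = rotations" unfolding generated_group_def Rs by simp
  have mult: "f \<otimes>\<^bsub>?G\<^esub> g = f \<circ> g" if "f \<in> rotations" "g \<in> rotations" for f g
    using rotations_mult[OF that] by (simp add: generated_group_def)
  have grp: "group ?G"
    unfolding generated_group_def Rs[symmetric]
    by (rule subgroup.subgroup_is_group[OF rotations_subgroup group_BijGroup])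
  have maps: "g ` A \<in> \<T>" if g: "g \<in> rotations" and A: "A \<in> \<T>" for g A
  proof -
    obtain f where f: "f \<in> rotations" "A = f ` T" using rotations_transitive[OF A] .
    then show ?thesis using rotations_placed[OF rotations_comp[OF g f(1)]] by (simp add: placed_def image_comp)
  qed
  have inverse: "\<exists>g'\<in>rotations. g' \<circ> g = id \<and> g \<circ> g' = id" if g: "g \<in> rotations" for g
  proof -
    have one: "\<one>\<^bsub>?G\<^esub> = id" by (auto simp: generated_group_def BijGroup_def)
    obtain g' where "g' \<in> carrier ?G" "g' \<otimes>\<^bsub>?G\<^esub> g = \<one>\<^bsub>?G\<^esub>" "g \<otimes>\<^bsub>?G\<^esub> g' = \<one>\<^bsub>?G\<^esub>"
      using group.l_inv[OF grp] group.r_inv[OF grp] group.inv_closed[OF grp] g carr by metis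
    then show ?thesis using mult g carr one by metis
  qed
  have bij: "?act g \<in> Bij \<T>" if g: "g \<in> rotations" for g
  proof -
    obtain g' where g': "g' \<in> rotations" "g' \<circ> g = id" "g \<circ> g' = id" using inverse[OF g] by blast
    have "bij_betw (\<lambda>A. g ` A) \<T> \<T>"
    proof (rule bij_betw_byWitness[where f' = "\<lambda>A. g' ` A"])
      show "\<forall>A\<in>\<T>. g' ` g ` A = A" "\<forall>A\<in>\<T>. g ` g' ` A = A" using g'(2,3) by (simp_all add: image_comp)
    qed (use maps g g'(1) in auto)
    then have "bij_betw (?act g) \<T> \<T>" by (rule bij_betw_cong[THEN iffD1, rotated]) simp
    then show ?thesis by (simp add: Bij_def)
  qed
  have "?act \<in> hom ?G (BijGroup \<T>)"
  proof (rule homI)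
    show "?act g \<in> carrier (BijGroup \<T>)" if "g \<in> carrier ?G" for g
      using bij that carr by (simp add: BijGroup_def)
    show "?act (f \<otimes>\<^bsub>?G\<^esub> g) = ?act f \<otimes>\<^bsub>BijGroup \<T>\<^esub> ?act g" if "f \<in> carrier ?G" "g \<in> carrier ?G" for f g
    proof -
      have fg: "f \<in> rotations" "g \<in> rotations" using that carr by auto
      have "?act (f \<circ> g) = compose \<T> (?act f) (?act g)"
        by (rule ext) (use maps[OF fg(2)] in \<open>auto simp: compose_def restrict_def image_comp\<close>)
      then show ?thesis using bij fg mult[OF fg] by (simp add: BijGroup_def)
    qed
  qed
  then have "group_hom ?G (BijGroup \<T>) ?act"
    using grp group_BijGroup by (simp add: group_hom_def group_hom_axioms_def)
  then have "group_action ?G \<T> ?act" by (simp add: group_action_def)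
  moreover have "\<exists>g\<in>carrier ?G. ?act g A = B" if AB: "A \<in> \<T>" "B \<in> \<T>" for A B
  proof -
    obtain f where f: "f \<in> rotations" "A = f ` T" using rotations_transitive[OF AB(1)] .
    obtain g where g: "g \<in> rotations" "B = g ` T" using rotations_transitive[OF AB(2)] .
    obtain f' where f': "f' \<in> rotations" "f' \<circ> f = id" using inverse[OF f(1)] by blast
    have "(g \<circ> f') ` A = g ` (f' \<circ> f) ` T" unfolding f(2) by (simp only: image_comp comp_assoc)
    then have "(g \<circ> f') ` A = B" unfolding f'(2) g(2) by simp
    then show ?thesis using rotations_comp[OF g(1) f'(1)] carr AB(1) by (intro bexI[of _ "g \<circ> f'"]) auto
  qed
  ultimately have act: "transitive_action ?G \<T> ?act"
    by (simp add: transitive_action_def transitive_action_axioms_def)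
  have swap: "R e (pathstart e) = pathfinish e" "R e (pathfinish e) = pathstart e" if "e \<in> edges" for e
    using R_maps[OF that] by (auto simp: maps_edge_def)
  have incl: "R\<^sub>\<alpha> \<in> rotations" "R\<^sub>\<beta> \<in> rotations" "R\<^sub>\<gamma> \<in> rotations"
    by (rule generate.incl, use Rs in blast)+
  have "R\<^sub>\<beta> \<circ> R\<^sub>\<gamma> \<circ> R\<^sub>\<alpha> \<in> rotations" by (intro rotations_comp incl)
  moreover have "pathstart \<beta> \<in> T"
    using edge_subset[of \<beta>] boundary_subset pathstart_in_path_image[of \<beta>] by blast
  moreover have "(R\<^sub>\<beta> \<circ> R\<^sub>\<gamma> \<circ> R\<^sub>\<alpha>) (pathstart \<beta>) = pathstart \<beta>"
    using swap[of \<alpha>] swap[of \<beta>] swap[of \<gamma>] ends_match assms(6-8) by simp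
  ultimately have "\<exists>m>0. (R\<^sub>\<beta> \<circ> R\<^sub>\<gamma> \<circ> R\<^sub>\<alpha>) ^^ m = id" by (rule tile_finite_order)
  with act show ?thesis by blast
qed

end
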